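(* (1) (Case $w_0=\lim_N W_N=\infty$.) Let $m_0>0$ and let $\{X_i\}_{i\ge 1}$ be an infinite i.i.d. sequence of exponential random variables with rate $1/m_0$ (mean $m_0$). For every $N$, define $$W_N=\sum_{i=1}^N X_i,\qquad \mu_0^N=\frac1N\sum_{i=1}^N\delta_{X_i}.$$ Then, as $N\to\infty$, $\mu_0^N\Rightarrow\mu_0$ weakly almost surely, where $\mu_0(dx)=\frac1{m_0}e^{-x/m_0}\,dx$. Therefore the mean-field limit holds for this initial data: $(\mu_t^N)_{t\ge0}$ converges in probability in $D([0,\infty);\mathcal{M}_1(\mathbb{R}_+))$ to a limit $(\mu_t)_{t\ge 0}$ that is continuous in $t$ and solves the kinetic equation $\mu_t=\mu_0+\int_0^tQ(\mu_s)\,ds$ (with $w_0=\infty$), and for all $g\in C_b(\mathbb{R}_+)$ and $t\ge 0$, in probability as $N\to\infty$, $\sup_{s\le t}\langle g,\mu_s^N-\mu_s\rangle\to0$, $\sup_{s\le t}|M_s^{g,N}|\to0$ and $\int_0^t\langle g,Q^{(N)}(\mu_s^N)\rangle\,ds\to\int_0^t\langle g,Q(\mu_s)\rangle\,ds$. Moreover $\mu_0$ remains invariant in time, i.e. $\mu_t=\mu_0$ for all $t\ge 0$. (2) (Case $w_0<\infty$.) Suppose $\lim_{N\to\infty}W_N=w_0\in(0,\infty)$. Then there does not exist a sequence $\{\mu_0^N\}_{N\in\mathbb{N}}$ of empirical measures of $N$-agent systems with total wealth $W_N$ such that $\mu_0^N\Rightarrow\mu_0$ with $\mu_0$ having a density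 of the form $$\tilde f(x)=\frac{e^{-x/m}}{m(1-e^{-w_0/m})}\mathbf{1}_{\{x\le w_0\}},\qquad m>0.$$
   Context: $\mathcal{M}_1(\mathbb{R}_+)$ is the space of probability measures on $\mathbb{R}_+=[0,\infty)$ with the weak topology, $D([0,\infty);\mathcal{M}_1(\mathbb{R}_+))$ is the Skorokhod space, $C_b(\mathbb{R}_+)$ is the set of bounded continuous functions, and $\langle g,\mu\rangle=\int g\,d\mu$. An empirical measure of an $N$-agent system with total wealth $W_N$ is a measure $\frac1N\sum_{i=1}^N\delta_{x_i}$ with $x_i\ge 0$ and $\sum_{i=1}^N x_i=W_N$. Particle system: for each $N\ge 2$, $\mathbf{X}^N_t=(X^{1,N}_t,\dots,X^{N,N}_t)$ is the continuous-time Markov jump process of nonnegative wealths with conserved total $W_N=\sum_i X^{i,N}_t$ (in (1), started from $(X_1,\dots,X_N)$) in which each ordered pair $(i,j)$ with $i\ne j$ interacts at rate $1/N$. At an interaction, a fresh independent $r$ uniform on $[0,1]$ is drawn and $(X^{i,N},X^{j,N})$ is replaced by $(r(X^{i,N}+X^{j,N}),(1-r)(X^{i,N}+X^{j,N}))$. The empirical measure is $\mu_t^N=\frac1N\sum_{i=1}^N\delta_{X_t^{i,N}}$. Set $\mu^{(2,N)}(A\times B)=\mu^N(A)\mu^N(B)-\frac1N\mu^N(A\cap B)$ and, for $g\in C_b(\mathbb{R}_+)$, $$\langle g,Q^{(N)}(\mu^N)\rangle=\int_0^1\int_{\mathbb{R}_+^2}\big(g(r(x+y))+g((1-r)(x+y))-g(x)-g(y)\big)\mathbf{1}_{\{x+y\le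 W_N\}}\mu^{(2,N)}(dx,dy)\,dr,$$ $$\langle g,Q(\mu)\rangle=\int_0^1\int_{\mathbb{R}_+^2}\big(g(r(x+y))+g((1-r)(x+y))-g(x)-g(y)\big)\mathbf{1}_{\{x+y\le w_0\}}\mu(dx)\mu(dy)\,dr,$$ $$M_t^{g,N}=\langle g,\mu_t^N\rangle-\langle g,\mu_0^N\rangle-\int_0^t\langle g,Q^{(N)}(\mu_s^N)\rangle\,ds.$$ The kinetic equation is understood weakly, tested against all $g\in C_b(\mathbb{R}_+)$; for $w_0=\infty$ the indicator in $Q$ is identically $1$. *)

theory Defs
  imports "HOL-Probability.Probability"
begin

section \<open>Probability measures on the half-line\<close>

definition Rplus :: "real measure" where
  "Rplus = restrict_space borel {0..}"

definition prob_measures :: "real measure set" where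
  "prob_measures = {\<mu>. prob_space \<mu> \<and> sets \<mu> = sets Rplus}"

text \<open>Test functions are functions on the half-line: their values at negative reals play no role.\<close>

definition C_b :: "(real \<Rightarrow> real) set" where
  "C_b = {g. continuous_on {0..} g \<and> bounded (g ` {0..})}"

definition weak_topology :: "real measure topology" where
  "weak_topology = topology_generated_by
     {{\<mu> \<in> prob_measures. (LINT x|\<mu>. g x) \<in> U} | g U. g \<in> C_b \<and> open U}"

lemma topspace_weak_topology: "topspace weak_topology = prob_measures"
proof -
  have "(\<lambda>_. 0) \<in> C_b" by (auto simp: C_b_def bounded_iff)
  then show ?thesis
    unfolding weak_topology_def topology_generated_by_topspace by blast
qed

text \<open>The empirical measure of \<open>x 0, \<dots>, x (N - 1)\<close> as the image of the uniform distribution on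
  the set of indices.\<close>

definition empirical :: "nat \<Rightarrow> (nat \<Rightarrow> real) \<Rightarrow> real measure" where
  "empirical N x = distr (uniform_count_measure {..<N}) Rplus x"

definition is_empirical_measure :: "nat \<Rightarrow> real \<Rightarrow> real measure \<Rightarrow> bool" where
  "is_empirical_measure N W \<nu> \<longleftrightarrow>
     (\<exists>x. (\<forall>i<N. 0 \<le> x i) \<and> (\<Sum>i<N. x i) = W \<and> \<nu> = empirical N x)"

lemma empirical_measurable:
  assumes "\<And>i. i < N \<Longrightarrow> 0 \<le> x i"
  shows "x \<in> measurable (uniform_count_measure {..<N}) Rplus"
  using assms
  by (auto simp: measurable_def Rplus_def space_restrict_space space_uniform_count_measure
      sets_uniform_count_measure)

lemma emeasure_empirical:
  assumes x: "\<And>i. i < N \<Longrightarrow> 0 \<le> x i" and A: "A \<in> sets Rplus"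
  shows "emeasure (empirical N x) A = ennreal ((1 / N) * (\<Sum>i<N. indicator A (x i)))"
proof -
  have eq: "x -` A \<inter> {..<N} = {i \<in> {..<N}. x i \<in> A}" by auto
  have "emeasure (empirical N x) A = emeasure (uniform_count_measure {..<N}) (x -` A \<inter> {..<N})"
    unfolding empirical_def
    by (simp add: emeasure_distr[OF empirical_measurable[OF x] A] space_uniform_count_measure)
  also have "\<dots> = ennreal (card (x -` A \<inter> {..<N}) / N)"
    by (simp add: emeasure_uniform_count_measure)
  also have "real (card (x -` A \<inter> {..<N})) = (\<Sum>i<N. indicator A (x i))"
    unfolding eq by (simp add: indicator_def sum.If_cases Int_def)
  finally show ?thesis by simp
qed

lemma prob_space_empirical:
  assumes "\<And>i. i < N \<Longrightarrow> 0 \<le> x i" "0 < N"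
  shows "prob_space (empirical N x)"
  unfolding empirical_def using assms
  by (intro prob_space.prob_space_distr prob_space_uniform_count_measure empirical_measurable) auto


section \<open>The Skorokhod space\<close>

text \<open>The Prokhorov metric on \<^const>\<open>prob_measures\<close>, which metrizes \<^const>\<open>weak_topology\<close>.\<close>

definition prokhorov_dist :: "real measure \<Rightarrow> real measure \<Rightarrow> real" where
  "prokhorov_dist \<mu> \<nu> = Inf {e. 0 < e \<and>
     (\<forall>F. closed F \<and> F \<subseteq> {0..} \<longrightarrow>
        measure \<mu> F \<le> measure \<nu> {x. 0 \<le> x \<and> (\<exists>y\<in>F. \<bar>x - y\<bar> < e)} + e)}"

text \<open>Paths are functions on \<open>real\<close> of which only the restriction to \<open>{0..}\<close> is relevant.\<close>

definition skorokhod_space :: "(real \<Rightarrow> real measure) set" where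
  "skorokhod_space = {x. \<forall>t\<ge>0. limitin weak_topology x (x t) (at_right t) \<and>
     (0 < t \<longrightarrow> (\<exists>l. limitin weak_topology x l (at_left t)))}"

text \<open>The metric of Ethier and Kurtz (Markov Processes, Section 3.5) for the Skorokhod topology on
  paths indexed by the half-line.  \<open>time_changes\<close> is the set of increasing bijections \<open>l\<close> of the
  half-line for which \<open>time_change_size l\<close>, the supremum of \<open>\<bar>ln ((l t - l s) / (t - s))\<bar>\<close>, is
  finite.\<close>

definition time_changes :: "(real \<Rightarrow> real) set" where
  "time_changes = {l. strict_mono_on {0..} l \<and> l ` {0..} = {0..} \<and>
     bdd_above ((\<lambda>(s, t). \<bar>ln ((l t - l s) / (t - s))\<bar>) ` {(s, t). 0 \<le> s \<and> s < t})}"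

definition time_change_size :: "(real \<Rightarrow> real) \<Rightarrow> real" where
  "time_change_size l = (SUP (s, t) \<in> {(s, t). 0 \<le> s \<and> s < t}. \<bar>ln ((l t - l s) / (t - s))\<bar>)"

definition stopped_dist ::
  "(real \<Rightarrow> real measure) \<Rightarrow> (real \<Rightarrow> real measure) \<Rightarrow> (real \<Rightarrow> real) \<Rightarrow> real \<Rightarrow> real" where
  "stopped_dist x y l u = (SUP t\<in>{0..}. min 1 (prokhorov_dist (x (min t u)) (y (min (l t) u))))"

definition skorokhod_dist :: "(real \<Rightarrow> real measure) \<Rightarrow> (real \<Rightarrow> real measure) \<Rightarrow> real" where
  "skorokhod_dist x y = (INF l\<in>time_changes.
     max (time_change_size l) (LINT u:{0..}|lborel. exp (- u) * stopped_dist x y l u))"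


section \<open>Convergence in probability to a deterministic limit\<close>

text \<open>The outer measure agrees with \<^const>\<open>emeasure\<close> on events; using it, the definitions
  carry the intended meaning without a separate measurability claim (\<^const>\<open>emeasure\<close>
  would be \<open>0\<close> on a non-measurable set).\<close>

definition tendsto_in_prob :: "'w measure \<Rightarrow> (nat \<Rightarrow> 'w \<Rightarrow> real) \<Rightarrow> real \<Rightarrow> bool" where
  "tendsto_in_prob M Z c \<longleftrightarrow>
     (\<forall>e>0. (\<lambda>N. outer_measure_of M {\<omega> \<in> space M. e < \<bar>Z N \<omega> - c\<bar>}) \<longlonglongrightarrow> 0)"

definition skorokhod_tendsto_in_prob ::
  "'w measure \<Rightarrow> (nat \<Rightarrow> 'w \<Rightarrow> real \<Rightarrow> real measure) \<Rightarrow> (real \<Rightarrow> real measure) \<Rightarrow> bool" where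
  "skorokhod_tendsto_in_prob M Z x \<longleftrightarrow>
     x \<in> skorokhod_space \<and>
     (\<forall>\<^sub>F N in sequentially. \<forall>\<omega>\<in>space M. Z N \<omega> \<in> skorokhod_space) \<and>
     (\<forall>e>0. (\<lambda>N. outer_measure_of M {\<omega> \<in> space M. e < skorokhod_dist (Z N \<omega>) x}) \<longlonglongrightarrow> 0)"


section \<open>The particle system\<close>

definition natural_filtration ::
  "'w measure \<Rightarrow> 's measure \<Rightarrow> (real \<Rightarrow> 'w \<Rightarrow> 's) \<Rightarrow> real \<Rightarrow> 'w measure" where
  "natural_filtration M S X s =
     sigma (space M) {X u -` B \<inter> space M | u B. 0 \<le> u \<and> u \<le> s \<and> B \<in> sets S}"

text \<open>The semigroup \<open>exp (t A)\<close> of a bounded generator \<open>A\<close>.\<close>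

definition generated_semigroup ::
  "(('s \<Rightarrow> real) \<Rightarrow> 's \<Rightarrow> real) \<Rightarrow> real \<Rightarrow> ('s \<Rightarrow> real) \<Rightarrow> 's \<Rightarrow> real" where
  "generated_semigroup A t f x = (\<Sum>n. t ^ n / fact n * (A ^^ n) f x)"

text \<open>Markov jump processes with state space \<open>S\<close> and bounded generator \<open>A\<close>.  The condition on the
  paths says that they are right-continuous step functions; by compactness they have
  finitely many jumps in bounded time intervals.\<close>

definition markov_jump_process ::
  "'w measure \<Rightarrow> 's measure \<Rightarrow> (('s \<Rightarrow> real) \<Rightarrow> 's \<Rightarrow> real) \<Rightarrow> (real \<Rightarrow> 'w \<Rightarrow> 's) \<Rightarrow> bool" where
  "markov_jump_process M S A X \<longleftrightarrow>
     (\<forall>t\<ge>0. X t \<in> measurable M S) \<and>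
     (\<forall>\<omega>\<in>space M. \<forall>t\<ge>0.
        (\<forall>\<^sub>F u in at_right t. X u \<omega> = X t \<omega>) \<and>
        (0 < t \<longrightarrow> (\<exists>y. \<forall>\<^sub>F u in at_left t. X u \<omega> = y))) \<and>
     (\<forall>f\<in>borel_measurable S. bounded (f ` space S) \<longrightarrow>
        (\<forall>s\<ge>0. \<forall>t\<ge>0. AE \<omega> in M.
           real_cond_exp M (natural_filtration M S X s) (\<lambda>\<omega>. f (X (s + t) \<omega>)) \<omega>
             = generated_semigroup A t f (X s \<omega>)))"

definition exchange :: "nat \<Rightarrow> nat \<Rightarrow> real \<Rightarrow> (nat \<Rightarrow> real) \<Rightarrow> nat \<Rightarrow> real" where
  "exchange i j r x = x(i := r * (x i + x j), j := (1 - r) * (x i + x j))"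

text \<open>Each ordered pair \<open>(i, j)\<close> with \<open>i \<noteq> j\<close> interacts at rate \<open>1 / N\<close>, with \<open>r\<close> uniform on the
  unit interval.\<close>

definition exchange_generator ::
  "nat \<Rightarrow> ((nat \<Rightarrow> real) \<Rightarrow> real) \<Rightarrow> (nat \<Rightarrow> real) \<Rightarrow> real" where
  "exchange_generator N f x =
     (\<Sum>(i, j) \<in> {(i, j). i < N \<and> j < N \<and> i \<noteq> j}.
        1 / N * (LINT r:{0..1}|lborel. f (exchange i j r x) - f x))"

definition wealth_exchange_process ::
  "'w measure \<Rightarrow> nat \<Rightarrow> (real \<Rightarrow> 'w \<Rightarrow> nat \<Rightarrow> real) \<Rightarrow> bool" where
  "wealth_exchange_process M N X \<longleftrightarrow>
     markov_jump_process M (PiM {..<N} (\<lambda>_. Rplus)) (exchange_generator N) X"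


section \<open>The collision operators and the kinetic equation\<close>

definition collision_gain :: "(real \<Rightarrow> real) \<Rightarrow> real \<Rightarrow> real \<times> real \<Rightarrow> real" where
  "collision_gain g r = (\<lambda>(x, y). g (r * (x + y)) + g ((1 - r) * (x + y)) - g x - g y)"

text \<open>The measure \<open>\<mu>\<^sup>(\<^sup>2\<^sup>,\<^sup>N\<^sup>)\<close>; the subtracted measure is the image of \<open>\<mu> / N\<close> under the
  diagonal map \<open>x \<mapsto> (x, x)\<close>, whose value on \<open>A \<times> B\<close> is \<open>\<mu> (A \<inter> B) / N\<close>.\<close>

definition pair_empirical :: "nat \<Rightarrow> real measure \<Rightarrow> (real \<times> real) measure" where
  "pair_empirical N \<mu> = diff_measure (\<mu> \<Otimes>\<^sub>M \<mu>)
     (scale_measure (ennreal (1 / N)) (distr \<mu> (\<mu> \<Otimes>\<^sub>M \<mu>) (\<lambda>x. (x, x))))"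

lemma measure_pair_empirical_rectangle:
  assumes x: "\<And>i. i < N \<Longrightarrow> 0 \<le> x i" and N: "0 < N"
    and A: "A \<in> sets Rplus" and B: "B \<in> sets Rplus"
  defines "\<mu> \<equiv> empirical N x"
  shows "measure (pair_empirical N \<mu>) (A \<times> B)
    = measure \<mu> A * measure \<mu> B - 1 / N * measure \<mu> (A \<inter> B)"
proof -
  interpret \<mu>: prob_space \<mu> unfolding \<mu>_def by (rule prob_space_empirical[OF x N])
  interpret \<mu>\<mu>: pair_prob_space \<mu> \<mu> ..
  have sets_\<mu>: "sets \<mu> = sets Rplus" by (simp add: \<mu>_def empirical_def)
  have diag: "(\<lambda>x. (x, x)) \<in> measurable \<mu> (\<mu> \<Otimes>\<^sub>M \<mu>)" by measurable
  let ?D = "scale_measure (ennreal (1 / N)) (distr \<mu> (\<mu> \<Otimes>\<^sub>M \<mu>) (\<lambda>x. (x, x)))"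
  have D: "emeasure ?D C = ennreal (1 / N) * emeasure \<mu> ((\<lambda>x. (x, x)) -` C \<inter> space \<mu>)"
    if "C \<in> sets (\<mu> \<Otimes>\<^sub>M \<mu>)" for C
    using that by (simp add: emeasure_distr[OF diag])
  have le: "emeasure ?D C \<le> emeasure (\<mu> \<Otimes>\<^sub>M \<mu>) C" if C: "C \<in> sets (\<mu> \<Otimes>\<^sub>M \<mu>)" for C
  proof -
    have x': "x \<in> measurable (uniform_count_measure {..<N}) Rplus"
      by (rule empirical_measurable[OF x])
    have tr: "(\<integral>\<^sup>+y. h y \<partial>\<mu>) = (\<integral>\<^sup>+i. h (x i) \<partial>uniform_count_measure {..<N})"
      if "h \<in> borel_measurable Rplus" for h :: "real \<Rightarrow> ennreal"
      unfolding \<mu>_def empirical_def using that by (intro nn_integral_distr[OF x']) simp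
    have C': "(\<lambda>x. (x, x)) -` C \<inter> space \<mu> \<in> sets \<mu>"
      using measurable_sets[OF diag C] .
    have sl: "Pair y -` C \<in> sets \<mu>" for y
      using C by (rule sets_Pair1)
    have atom: "ennreal (1 / N) * indicator ((\<lambda>x. (x, x)) -` C \<inter> space \<mu>) (x i)
        \<le> emeasure \<mu> (Pair (x i) -` C)" if i: "i < N" for i
    proof (cases "(x i, x i) \<in> C")
      case True
      have "1 \<le> (\<Sum>k<N. indicator (Pair (x i) -` C) (x k) :: real)"
        using member_le_sum[of i "{..<N}" "\<lambda>k. indicator (Pair (x i) -` C) (x k) :: real"] i True
        by simp
      then have "1 / N \<le> 1 / N * (\<Sum>k<N. indicator (Pair (x i) -` C) (x k) :: real)"
        using N by (simp add: divide_right_mono)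
      then have "ennreal (1 / N) \<le> emeasure \<mu> (Pair (x i) -` C)"
        unfolding \<mu>_def using sl[of "x i"] unfolding sets_\<mu>
        by (subst emeasure_empirical[OF x]) (auto intro!: ennreal_leI)
      then show ?thesis by (auto simp: indicator_def)
    qed (auto simp: indicator_def)
    have "emeasure ?D C
        = (\<integral>\<^sup>+y. ennreal (1 / N) * indicator ((\<lambda>x. (x, x)) -` C \<inter> space \<mu>) y \<partial>\<mu>)"
      unfolding D[OF C] using C' by (simp add: nn_integral_cmult_indicator)
    also have "\<dots> = (\<integral>\<^sup>+i. ennreal (1 / N) * indicator ((\<lambda>x. (x, x)) -` C \<inter> space \<mu>) (x i)
        \<partial>uniform_count_measure {..<N})"
      using C' by (intro tr) (simp add: sets_\<mu>)
    also have "\<dots> \<le> (\<integral>\<^sup>+i. emeasure \<mu> (Pair (x i) -` C) \<partial>uniform_count_measure {..<N})"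
      by (rule nn_integral_mono) (use atom in \<open>simp add: space_uniform_count_measure\<close>)
    also have "\<dots> = (\<integral>\<^sup>+y. emeasure \<mu> (Pair y -` C) \<partial>\<mu>)"
      using \<mu>.measurable_emeasure_Pair[OF C]
      by (intro tr[symmetric]) (simp add: measurable_cong_sets[OF sets_\<mu> refl])
    also have "\<dots> = emeasure (\<mu> \<Otimes>\<^sub>M \<mu>) C"
      using C by (simp add: \<mu>.emeasure_pair_measure_alt)
    finally show ?thesis .
  qed
  have AB: "A \<times> B \<in> sets (\<mu> \<Otimes>\<^sub>M \<mu>)" using A B by (simp add: sets_\<mu>)
  have finD: "finite_measure ?D"
    by (rule finite_measureI)
      (use le[OF sets.top[of "\<mu> \<Otimes>\<^sub>M \<mu>"]] \<mu>\<mu>.emeasure_space_1 in \<open>auto simp: top_unique space_scale_measure\<close>)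
  have int: "(\<lambda>x. (x, x)) -` (A \<times> B) \<inter> space \<mu> = A \<inter> B"
    using sets.sets_into_space[of A \<mu>] A unfolding sets_\<mu> by auto
  have e: "emeasure (pair_empirical N \<mu>) (A \<times> B)
      = emeasure (\<mu> \<Otimes>\<^sub>M \<mu>) (A \<times> B) - emeasure ?D (A \<times> B)"
    unfolding pair_empirical_def
    by (rule emeasure_diff_measure[OF _ finD _ le AB]) (auto intro: \<mu>\<mu>.finite_measure_axioms)
  have p: "emeasure (\<mu> \<Otimes>\<^sub>M \<mu>) (A \<times> B) = ennreal (measure \<mu> A * measure \<mu> B)"
    using A B by (simp add: \<mu>.emeasure_pair_measure_Times sets_\<mu> \<mu>.emeasure_eq_measure ennreal_mult)
  have d: "emeasure ?D (A \<times> B) = ennreal (1 / N * measure \<mu> (A \<inter> B))"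
    unfolding D[OF AB] int by (simp add: \<mu>.emeasure_eq_measure flip: ennreal_mult)
  have ge: "1 / N * measure \<mu> (A \<inter> B) \<le> measure \<mu> A * measure \<mu> B"
    using le[OF AB] unfolding p d by (subst (asm) ennreal_le_iff) auto
  show ?thesis
    unfolding measure_def[of "pair_empirical N \<mu>"] e p d
    using ge by (subst ennreal_minus) auto
qed

definition collision_N :: "nat \<Rightarrow> real \<Rightarrow> (real \<Rightarrow> real) \<Rightarrow> real measure \<Rightarrow> real" where
  "collision_N N W g \<mu> = (LINT r:{0..1}|lborel. LINT p|pair_empirical N \<mu>.
     collision_gain g r p * indicator {p. fst p + snd p \<le> W} p)"

definition collision :: "ereal \<Rightarrow> (real \<Rightarrow> real) \<Rightarrow> real measure \<Rightarrow> real" where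
  "collision w0 g \<mu> = (LINT r:{0..1}|lborel. LINT p|(\<mu> \<Otimes>\<^sub>M \<mu>).
     collision_gain g r p * indicator {p. ereal (fst p + snd p) \<le> w0} p)"

text \<open>The weak form of \<open>\<mu> t = \<mu>0 + (\<integral>s = 0..t. Q (\<mu> s))\<close>.\<close>

definition solves_kinetic_equation ::
  "ereal \<Rightarrow> real measure \<Rightarrow> (real \<Rightarrow> real measure) \<Rightarrow> bool" where
  "solves_kinetic_equation w0 \<mu>0 \<mu> \<longleftrightarrow>
     (\<forall>t\<ge>0. \<mu> t \<in> prob_measures) \<and>
     (\<forall>g\<in>C_b. \<forall>t\<ge>0.
        set_integrable lborel {0..t} (\<lambda>s. collision w0 g (\<mu> s)) \<and>
        (LINT x|\<mu> t. g x) = (LINT x|\<mu>0. g x) + (LINT s:{0..t}|lborel. collision w0 g (\<mu> s)))"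

definition martingale_term ::
  "nat \<Rightarrow> real \<Rightarrow> (real \<Rightarrow> real) \<Rightarrow> (real \<Rightarrow> real measure) \<Rightarrow> real \<Rightarrow> real" where
  "martingale_term N W g \<nu> t = (LINT x|\<nu> t. g x) - (LINT x|\<nu> 0. g x)
     - (LINT s:{0..t}|lborel. collision_N N W g (\<nu> s))"

end

theory Submission
  imports Defs
begin

text \<open>Why the theorem holds.  A collision sends \<open>(x, y)\<close> to \<open>(r s, (1 - r) s)\<close>, where
  \<open>s = x + y\<close>.  The joint density of two independent exponential wealths depends only on \<open>s\<close>, so that
  given \<open>s\<close> the first wealth is already uniform on \<open>[0, s]\<close>: a collision leaves the product of two
  exponential laws invariant (\<open>exponential_exchange_invariant\<close>).  Hence i.i.d. exponential wealths are a
  stationary state of the \<open>N\<close>-agent system, and the candidate for the limit is the constant path at the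
  exponential law \<open>\<mu>\<close>, which solves the kinetic equation because \<open>Q(\<mu>) = 0\<close>.

  It remains to show that the empirical process stays close to \<open>\<mu>\<close> uniformly on bounded time intervals.
  The centred mean of a bounded test function and the collision term \<open>Q\<^sup>(\<^sup>N\<^sup>)\<close> are both, up to a factor
  tending to 1, pair statistics \<open>q(x) = 1/N\<^sup>2 \<Sum> h(x\<^sub>i, x\<^sub>j)\<close> over \<open>i \<noteq> j\<close>, with a bounded kernel \<open>h\<close>
  whose mean under \<open>\<mu> \<Otimes> \<mu>\<close> is 0.  (For \<open>Q\<^sup>(\<^sup>N\<^sup>)\<close> this uses that the total wealth is conserved, so that the
  indicator of \<open>x\<^sub>i + x\<^sub>j \<le> W\<^sub>N\<close> is always 1.)  At a single time, independence of disjoint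
  pairs gives a second moment of order \<open>1/N\<close>, and by stationarity the same bound holds at all
  times.  To pass to the supremum over time, note that one exchange changes \<open>q\<close> by \<open>O(1/N)\<close> and that
  exchanges happen at total rate \<open>O(N)\<close>; so \<open>A q\<close> and \<open>A q\<^sup>2\<close> are bounded uniformly in \<open>N\<close>, and the
  squared increment of \<open>q\<close> over a time \<open>u\<close> has conditional mean \<open>O(u)\<close>.  An inequality of
  Ottaviani type then bounds the supremum on each of a fixed number of short intervals by the value at its
  right end (\<open>maximal_inequality\<close>, \<open>pair_statistic_maximal\<close>).

  All convergence statements follow.  Since the test functions in this argument are merely measurable, the
  Prokhorov distance is controlled through indicators of finitely many bins, and the Skorokhod distance to a
  constant path through the identity time change (\<open>skorokhod_tendsto\<close>).  The almost sure
  convergence of the initial data is Hoeffding's inequality together with the Borel-Cantelli lemma.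

  For the second part, the mean of an empirical measure with bounded total wealth is \<open>W\<^sub>N / N\<close>, which tends
  to 0; so the only possible weak limit is the point mass at 0, which has no density.\<close>


section \<open>Test functions, weak convergence and empirical measures\<close>

lemma C_b_D:
  assumes "g \<in> C_b"
  shows C_b_measurable: "g \<in> borel_measurable Rplus" and C_b_bounded: "\<exists>B. \<forall>x\<ge>0. \<bar>g x\<bar> \<le> B"
  using assms unfolding C_b_def Rplus_def
  by (auto intro: borel_measurable_continuous_on_restrict simp: bounded_iff)

lemma space_Rplus [simp]: "space Rplus = {0..}"
  by (simp add: Rplus_def space_restrict_space)

lemma prob_measures_D:
  assumes "\<mu> \<in> prob_measures"
  shows "prob_space \<mu>" "sets \<mu> = sets Rplus" "space \<mu> = {0..}"
  using assms sets_eq_imp_space_eq[of \<mu> Rplus] by (auto simp: prob_measures_def)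

text \<open>The sets that eventually contain \<open>\<nu> x\<close> as soon as they contain \<open>\<mu>\<close> are closed under finite
  intersections and arbitrary unions, so it suffices to look at the generating sets.\<close>

lemma limitin_weak_topologyI:
  assumes \<mu>: "\<mu> \<in> prob_measures" and \<nu>: "\<forall>\<^sub>F x in F. \<nu> x \<in> prob_measures"
    and conv: "\<And>g. g \<in> C_b \<Longrightarrow> ((\<lambda>x. LINT y|\<nu> x. g y) \<longlongrightarrow> (LINT y|\<mu>. g y)) F"
  shows "limitin weak_topology \<nu> \<mu> F"
  unfolding limitin_def topspace_weak_topology
proof (intro conjI allI impI)
  fix U assume U: "openin weak_topology U \<and> \<mu> \<in> U"
  then have "generate_topology_on
     {{\<mu> \<in> prob_measures. (LINT x|\<mu>. g x) \<in> U} | g U. g \<in> C_b \<and> open U} U"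
    unfolding weak_topology_def openin_topology_generated_by_iff by simp
  then have "\<mu> \<in> U \<longrightarrow> (\<forall>\<^sub>F x in F. \<nu> x \<in> U)"
  proof induction
    case (UN K)
    show ?case
    proof
      assume "\<mu> \<in> \<Union>K"
      then obtain k where "k \<in> K" "\<mu> \<in> k" by blast
      then have "\<forall>\<^sub>F x in F. \<nu> x \<in> k" using UN by blast
      then show "\<forall>\<^sub>F x in F. \<nu> x \<in> \<Union>K" by eventually_elim (use \<open>k \<in> K\<close> in blast)
    qed
  next
    case (Basis s)
    then obtain g V where s: "s = {\<mu> \<in> prob_measures. (LINT x|\<mu>. g x) \<in> V}" "g \<in> C_b" "open V" by auto
    then show ?case using \<nu> topological_tendstoD[OF conv[of g], of V]
      by (auto elim: eventually_elim2)
  qed (auto elim: eventually_elim2)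
  then show "\<forall>\<^sub>F x in F. \<nu> x \<in> U" using U by blast
qed (fact \<mu>)

lemma limitin_weak_topologyD:
  assumes lim: "limitin weak_topology \<nu> \<mu> F" and g: "g \<in> C_b"
  shows "((\<lambda>x. LINT y|\<nu> x. g y) \<longlongrightarrow> (LINT y|\<mu>. g y)) F"
proof (rule topological_tendstoI)
  fix V :: "real set" assume V: "open V" "(LINT y|\<mu>. g y) \<in> V"
  let ?U = "{\<mu> \<in> prob_measures. (LINT x|\<mu>. g x) \<in> V}"
  have "openin weak_topology ?U"
    unfolding weak_topology_def using g V by (intro topology_generated_by_Basis) auto
  moreover have "\<mu> \<in> ?U" using V limitin_topspace[OF lim] by (simp add: topspace_weak_topology)
  ultimately have "\<forall>\<^sub>F x in F. \<nu> x \<in> ?U" using lim unfolding limitin_def by blast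
  then show "\<forall>\<^sub>F x in F. (LINT y|\<nu> x. g y) \<in> V" by (auto elim: eventually_mono)
qed

lemma empirical_prob_measure:
  assumes "\<And>i. i < N \<Longrightarrow> 0 \<le> x i" "0 < N"
  shows "empirical N x \<in> prob_measures"
  using prob_space_empirical[OF assms] by (simp add: prob_measures_def empirical_def)

lemma empirical_nn_integral:
  assumes x: "\<And>i. i < N \<Longrightarrow> 0 \<le> x i" and g: "g \<in> borel_measurable Rplus"
  shows "(\<integral>\<^sup>+y. g y \<partial>empirical N x) = ennreal (1 / N) * (\<Sum>i<N. g (x i))"
proof -
  have "(\<integral>\<^sup>+y. g y \<partial>empirical N x) = (\<integral>\<^sup>+i. g (x i) \<partial>uniform_count_measure {..<N})"
    unfolding empirical_def using g by (intro nn_integral_distr empirical_measurable x) auto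
  also have "\<dots> = (\<Sum>i<N. ennreal (1 / N) * g (x i))"
    unfolding uniform_count_measure_def by (simp add: nn_integral_point_measure_finite)
  finally show ?thesis by (simp add: sum_distrib_left)
qed

lemma empirical_integral:
  fixes g :: "real \<Rightarrow> real"
  assumes x: "\<And>i. i < N \<Longrightarrow> 0 \<le> x i" and g: "g \<in> borel_measurable Rplus"
  shows "(LINT y|empirical N x. g y) = 1 / N * (\<Sum>i<N. g (x i))"
proof -
  have "(LINT y|empirical N x. g y) = (LINT i|uniform_count_measure {..<N}. g (x i))"
    unfolding empirical_def using g by (intro integral_distr empirical_measurable x) auto
  also have "\<dots> = (\<Sum>i<N. 1 / N * g (x i))"
    unfolding uniform_count_measure_def
    by (subst lebesgue_integral_point_measure_finite) (auto simp: sum_divide_distrib)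
  finally show ?thesis by (simp add: sum_distrib_left)
qed

abbreviation off_diagonal :: "nat \<Rightarrow> (nat \<times> nat) set" where
  "off_diagonal N \<equiv> {(i, j). i < N \<and> j < N \<and> i \<noteq> j}"

lemma finite_off_diagonal: "finite (off_diagonal N)"
  by (rule finite_subset[of _ "{..<N} \<times> {..<N}"]) auto

lemma card_off_diagonal_le: "card (off_diagonal N) \<le> N * N"
  using card_mono[of "{..<N} \<times> {..<N}" "off_diagonal N"] by (auto simp: card_cartesian_product)

lemma sum_square_split:
  "(\<Sum>i<N. \<Sum>j<N. G i j) = (\<Sum>(i, j)\<in>off_diagonal N. G i j) + (\<Sum>i<N. G i i)"
  for G :: "nat \<Rightarrow> nat \<Rightarrow> 'a :: comm_monoid_add"
proof -
  have "(\<Sum>i<N. \<Sum>j<N. G i j) = (\<Sum>(i, j)\<in>{..<N} \<times> {..<N}. G i j)"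
    by (rule sum.cartesian_product)
  also have "{..<N} \<times> {..<N} = off_diagonal N \<union> (\<lambda>i. (i, i)) ` {..<N}" by auto
  also have "(\<Sum>(i, j)\<in>\<dots>. G i j) = (\<Sum>(i, j)\<in>off_diagonal N. G i j) + (\<Sum>(i, j)\<in>(\<lambda>i. (i, i)) ` {..<N}. G i j)"
    by (rule sum.union_disjoint) (auto simp: finite_off_diagonal)
  finally show ?thesis by (simp add: sum.reindex inj_on_def)
qed

text \<open>On the product of an empirical measure with itself, a point \<open>(x i, x i)\<close> on the diagonal carries
  at least the mass \<open>1/N\<^sup>2\<close> that the second measure subtracts.  The difference is therefore a genuine measure, and
  what is left is mass \<open>1/N\<^sup>2\<close> for each pair of distinct indices.\<close>

lemma emeasure_pair_empirical:
  assumes x: "\<And>i. i < N \<Longrightarrow> 0 \<le> x i" and N: "0 < N"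
    and C: "C \<in> sets (Rplus \<Otimes>\<^sub>M Rplus)"
  shows "emeasure (pair_empirical N (empirical N x)) C
    = ennreal (1 / N * (1 / N)) * (\<Sum>(i, j)\<in>off_diagonal N. indicator C (x i, x j))"
proof -
  define \<mu> where "\<mu> = empirical N x"
  interpret \<mu>: prob_space \<mu> unfolding \<mu>_def by (rule prob_space_empirical[OF x N])
  interpret \<mu>\<mu>: pair_prob_space \<mu> \<mu> ..
  have sets_\<mu>[measurable_cong]: "sets \<mu> = sets Rplus" by (simp add: \<mu>_def empirical_def)
  have sets_\<mu>\<mu>: "sets (\<mu> \<Otimes>\<^sub>M \<mu>) = sets (Rplus \<Otimes>\<^sub>M Rplus)" by (intro sets_pair_measure_cong sets_\<mu>)
  have diag: "(\<lambda>x. (x, x)) \<in> measurable \<mu> (\<mu> \<Otimes>\<^sub>M \<mu>)" by measurable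
  let ?D = "scale_measure (ennreal (1 / N)) (distr \<mu> (\<mu> \<Otimes>\<^sub>M \<mu>) (\<lambda>x. (x, x)))"
  let ?c = "ennreal (1 / N * (1 / N))"
  have c: "ennreal (1 / N) * (ennreal (1 / N) * z) = ?c * z" for z
    by (subst ennreal_mult) (auto simp: mult.assoc)
  have D: "emeasure ?D C = ?c * (\<Sum>i<N. indicator C (x i, x i))"
    if C: "C \<in> sets (\<mu> \<Otimes>\<^sub>M \<mu>)" for C
  proof -
    have m: "(\<lambda>x. (x, x)) -` C \<inter> space \<mu> \<in> sets \<mu>" using measurable_sets[OF diag C] .
    have "emeasure ?D C = ennreal (1 / N) * (\<integral>\<^sup>+y. indicator ((\<lambda>x. (x, x)) -` C \<inter> space \<mu>) y \<partial>\<mu>)"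
      using C m by (simp add: emeasure_distr[OF diag])
    also have "(\<integral>\<^sup>+y. indicator ((\<lambda>x. (x, x)) -` C \<inter> space \<mu>) y \<partial>\<mu>)
        = ennreal (1 / N) * (\<Sum>i<N. indicator ((\<lambda>x. (x, x)) -` C \<inter> space \<mu>) (x i))"
      unfolding \<mu>_def using m[unfolded \<mu>_def]
      by (intro empirical_nn_integral x) (auto simp: empirical_def)
    also have "(\<Sum>i<N. indicator ((\<lambda>x. (x, x)) -` C \<inter> space \<mu>) (x i)) = (\<Sum>i<N. indicator C (x i, x i) :: ennreal)"
      by (intro sum.cong) (auto simp: indicator_def \<mu>_def empirical_def x)
    finally show ?thesis using c by simp
  qed
  have P: "emeasure (\<mu> \<Otimes>\<^sub>M \<mu>) C = ?c * (\<Sum>i<N. \<Sum>j<N. indicator C (x i, x j))"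
    if C[measurable]: "C \<in> sets (\<mu> \<Otimes>\<^sub>M \<mu>)" for C
  proof -
    have e: "emeasure \<mu> (Pair y -` C) = ennreal (1 / N) * (\<Sum>j<N. indicator C (y, x j))" for y
    proof -
      have m: "Pair y -` C \<in> sets Rplus" using sets_Pair1[OF C, of y] sets_\<mu> by simp
      have "emeasure \<mu> (Pair y -` C) = (\<integral>\<^sup>+z. indicator (Pair y -` C) z \<partial>\<mu>)" using m sets_\<mu> by simp
      also have "\<dots> = ennreal (1 / N) * (\<Sum>j<N. indicator (Pair y -` C) (x j))"
        unfolding \<mu>_def using m by (intro empirical_nn_integral x) auto
      finally show ?thesis by (simp add: indicator_def)
    qed
    have "emeasure (\<mu> \<Otimes>\<^sub>M \<mu>) C = (\<integral>\<^sup>+y. emeasure \<mu> (Pair y -` C) \<partial>\<mu>)"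
      using C by (simp add: \<mu>.emeasure_pair_measure_alt)
    also have "\<dots> = ennreal (1 / N) * (\<Sum>i<N. emeasure \<mu> (Pair (x i) -` C))"
      using \<mu>.measurable_emeasure_Pair[OF C] measurable_cong_sets[OF sets_\<mu> refl]
      unfolding \<mu>_def by (intro empirical_nn_integral x) auto
    also have "\<dots> = ?c * (\<Sum>i<N. \<Sum>j<N. indicator C (x i, x j))"
      unfolding e sum_distrib_left[symmetric] c ..
    finally show ?thesis .
  qed
  have le: "emeasure ?D C \<le> emeasure (\<mu> \<Otimes>\<^sub>M \<mu>) C" if "C \<in> sets (\<mu> \<Otimes>\<^sub>M \<mu>)" for C
    unfolding D[OF that] P[OF that] sum_square_split by (intro mult_left_mono) auto
  have finD: "finite_measure ?D"
    by (rule finite_measureI)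
      (use le[OF sets.top[of "\<mu> \<Otimes>\<^sub>M \<mu>"]] \<mu>\<mu>.emeasure_space_1 in \<open>auto simp: top_unique space_scale_measure\<close>)
  have C': "C \<in> sets (\<mu> \<Otimes>\<^sub>M \<mu>)" using C sets_\<mu>\<mu> by simp
  have "emeasure (pair_empirical N \<mu>) C = emeasure (\<mu> \<Otimes>\<^sub>M \<mu>) C - emeasure ?D C"
    unfolding pair_empirical_def
    by (rule emeasure_diff_measure[OF _ finD _ le C']) (auto intro: \<mu>\<mu>.finite_measure_axioms)
  also have "\<dots> = ?c * (\<Sum>(i, j)\<in>off_diagonal N. indicator C (x i, x j))"
    unfolding D[OF C'] P[OF C'] sum_square_split distrib_left
    by (rule ennreal_add_diff_cancel_right)
      (auto simp: ennreal_mult_eq_top_iff ennreal_sum_eq_top indicator_def)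
  finally show ?thesis unfolding \<mu>_def .
qed

lemma pair_empirical_integral:
  fixes g :: "real \<times> real \<Rightarrow> real"
  assumes x: "\<And>i. i < N \<Longrightarrow> 0 \<le> x i" and N: "0 < N"
    and g: "g \<in> borel_measurable (Rplus \<Otimes>\<^sub>M Rplus)"
  shows "(LINT p|pair_empirical N (empirical N x). g p)
    = 1 / N * (1 / N) * (\<Sum>(i, j)\<in>off_diagonal N. g (x i, x j))"
proof -
  let ?P = "point_measure (off_diagonal N) (\<lambda>_. ennreal (1 / N * (1 / N)))"
  let ?x = "\<lambda>(i, j). (x i, x j)"
  have m: "?x \<in> measurable ?P (Rplus \<Otimes>\<^sub>M Rplus)"
    by (auto simp: measurable_def space_pair_measure space_point_measure sets_point_measure x)
  have "pair_empirical N (empirical N x) = distr ?P (Rplus \<Otimes>\<^sub>M Rplus) ?x"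
  proof (rule measure_eqI)
    show s: "sets (pair_empirical N (empirical N x)) = sets (distr ?P (Rplus \<Otimes>\<^sub>M Rplus) ?x)"
      by (auto simp: pair_empirical_def empirical_def intro!: sets_pair_measure_cong)
    fix C assume "C \<in> sets (pair_empirical N (empirical N x))"
    then have C: "C \<in> sets (Rplus \<Otimes>\<^sub>M Rplus)" using s by simp
    have "emeasure (distr ?P (Rplus \<Otimes>\<^sub>M Rplus) ?x) C = emeasure ?P (?x -` C \<inter> off_diagonal N)"
      using emeasure_distr[OF m C] by (simp add: space_point_measure)
    also have "\<dots> = (\<Sum>p\<in>?x -` C \<inter> off_diagonal N. ennreal (1 / N * (1 / N)))"
      by (rule emeasure_point_measure_finite) (auto simp: finite_off_diagonal)
    also have "\<dots> = (\<Sum>p\<in>off_diagonal N. ennreal (1 / N * (1 / N)) * indicator C (?x p))"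
      by (rule sum.mono_neutral_cong_left) (auto simp: finite_off_diagonal indicator_def split: if_splits)
    finally show "emeasure (pair_empirical N (empirical N x)) C = emeasure (distr ?P (Rplus \<Otimes>\<^sub>M Rplus) ?x) C"
      by (subst emeasure_pair_empirical[OF x N C])
        (simp_all add: sum_distrib_left case_prod_beta)
  qed
  then have "(LINT p|pair_empirical N (empirical N x). g p) = (LINT p|?P. g (?x p))"
    using integral_distr[OF m g] by simp
  also have "\<dots> = (\<Sum>p\<in>off_diagonal N. 1 / N * (1 / N) * g (?x p))"
    by (subst lebesgue_integral_point_measure_finite) (auto simp: finite_off_diagonal)
  finally show ?thesis by (simp add: sum_distrib_left case_prod_beta)
qed

section \<open>Maximal inequality for jump processes with bounded generator\<close>

text \<open>The constant \<open>c\<close> bounds the norm of the generator and makes its exponential series converge.  For the exchange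
  system it is \<open>2 N\<close>, so it must not enter the final estimates: these are in terms of bounds for \<open>A f\<close> and
  \<open>A f\<^sup>2\<close>, for the particular \<open>f\<close> considered.\<close>

locale bounded_jump_process = prob_space M for M :: "'w measure" +
  fixes S :: "'s measure" and A :: "('s \<Rightarrow> real) \<Rightarrow> 's \<Rightarrow> real" and Y :: "real \<Rightarrow> 'w \<Rightarrow> 's"
    and c :: real
  assumes markov: "markov_jump_process M S A Y"
    and c_nonneg: "0 \<le> c"
    and generator_measurable:
      "F \<in> borel_measurable S \<Longrightarrow> (\<And>x. x \<in> space S \<Longrightarrow> \<bar>F x\<bar> \<le> B) \<Longrightarrow> A F \<in> borel_measurable S"
    and generator_bound:
      "F \<in> borel_measurable S \<Longrightarrow> (\<And>x. x \<in> space S \<Longrightarrow> \<bar>F x\<bar> \<le> B) \<Longrightarrow> x \<in> space S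
        \<Longrightarrow> \<bar>A F x\<bar> \<le> c * B"
begin

lemma generator_power:
  assumes "F \<in> borel_measurable S" "\<And>x. x \<in> space S \<Longrightarrow> \<bar>F x\<bar> \<le> B"
  shows "(A ^^ n) F \<in> borel_measurable S \<and> (\<forall>x\<in>space S. \<bar>(A ^^ n) F x\<bar> \<le> c ^ n * B)"
proof (induction n)
  case (Suc n)
  then show ?case
    using generator_measurable[of "(A ^^ n) F" "c ^ n * B"] generator_bound[of "(A ^^ n) F" "c ^ n * B"]
    by (auto simp: mult.assoc)
qed (use assms in auto)

lemma semigroup_summable:
  assumes F: "F \<in> borel_measurable S" "\<And>x. x \<in> space S \<Longrightarrow> \<bar>F x\<bar> \<le> B" and t: "0 \<le> t"
    and x: "x \<in> space S"
  shows "summable (\<lambda>n. t ^ n / fact n * (A ^^ n) F x)"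
proof (rule summable_comparison_test')
  show "summable (\<lambda>n. B * ((t * c) ^ n /\<^sub>R fact n))"
    by (intro summable_mult summable_exp_generic)
  show "norm (t ^ n / fact n * (A ^^ n) F x) \<le> B * ((t * c) ^ n /\<^sub>R fact n)" for n
    using mult_left_mono[OF generator_power[THEN conjunct2, rule_format, OF F x, of n], of "t ^ n / fact n"] t
    by (simp add: abs_mult power_mult_distrib divide_simps mult_ac)
qed

lemma semigroup_measurable:
  assumes F: "F \<in> borel_measurable S" "\<And>x. x \<in> space S \<Longrightarrow> \<bar>F x\<bar> \<le> B"
  shows "generated_semigroup A t F \<in> borel_measurable S"
proof -
  have [measurable]: "(A ^^ n) F \<in> borel_measurable S" for n
    using generator_power[OF F] by blast
  show ?thesis unfolding generated_semigroup_def[abs_def] by measurable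
qed

text \<open>Every term of the series after the first contains a factor \<open>A F\<close>; taking \<open>K\<close> out leaves a
  series dominated by the exponential one.\<close>

lemma semigroup_increment:
  assumes F: "F \<in> borel_measurable S" "\<And>x. x \<in> space S \<Longrightarrow> \<bar>F x\<bar> \<le> B"
    and K: "\<And>x. x \<in> space S \<Longrightarrow> \<bar>A F x\<bar> \<le> K" and t: "0 \<le> t" and x: "x \<in> space S"
  shows "\<bar>generated_semigroup A t F x - F x\<bar> \<le> t * exp (c * t) * K"
proof -
  let ?f = "\<lambda>n. t ^ n / fact n * (A ^^ n) F x"
  have sum: "summable ?f" using semigroup_summable[OF F t x] .
  have K0: "0 \<le> K" using K[OF x] by linarith
  have AF: "A F \<in> borel_measurable S" using generator_measurable[OF F] .
  have eq: "generated_semigroup A t F x - F x = (\<Sum>n. ?f (Suc n))"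
    using suminf_split_head[OF sum] by (simp add: generated_semigroup_def)
  have bd: "norm (?f (Suc n)) \<le> t * K * ((t * c) ^ n /\<^sub>R fact n)" for n
  proof -
    have "(A ^^ Suc n) F x = (A ^^ n) (A F) x" by (simp add: funpow_swap1)
    then have "\<bar>(A ^^ Suc n) F x\<bar> \<le> c ^ n * K"
      using generator_power[OF AF K, of n] x by simp
    then have "norm (?f (Suc n)) \<le> t ^ Suc n / fact (Suc n) * (c ^ n * K)"
      unfolding real_norm_def abs_mult using t by (intro mult_mono) auto
    also have "\<dots> \<le> t ^ Suc n / fact n * (c ^ n * K)"
      using t K0 c_nonneg
      by (intro mult_right_mono divide_left_mono) (auto simp: fact_mono)
    finally show ?thesis by (simp add: power_mult_distrib divide_simps mult_ac)
  qed
  have s2: "summable (\<lambda>n. t * K * ((t * c) ^ n /\<^sub>R fact n))"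
    by (intro summable_mult summable_exp_generic)
  have "norm (\<Sum>n. ?f (Suc n)) \<le> (\<Sum>n. t * K * ((t * c) ^ n /\<^sub>R fact n))"
    by (rule norm_suminf_le[OF bd s2])
  also have "\<dots> = t * K * exp (t * c)"
    by (subst suminf_mult[OF summable_exp_generic]) (simp add: exp_def)
  finally show ?thesis unfolding eq by (simp add: mult_ac)
qed

abbreviation "\<F> \<equiv> natural_filtration M S Y"

lemma Y_measurable: "0 \<le> t \<Longrightarrow> Y t \<in> measurable M S"
  using markov by (auto simp: markov_jump_process_def)

lemma Y_space: "0 \<le> t \<Longrightarrow> \<omega> \<in> space M \<Longrightarrow> Y t \<omega> \<in> space S"
  using measurable_space[OF Y_measurable] .

lemma space_\<F>: "space (\<F> s) = space M"
  by (simp add: natural_filtration_def space_measure_of_conv)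

lemma sets_\<F>:
  "sets (\<F> s) = sigma_sets (space M) {Y u -` B \<inter> space M | u B. 0 \<le> u \<and> u \<le> s \<and> B \<in> sets S}"
  unfolding natural_filtration_def by (rule sets_measure_of) auto

lemma subalgebra_\<F>: "subalgebra M (\<F> s)"
  unfolding subalgebra_def space_\<F> sets_\<F>
  by (auto intro!: sets.sigma_sets_subset measurable_sets[OF Y_measurable])

lemma \<F>_mono: "s \<le> t \<Longrightarrow> sets (\<F> s) \<subseteq> sets (\<F> t)"
  unfolding sets_\<F> by (intro sigma_sets_mono') (blast intro: order_trans)

lemma Y_adapted:
  assumes "0 \<le> u" "u \<le> s"
  shows "Y u \<in> measurable (\<F> s) S"
proof (rule measurableI)
  fix B assume "B \<in> sets S"
  then show "Y u -` B \<inter> space (\<F> s) \<in> sets (\<F> s)"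
    unfolding space_\<F> sets_\<F> using assms by (intro sigma_sets.Basic) auto
qed (use assms in \<open>simp add: space_\<F> Y_space\<close>)

lemma \<F>_subD: "B \<in> sets (\<F> s) \<Longrightarrow> B \<in> sets M"
  using subalgebra_\<F> by (auto simp: subalgebra_def)

lemma \<F>_borel_mono: "Z \<in> borel_measurable (\<F> s) \<Longrightarrow> s \<le> t \<Longrightarrow> Z \<in> borel_measurable (\<F> t)"
  using \<F>_mono[of s t] by (auto simp: measurable_def space_\<F>)

lemma \<F>_borel: "Z \<in> borel_measurable (\<F> s) \<Longrightarrow> Z \<in> borel_measurable M"
  by (rule measurable_from_subalg[OF subalgebra_\<F>])

lemma integrable_bdd:
  assumes "Z \<in> borel_measurable M" "\<And>\<omega>. \<omega> \<in> space M \<Longrightarrow> \<bar>Z \<omega>\<bar> \<le> (b::real)"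
  shows "integrable M Z"
  using assms by (intro integrable_const_bound[of _ b]) auto

text \<open>The Markov property in integrated form.  The weight \<open>Z\<close> is any bounded variable known at time \<open>s\<close>; besides
  indicators of past events it will be \<open>f (Y s)\<close> times such an indicator.\<close>

lemma weighted_transition:
  assumes F: "F \<in> borel_measurable S" "\<And>x. x \<in> space S \<Longrightarrow> \<bar>F x\<bar> \<le> B"
    and Z: "Z \<in> borel_measurable (\<F> s)" "\<And>\<omega>. \<omega> \<in> space M \<Longrightarrow> \<bar>Z \<omega>\<bar> \<le> b"
    and s: "0 \<le> s" and t: "0 \<le> t"
  shows "(LINT \<omega>|M. Z \<omega> * F (Y (s + t) \<omega>))
    = (LINT \<omega>|M. Z \<omega> * generated_semigroup A t F (Y s \<omega>))"
proof -
  have [measurable]: "Y (s + t) \<in> measurable M S" "Y s \<in> measurable M S"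
    using s t by (auto intro!: Y_measurable)
  note F(1)[measurable] \<F>_borel[OF Z(1), measurable] semigroup_measurable[OF F, measurable]
  interpret sigma_finite_subalgebra M "\<F> s"
    by (intro finite_measure_subalgebra_is_sigma_finite)
      (auto simp: finite_measure_subalgebra_def finite_measure_subalgebra_axioms_def
        finite_measure_axioms subalgebra_\<F>)
  have int: "integrable M (\<lambda>\<omega>. Z \<omega> * F (Y (s + t) \<omega>))"
  proof (rule integrable_bdd)
    fix \<omega> assume "\<omega> \<in> space M"
    then show "\<bar>Z \<omega> * F (Y (s + t) \<omega>)\<bar> \<le> b * B"
      unfolding abs_mult using Z(2) F(2) Y_space[of "s + t"] s t
      by (intro mult_mono) (auto intro: order_trans[OF abs_ge_zero])
  qed measurable
  have ae: "AE \<omega> in M. real_cond_exp M (\<F> s) (\<lambda>\<omega>. F (Y (s + t) \<omega>)) \<omega>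
      = generated_semigroup A t F (Y s \<omega>)"
  proof -
    have "bounded (F ` space S)" using F(2) by (auto simp: bounded_iff)
    then show ?thesis using markov F(1) s t unfolding markov_jump_process_def by blast
  qed
  have "(LINT \<omega>|M. Z \<omega> * F (Y (s + t) \<omega>))
      = (LINT \<omega>|M. Z \<omega> * real_cond_exp M (\<F> s) (\<lambda>\<omega>. F (Y (s + t) \<omega>)) \<omega>)"
    by (rule real_cond_exp_intg(2)[symmetric]) (use int Z in auto)
  also have "\<dots> = (LINT \<omega>|M. Z \<omega> * generated_semigroup A t F (Y s \<omega>))"
    by (rule integral_cong_AE) (use ae in auto)
  finally show ?thesis .
qed

lemma weighted_increment_exp:
  assumes F: "F \<in> borel_measurable S" "\<And>x. x \<in> space S \<Longrightarrow> \<bar>F x\<bar> \<le> B"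
    and K: "\<And>x. x \<in> space S \<Longrightarrow> \<bar>A F x\<bar> \<le> K"
    and Z: "Z \<in> borel_measurable (\<F> s)" "\<And>\<omega>. \<omega> \<in> space M \<Longrightarrow> \<bar>Z \<omega>\<bar> \<le> b"
    and s: "0 \<le> s" and t: "0 \<le> t"
  shows "\<bar>(LINT \<omega>|M. Z \<omega> * F (Y (s + t) \<omega>)) - (LINT \<omega>|M. Z \<omega> * F (Y s \<omega>))\<bar>
    \<le> t * exp (c * t) * K * (LINT \<omega>|M. \<bar>Z \<omega>\<bar>)"
proof -
  have [measurable]: "Y s \<in> measurable M S"
    using s t by (auto intro!: Y_measurable)
  note F(1)[measurable] \<F>_borel[OF Z(1), measurable] semigroup_measurable[OF F, measurable]
  let ?P = "generated_semigroup A t F"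
  have inc: "\<bar>?P x - F x\<bar> \<le> t * exp (c * t) * K" if "x \<in> space S" for x
    using semigroup_increment[OF F K t that] .
  have bZ: "\<bar>Z \<omega> * F (Y s \<omega>)\<bar> \<le> b * B" if "\<omega> \<in> space M" for \<omega>
    unfolding abs_mult using Z(2) F(2) Y_space[of s] s t that
    by (intro mult_mono) (auto intro: order_trans[OF abs_ge_zero])
  have i1: "integrable M (\<lambda>\<omega>. Z \<omega> * F (Y s \<omega>))"
    by (rule integrable_bdd[OF _ bZ]) auto
  have bD: "\<bar>Z \<omega> * (?P (Y s \<omega>) - F (Y s \<omega>))\<bar> \<le> t * exp (c * t) * K * \<bar>Z \<omega>\<bar>" if "\<omega> \<in> space M" for \<omega>
    using mult_left_mono[OF inc[OF Y_space[OF s that]], of "\<bar>Z \<omega>\<bar>"] by (simp add: abs_mult mult_ac)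
  have iZ: "integrable M (\<lambda>\<omega>. \<bar>Z \<omega>\<bar>)"
    by (rule integrable_bdd[where b=b]) (use Z in auto)
  have iD: "integrable M (\<lambda>\<omega>. Z \<omega> * (?P (Y s \<omega>) - F (Y s \<omega>)))"
    by (rule Bochner_Integration.integrable_bound[OF integrable_mult_right[OF iZ, of "t * exp (c * t) * K"]])
      (use bD in \<open>auto intro!: AE_I2 intro: order_trans[OF _ abs_ge_self]\<close>)
  have "(LINT \<omega>|M. Z \<omega> * ?P (Y s \<omega>)) = (LINT \<omega>|M. Z \<omega> * F (Y s \<omega>) + Z \<omega> * (?P (Y s \<omega>) - F (Y s \<omega>)))"
    by (simp add: algebra_simps)
  also have "\<dots> = (LINT \<omega>|M. Z \<omega> * F (Y s \<omega>)) + (LINT \<omega>|M. Z \<omega> * (?P (Y s \<omega>) - F (Y s \<omega>)))"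
    by (rule Bochner_Integration.integral_add[OF i1 iD])
  finally have "(LINT \<omega>|M. Z \<omega> * F (Y (s + t) \<omega>)) - (LINT \<omega>|M. Z \<omega> * F (Y s \<omega>))
      = (LINT \<omega>|M. Z \<omega> * (?P (Y s \<omega>) - F (Y s \<omega>)))"
    using weighted_transition[OF F Z s t] by simp
  moreover have "\<bar>LINT \<omega>|M. Z \<omega> * (?P (Y s \<omega>) - F (Y s \<omega>))\<bar>
      \<le> (LINT \<omega>|M. t * exp (c * t) * K * \<bar>Z \<omega>\<bar>)"
    using integral_norm_bound[of M "\<lambda>\<omega>. Z \<omega> * (?P (Y s \<omega>) - F (Y s \<omega>))"]
      integral_mono[OF integrable_abs[OF iD] integrable_mult_right[OF iZ, of "t * exp (c * t) * K"] bD]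
    unfolding real_norm_def by linarith
  ultimately show ?thesis by simp
qed

text \<open>Cut the interval into \<open>n\<close> equal steps and apply \<open>weighted_increment_exp\<close> to each: the factor
  \<open>exp (c t)\<close> becomes \<open>exp (c t / n)\<close>, which tends to 1.  This is how the norm of the generator disappears.\<close>

lemma weighted_increment:
  assumes F: "F \<in> borel_measurable S" "\<And>x. x \<in> space S \<Longrightarrow> \<bar>F x\<bar> \<le> B"
    and K: "\<And>x. x \<in> space S \<Longrightarrow> \<bar>A F x\<bar> \<le> K"
    and Z: "Z \<in> borel_measurable (\<F> s)" "\<And>\<omega>. \<omega> \<in> space M \<Longrightarrow> \<bar>Z \<omega>\<bar> \<le> b"
    and s: "0 \<le> s" and t: "0 \<le> t"
  shows "\<bar>(LINT \<omega>|M. Z \<omega> * F (Y (s + t) \<omega>)) - (LINT \<omega>|M. Z \<omega> * F (Y s \<omega>))\<bar>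
    \<le> t * K * (LINT \<omega>|M. \<bar>Z \<omega>\<bar>)"
proof -
  let ?I = "\<lambda>u. LINT \<omega>|M. Z \<omega> * F (Y u \<omega>)" and ?Z = "LINT \<omega>|M. \<bar>Z \<omega>\<bar>"
  have "\<bar>?I (s + t) - ?I s\<bar> \<le> t * exp (c * (t / Suc n)) * K * ?Z" for n
  proof -
    let ?h = "t / Suc n"
    have h: "0 \<le> ?h" using t by simp
    have step: "\<bar>?I (s + Suc k * ?h) - ?I (s + k * ?h)\<bar> \<le> ?h * exp (c * ?h) * K * ?Z" for k
    proof -
      have e: "s + Suc k * ?h = (s + k * ?h) + ?h" by (simp add: algebra_simps add_divide_distrib)
      have k: "0 \<le> k * ?h" using h by (intro mult_nonneg_nonneg) auto
      show ?thesis unfolding e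
        by (rule weighted_increment_exp[OF F K \<F>_borel_mono[OF Z(1)] Z(2) _ h]) (use k s in auto)
    qed
    \<comment> \<open>the bound for a single step\<close>
    define D where "D = ?h * exp (c * ?h) * K * ?Z"
    have "\<bar>?I (s + k * ?h) - ?I s\<bar> \<le> k * D" for k :: nat
    proof (induction k)
      case (Suc k)
      have "Suc k * D = k * D + D" by (simp add: algebra_simps)
      then show ?case using Suc step[of k] unfolding D_def[symmetric] by linarith
    qed simp
    from this[of "Suc n"] show ?thesis unfolding D_def by (simp add: field_simps del: of_nat_Suc)
  qed
  moreover have "(\<lambda>n. t * exp (c * (t / Suc n)) * K * ?Z) \<longlonglongrightarrow> t * exp (c * 0) * K * ?Z"
    by (intro tendsto_intros LIMSEQ_Suc[OF lim_const_over_n])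
  ultimately have "\<bar>?I (s + t) - ?I s\<bar> \<le> t * exp (c * 0) * K * ?Z"
    by (intro LIMSEQ_le_const) auto
  then show ?thesis by simp
qed

text \<open>Write \<open>(v - u)\<^sup>2 = (v\<^sup>2 - u\<^sup>2) - 2 u (v - u)\<close> with \<open>u = f (Y s)\<close> and \<open>v = f (Y (s + t))\<close>.  The first
  bracket is an increment of \<open>f\<^sup>2\<close>, and in the second term \<open>u\<close> is known at time \<open>s\<close> and joins the weight.\<close>

lemma weighted_square_increment:
  assumes f: "f \<in> borel_measurable S" "\<And>x. x \<in> space S \<Longrightarrow> \<bar>f x\<bar> \<le> B"
    and K1: "\<And>x. x \<in> space S \<Longrightarrow> \<bar>A f x\<bar> \<le> K1"
    and K2: "\<And>x. x \<in> space S \<Longrightarrow> \<bar>A (\<lambda>x. (f x)\<^sup>2) x\<bar> \<le> K2"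
    and E: "E \<in> sets (\<F> s)" and s: "0 \<le> s" and t: "0 \<le> t"
  shows "(LINT \<omega>|M. indicator E \<omega> * (f (Y (s + t) \<omega>) - f (Y s \<omega>))\<^sup>2) \<le> t * (K2 + 2 * B * K1) * prob E"
proof -
  have EM[measurable]: "E \<in> events" using \<F>_subD[OF E] .
  have [measurable]: "Y s \<in> measurable M S" "Y (s + t) \<in> measurable M S"
    using s t by (auto intro!: Y_measurable)
  have [measurable]: "Y s \<in> measurable (\<F> s) S" using s by (intro Y_adapted) auto
  note f(1)[measurable] E[measurable]
  obtain \<omega>0 where "\<omega>0 \<in> space M" using not_empty by blast
  then have B0: "0 \<le> B" and K10: "0 \<le> K1"
    using f(2)[OF Y_space[OF s]] K1[OF Y_space[OF s]] by fastforce+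
  let ?s2 = "\<lambda>x. (f x)\<^sup>2" and ?Z1 = "\<lambda>\<omega>. indicator E \<omega> :: real"
  let ?Z2 = "\<lambda>\<omega>. indicator E \<omega> * f (Y s \<omega>)"
  have b2: "\<bar>?s2 x\<bar> \<le> B\<^sup>2" if "x \<in> space S" for x
    using power_mono[OF f(2)[OF that], of 2] by simp
  have bZ2: "\<bar>?Z2 \<omega>\<bar> \<le> B" if "\<omega> \<in> space M" for \<omega>
    using f(2)[OF Y_space[OF s that]] B0 by (auto simp: indicator_def)
  have ZFbd: "\<bar>Z * F\<bar> \<le> b * B'" if "\<bar>Z\<bar> \<le> b" "\<bar>F\<bar> \<le> B'" for Z F b B' :: real
    unfolding abs_mult using that by (intro mult_mono) (auto intro: order_trans[OF abs_ge_zero])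
  have i: "integrable M (\<lambda>\<omega>. ?Z1 \<omega> * ?s2 (Y u \<omega>))" "integrable M (\<lambda>\<omega>. ?Z2 \<omega> * f (Y u \<omega>))"
    if "u = s \<or> u = s + t" for u
  proof -
    have u: "0 \<le> u" using that s t by auto
    have [measurable]: "Y u \<in> measurable M S" using u by (rule Y_measurable)
    show "integrable M (\<lambda>\<omega>. ?Z1 \<omega> * ?s2 (Y u \<omega>))"
      by (rule integrable_bdd[where b="1 * B\<^sup>2"], measurable, rule ZFbd)
        (use b2 Y_space[OF u] in \<open>auto simp: indicator_def\<close>)
    show "integrable M (\<lambda>\<omega>. ?Z2 \<omega> * f (Y u \<omega>))"
      by (rule integrable_bdd[where b="B * B"], measurable, rule ZFbd)
        (use f(2) bZ2 Y_space[OF u] in auto)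
  qed
  have "(LINT \<omega>|M. indicator E \<omega> * (f (Y (s + t) \<omega>) - f (Y s \<omega>))\<^sup>2)
     = (LINT \<omega>|M. (?Z1 \<omega> * ?s2 (Y (s + t) \<omega>) - ?Z1 \<omega> * ?s2 (Y s \<omega>))
         - 2 * (?Z2 \<omega> * f (Y (s + t) \<omega>) - ?Z2 \<omega> * f (Y s \<omega>)))"
    by (rule Bochner_Integration.integral_cong) (auto simp: power2_eq_square algebra_simps)
  also have "\<dots> = ((LINT \<omega>|M. ?Z1 \<omega> * ?s2 (Y (s + t) \<omega>)) - (LINT \<omega>|M. ?Z1 \<omega> * ?s2 (Y s \<omega>)))
         - 2 * ((LINT \<omega>|M. ?Z2 \<omega> * f (Y (s + t) \<omega>)) - (LINT \<omega>|M. ?Z2 \<omega> * f (Y s \<omega>)))"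
    using i by (simp del: Bochner_Integration.integral_mult_right_zero)
  also have "\<dots> \<le> t * K2 * prob E + 2 * (t * K1 * (B * prob E))"
  proof -
    have "\<bar>(LINT \<omega>|M. ?Z1 \<omega> * ?s2 (Y (s + t) \<omega>)) - (LINT \<omega>|M. ?Z1 \<omega> * ?s2 (Y s \<omega>))\<bar>
        \<le> t * K2 * (LINT \<omega>|M. \<bar>?Z1 \<omega>\<bar>)"
      by (rule weighted_increment[OF _ b2 K2 _ _ s t, where b=1]) (auto simp: indicator_def)
    moreover have "(LINT \<omega>|M. \<bar>?Z1 \<omega>\<bar>) = prob E" by simp
    moreover have "\<bar>(LINT \<omega>|M. ?Z2 \<omega> * f (Y (s + t) \<omega>)) - (LINT \<omega>|M. ?Z2 \<omega> * f (Y s \<omega>))\<bar>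
        \<le> t * K1 * (LINT \<omega>|M. \<bar>?Z2 \<omega>\<bar>)"
      by (rule weighted_increment[OF f K1 _ bZ2 s t]) auto
    moreover have "(LINT \<omega>|M. \<bar>?Z2 \<omega>\<bar>) \<le> B * prob E"
    proof -
      have "(LINT \<omega>|M. \<bar>?Z2 \<omega>\<bar>) \<le> (LINT \<omega>|M. B * indicator E \<omega>)"
      proof (rule integral_mono)
        show "integrable M (\<lambda>\<omega>. \<bar>?Z2 \<omega>\<bar>)"
          by (rule integrable_bdd[where b=B]) (use bZ2 in auto)
        show "integrable M (\<lambda>\<omega>. B * indicator E \<omega>)"
          by (rule integrable_bdd[where b=B]) (use B0 in \<open>auto simp: indicator_def\<close>)
        show "\<bar>?Z2 \<omega>\<bar> \<le> B * indicator E \<omega>" if "\<omega> \<in> space M" for \<omega>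
          using f(2)[OF Y_space[OF s that]] by (auto simp: indicator_def)
      qed
      then show ?thesis by simp
    qed
    then have "t * K1 * (LINT \<omega>|M. \<bar>?Z2 \<omega>\<bar>) \<le> t * K1 * (B * prob E)"
      using t K10 by (intro mult_left_mono) auto
    ultimately show ?thesis by (auto simp: abs_le_iff)
  qed
  finally show ?thesis by (simp add: algebra_simps)
qed


lemma right_constant:
  assumes "\<omega> \<in> space M" "0 \<le> t" "t < b"
  obtains q where "q \<in> \<rat>" "t < q" "q < b" "Y q \<omega> = Y t \<omega>"
proof -
  have "\<forall>\<^sub>F u in at_right t. Y u \<omega> = Y t \<omega>"
    using markov assms by (auto simp: markov_jump_process_def)
  then obtain d where d: "t < d" "\<And>u. t < u \<Longrightarrow> u < d \<Longrightarrow> Y u \<omega> = Y t \<omega>"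
    unfolding eventually_at_right_field by blast
  obtain q where "q \<in> \<rat>" "t < q" "q < min d b" using Rats_dense_in_real[of t "min d b"] d(1) assms(3) by auto
  then show ?thesis using d(2) that by auto
qed

text \<open>Consider the first time \<open>u\<close> in \<open>T\<close> at which \<open>\<bar>f\<bar>\<close> exceeds \<open>2 l\<close>.  If \<open>\<bar>f\<bar> \<le> l\<close> at time \<open>b\<close>, then \<open>f\<close> has moved
  by more than \<open>l\<close> in between, which by \<open>inc\<close> and Chebyshev's inequality has conditional probability at
  most 1/2.  The induction splits off the earliest time of \<open>T\<close>; the event \<open>E\<close> carries the information that the
  earlier times have been passed without an excess.\<close>

lemma ottaviani_finite:
  assumes f[measurable]: "f \<in> borel_measurable S" and bd: "\<And>x. x \<in> space S \<Longrightarrow> \<bar>f x\<bar> \<le> B"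
    and l: "0 < l" and a: "0 \<le> a"
    and inc: "\<And>u E. a \<le> u \<Longrightarrow> u \<le> b \<Longrightarrow> E \<in> sets (\<F> u) \<Longrightarrow>
      (LINT \<omega>|M. indicator E \<omega> * (f (Y b \<omega>) - f (Y u \<omega>))\<^sup>2) \<le> l\<^sup>2 / 2 * prob E"
    and T: "finite T" "T \<subseteq> {a..b}" and E: "E \<in> events" "\<And>u. u \<in> T \<Longrightarrow> E \<in> sets (\<F> u)"
  shows "prob (E \<inter> {\<omega> \<in> space M. \<exists>u\<in>T. 2 * l < \<bar>f (Y u \<omega>)\<bar>})
    \<le> 2 * prob (E \<inter> {\<omega> \<in> space M. l < \<bar>f (Y b \<omega>)\<bar>})"
  using T E
proof (induction T arbitrary: E rule: finite_linorder_min_induct)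
  case (insert u T)
  note [measurable] = \<open>E \<in> events\<close>
  have u: "a \<le> u" "u \<le> b" "0 \<le> u" "0 \<le> b" using insert.prems a by auto
  have [measurable]: "Y u \<in> measurable M S" "Y b \<in> measurable M S" using u by (auto intro: Y_measurable)
  have Tm: "{\<omega> \<in> space M. \<exists>u\<in>T. 2 * l < \<bar>f (Y u \<omega>)\<bar>} \<in> events"
  proof -
    have "{\<omega> \<in> space M. 2 * l < \<bar>f (Y v \<omega>)\<bar>} \<in> events" if "v \<in> T" for v
    proof -
      have "0 \<le> v" using that insert.prems a by auto
      note Y_measurable[OF this, measurable]
      show ?thesis by measurable
    qed
    moreover have "{\<omega> \<in> space M. \<exists>u\<in>T. 2 * l < \<bar>f (Y u \<omega>)\<bar>} = (\<Union>u\<in>T. {\<omega> \<in> space M. 2 * l < \<bar>f (Y u \<omega>)\<bar>})"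
      by blast
    ultimately show ?thesis using insert.hyps(1) by (simp only: sets.finite_UN)
  qed
  have [measurable]: "Y u \<in> measurable (\<F> u) S" using u by (intro Y_adapted) auto
  have Fu: "E \<in> sets (\<F> u)" using insert.prems by auto
  let ?D = "{\<omega> \<in> space M. 2 * l < \<bar>f (Y u \<omega>)\<bar>}"
  define E1 where "E1 = E \<inter> ?D"
  define E2 where "E2 = E - ?D"
  have "?D \<in> sets (\<F> u)" using space_\<F>[of u] by (subst space_\<F>[of u, symmetric]) measurable
  then have E12: "E1 \<in> sets (\<F> u)" "E2 \<in> sets (\<F> u)" using Fu by (auto simp: E1_def E2_def)
  note E12[THEN \<F>_subD, measurable]
  let ?L = "{\<omega> \<in> space M. l < \<bar>f (Y b \<omega>)\<bar>}"
  have "prob (E2 \<inter> {\<omega> \<in> space M. \<exists>u\<in>T. 2 * l < \<bar>f (Y u \<omega>)\<bar>}) \<le> 2 * prob (E2 \<inter> ?L)"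
  proof (rule insert.IH)
    show "T \<subseteq> {a..b}" using insert.prems by simp
    show "E2 \<in> sets (\<F> v)" if "v \<in> T" for v
      using insert.hyps that E12(2) \<F>_mono[of u v] by (auto dest: less_imp_le)
  qed (rule \<F>_subD[OF E12(2)])
  moreover have "prob E1 \<le> 2 * prob (E1 \<inter> ?L)"
  proof -
    have "l\<^sup>2 * prob (E1 - ?L) = (LINT \<omega>|M. l\<^sup>2 * indicator (E1 - ?L) \<omega>)" by simp
    also have "\<dots> \<le> (LINT \<omega>|M. indicator E1 \<omega> * (f (Y b \<omega>) - f (Y u \<omega>))\<^sup>2)"
    proof (rule integral_mono)
      show "integrable M (\<lambda>\<omega>. l\<^sup>2 * indicator (E1 - ?L) \<omega>)"
        by (rule integrable_bdd[where b="l\<^sup>2"]) (auto simp: indicator_def)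
      have "\<bar>(f (Y b \<omega>) - f (Y u \<omega>))\<^sup>2\<bar> \<le> (2 * B)\<^sup>2" if "\<omega> \<in> space M" for \<omega>
        using bd[OF Y_space[OF u(3) that]] bd[OF Y_space[OF u(4) that]]
        unfolding abs_power2 by (intro power2_le_iff_abs_le[THEN iffD2]) auto
      then show "integrable M (\<lambda>\<omega>. indicator E1 \<omega> * (f (Y b \<omega>) - f (Y u \<omega>))\<^sup>2)"
        by (intro integrable_bdd[where b="(2 * B)\<^sup>2"]) (auto simp: indicator_def)
      show "l\<^sup>2 * indicator (E1 - ?L) \<omega> \<le> indicator E1 \<omega> * (f (Y b \<omega>) - f (Y u \<omega>))\<^sup>2"
        if "\<omega> \<in> space M" for \<omega>
      proof (cases "\<omega> \<in> E1 - ?L")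
        case True
        then have "l \<le> \<bar>f (Y b \<omega>) - f (Y u \<omega>)\<bar>" using that by (auto simp: E1_def)
        then have "l\<^sup>2 \<le> (f (Y b \<omega>) - f (Y u \<omega>))\<^sup>2"
          using l by (metis abs_le_square_iff abs_of_pos)
        then show ?thesis using True by simp
      qed (auto simp: indicator_def)
    qed
    also have "\<dots> \<le> l\<^sup>2 / 2 * prob E1" using u by (intro inc E12)
    finally have "prob (E1 - ?L) \<le> prob E1 / 2" using l by simp
    moreover have "prob E1 = prob (E1 \<inter> ?L) + prob (E1 - ?L)"
      by (subst finite_measure_Union[symmetric]) (auto intro!: arg_cong[where f=prob])
    ultimately show ?thesis by simp
  qed
  moreover have "prob (E \<inter> ?L) = prob (E1 \<inter> ?L) + prob (E2 \<inter> ?L)"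
    by (subst finite_measure_Union[symmetric]) (auto simp: E1_def E2_def intro!: arg_cong[where f=prob])
  moreover have "prob (E \<inter> {\<omega> \<in> space M. \<exists>u\<in>insert u T. 2 * l < \<bar>f (Y u \<omega>)\<bar>})
      \<le> prob (E1 \<union> E2 \<inter> {\<omega> \<in> space M. \<exists>u\<in>T. 2 * l < \<bar>f (Y u \<omega>)\<bar>})"
    using Tm by (intro finite_measure_mono) (auto simp: E1_def E2_def)
  moreover have "\<dots> \<le> prob E1 + prob (E2 \<inter> {\<omega> \<in> space M. \<exists>u\<in>T. 2 * l < \<bar>f (Y u \<omega>)\<bar>})"
    using Tm by (intro measure_Un_le) auto
  ultimately show ?case by linarith
qed simp

text \<open>Right-continuous step paths take on \<open>[a, b]\<close> only values that they take at rational times or at \<open>b\<close>, so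
  the finite version extends by monotone convergence.\<close>

lemma ottaviani:
  assumes f[measurable]: "f \<in> borel_measurable S" and bd: "\<And>x. x \<in> space S \<Longrightarrow> \<bar>f x\<bar> \<le> B"
    and K1: "\<And>x. x \<in> space S \<Longrightarrow> \<bar>A f x\<bar> \<le> K1"
    and K2: "\<And>x. x \<in> space S \<Longrightarrow> \<bar>A (\<lambda>x. (f x)\<^sup>2) x\<bar> \<le> K2"
    and l: "0 < l" and a: "0 \<le> a" "a \<le> b" and short: "(b - a) * (K2 + 2 * B * K1) \<le> l\<^sup>2 / 2"
  shows "{\<omega> \<in> space M. \<exists>u\<in>{a..b}. 2 * l < \<bar>f (Y u \<omega>)\<bar>} \<in> events" (is "?sup \<in> _")
    and "prob {\<omega> \<in> space M. \<exists>u\<in>{a..b}. 2 * l < \<bar>f (Y u \<omega>)\<bar>}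
      \<le> 2 * prob {\<omega> \<in> space M. l < \<bar>f (Y b \<omega>)\<bar>}"
proof -
  \<comment> \<open>finite sets that increase to \<open>b\<close> and the rationals of \<open>[a, b]\<close>\<close>
  define T where "T n = {a..b} \<inter> insert b (of_rat ` nat_to_rat_surj ` {..<n})" for n :: nat
  let ?E = "\<lambda>n. {\<omega> \<in> space M. \<exists>u\<in>T n. 2 * l < \<bar>f (Y u \<omega>)\<bar>}"
  have fin: "finite (T n)" for n by (simp add: T_def)
  have Tm: "Y u \<in> measurable M S" if "u \<in> T n" for u n
  proof -
    have "a \<le> u" using that by (simp add: T_def)
    then show ?thesis using a(1) by (intro Y_measurable) linarith
  qed
  have Em: "?E n \<in> events" for n
  proof -
    have "?E n = (\<Union>u\<in>T n. {\<omega> \<in> space M. 2 * l < \<bar>f (Y u \<omega>)\<bar>})" by blast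
    moreover have "{\<omega> \<in> space M. 2 * l < \<bar>f (Y u \<omega>)\<bar>} \<in> events" if "u \<in> T n" for u
      using Tm[OF that] by measurable
    ultimately show ?thesis using fin[of n] by (simp only: sets.finite_UN)
  qed
  have inc: "(LINT \<omega>|M. indicator E \<omega> * (f (Y b \<omega>) - f (Y u \<omega>))\<^sup>2) \<le> l\<^sup>2 / 2 * prob E"
    if u: "a \<le> u" "u \<le> b" and E: "E \<in> sets (\<F> u)" for u E
  proof -
    obtain \<omega>0 where "\<omega>0 \<in> space M" using not_empty by blast
    then have "Y a \<omega>0 \<in> space S" using a Y_space by auto
    then have "0 \<le> B" "0 \<le> K1" "0 \<le> K2"
      using bd[of "Y a \<omega>0"] K1[of "Y a \<omega>0"] K2[of "Y a \<omega>0"] by linarith+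
    then have "(b - u) * (K2 + 2 * B * K1) \<le> (b - a) * (K2 + 2 * B * K1)"
      using u by (intro mult_right_mono) auto
    then have "(b - u) * (K2 + 2 * B * K1) * prob E \<le> l\<^sup>2 / 2 * prob E"
      using short by (intro mult_right_mono) auto
    then show ?thesis
      using weighted_square_increment[OF f bd K1 K2 E, of "b - u"] u a by simp
  qed
  have bound: "prob (?E n) \<le> 2 * prob {\<omega> \<in> space M. l < \<bar>f (Y b \<omega>)\<bar>}" for n
  proof -
    have T: "T n \<subseteq> {a..b}" unfolding T_def by (rule Int_lower1)
    have top: "space M \<in> sets (\<F> u)" for u using sets.top[of "\<F> u"] unfolding space_\<F> .
    have restrict: "space M \<inter> {\<omega> \<in> space M. P \<omega>} = {\<omega> \<in> space M. P \<omega>}" for P by blast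
    show ?thesis
      using ottaviani_finite[OF f bd l a(1) inc fin[of n] T sets.top top] unfolding restrict .
  qed
  have sup: "?sup = (\<Union>n. ?E n)"
  proof (intro equalityI subsetI)
    fix \<omega> assume "\<omega> \<in> ?sup"
    then obtain u where u: "\<omega> \<in> space M" "a \<le> u" "u \<le> b" "2 * l < \<bar>f (Y u \<omega>)\<bar>" by auto
    have "\<exists>n. \<exists>v\<in>T n. Y v \<omega> = Y u \<omega>"
    proof (cases "u = b")
      case True
      then have "u \<in> T 0" using u by (simp add: T_def)
      then show ?thesis by blast
    next
      case False
      then obtain q where q: "q \<in> \<rat>" "u < q" "q < b" "Y q \<omega> = Y u \<omega>"
        using right_constant[OF u(1), of u b] u a by auto
      obtain r where r: "q = of_rat r" using q(1) by (rule Rats_cases)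
      obtain n where "r = nat_to_rat_surj n" using surj_nat_to_rat_surj by (rule surjE)
      then have "q \<in> T (Suc n)" using q u r by (simp add: T_def)
      then show ?thesis using q(4) by blast
    qed
    then obtain n v where v: "v \<in> T n" "Y v \<omega> = Y u \<omega>" by blast
    then have "\<omega> \<in> ?E n" using u(1,4) by (intro CollectI conjI bexI[of _ v]) simp_all
    then show "\<omega> \<in> (\<Union>n. ?E n)" by blast
  qed (use T_def in blast)
  show "?sup \<in> events" unfolding sup using Em by auto
  have "(\<lambda>n. prob (?E n)) \<longlonglongrightarrow> prob (\<Union>n. ?E n)"
  proof (rule finite_Lim_measure_incseq)
    have "T m \<subseteq> T n" if "m \<le> n" for m n
      using that unfolding T_def by (intro Int_mono insert_mono image_mono) auto
    then show "incseq ?E" unfolding incseq_def by blast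
  qed (use Em in auto)
  then show "prob ?sup \<le> 2 * prob {\<omega> \<in> space M. l < \<bar>f (Y b \<omega>)\<bar>}"
    unfolding sup by (rule LIMSEQ_le_const2) (use bound in blast)
qed

text \<open>Cutting \<open>[0, t]\<close> into \<open>n\<close> intervals short enough for Ottaviani's inequality costs a factor \<open>n\<close>.  The choice
  of \<open>n\<close> depends on \<open>t\<close>, \<open>l\<close> and the bounds \<open>B\<close>, \<open>K1\<close>, \<open>K2\<close> alone, so it is the same for systems of all sizes.\<close>

lemma maximal_inequality:
  assumes f[measurable]: "f \<in> borel_measurable S" and bd: "\<And>x. x \<in> space S \<Longrightarrow> \<bar>f x\<bar> \<le> B"
    and K1: "\<And>x. x \<in> space S \<Longrightarrow> \<bar>A f x\<bar> \<le> K1"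
    and K2: "\<And>x. x \<in> space S \<Longrightarrow> \<bar>A (\<lambda>x. (f x)\<^sup>2) x\<bar> \<le> K2"
    and l: "0 < l" and t: "0 \<le> t" and n: "0 < n" and fine: "t / real n * (K2 + 2 * B * K1) \<le> l\<^sup>2 / 2"
    and p: "\<And>u. 0 \<le> u \<Longrightarrow> prob {\<omega> \<in> space M. l < \<bar>f (Y u \<omega>)\<bar>} \<le> p"
  shows "{\<omega> \<in> space M. \<exists>u\<in>{0..t}. 2 * l < \<bar>f (Y u \<omega>)\<bar>} \<in> events" (is "?sup \<in> _")
    and "prob {\<omega> \<in> space M. \<exists>u\<in>{0..t}. 2 * l < \<bar>f (Y u \<omega>)\<bar>} \<le> 2 * real n * p"
proof -
  let ?a = "\<lambda>k. real k * (t / real n)"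
  let ?E = "\<lambda>k. {\<omega> \<in> space M. \<exists>u\<in>{?a k..?a (Suc k)}. 2 * l < \<bar>f (Y u \<omega>)\<bar>}"
  have h: "0 \<le> t / real n" using t by simp
  have a: "0 \<le> ?a k" "?a k \<le> ?a (Suc k)" for k
    using h by (auto intro!: mult_nonneg_nonneg mult_right_mono simp del: times_divide_eq_right)
  have e: "(?a (Suc k) - ?a k) * (K2 + 2 * B * K1) \<le> l\<^sup>2 / 2" for k
  proof -
    have "?a (Suc k) - ?a k = t / real n" by (simp add: algebra_simps add_divide_distrib)
    then show ?thesis using fine by simp
  qed
  have Em: "?E k \<in> events" and Ep: "prob (?E k) \<le> 2 * p" for k
    using ottaviani[OF f bd K1 K2 l a e, of k] p[of "?a (Suc k)"] a(1)[of "Suc k"] by auto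
  have sup: "?sup = (\<Union>k<n. ?E k)"
  proof (intro equalityI subsetI)
    fix \<omega> assume "\<omega> \<in> ?sup"
    then obtain u where u: "\<omega> \<in> space M" "0 \<le> u" "u \<le> t" "2 * l < \<bar>f (Y u \<omega>)\<bar>" by auto
    have "\<exists>k<n. ?a k \<le> u \<and> u \<le> ?a (Suc k)"
    proof -
      have "\<exists>k\<le>n. u \<le> ?a k" using u n by (intro exI[of _ n]) auto
      then obtain k where k: "k \<le> n" "u \<le> ?a k" "\<And>j. j < k \<Longrightarrow> \<not> u \<le> ?a j"
        using exists_least_iff[of "\<lambda>k. k \<le> n \<and> u \<le> ?a k"] by (metis less_le_trans less_imp_le)
      show ?thesis
      proof (cases k)
        case 0
        then have "u = 0" using k u by simp
        then show ?thesis using n t a[of 0] by (intro exI[of _ 0]) auto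
      next
        case (Suc j)
        then show ?thesis using k(1,2) k(3)[of j] by (intro exI[of _ j]) auto
      qed
    qed
    then obtain k where k: "k < n" "?a k \<le> u" "u \<le> ?a (Suc k)" by (elim exE conjE)
    have "u \<in> {?a k..?a (Suc k)}" using k(2,3) by (simp only: atLeastAtMost_iff)
    then have "\<omega> \<in> ?E k" using u(1,4) by (intro CollectI conjI bexI[of _ u])
    then show "\<omega> \<in> (\<Union>k<n. ?E k)" using k(1) by (intro UN_I) (simp_all only: lessThan_iff)
  next
    fix \<omega> assume "\<omega> \<in> (\<Union>k<n. ?E k)"
    then obtain k u where k: "k < n" "\<omega> \<in> space M" "?a k \<le> u" "u \<le> ?a (Suc k)" "2 * l < \<bar>f (Y u \<omega>)\<bar>" by auto
    have "?a (Suc k) \<le> real n * (t / real n)" using k(1) h by (intro mult_right_mono) auto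
    then have "u \<le> t" "0 \<le> u" using k n a(1)[of k] by auto
    then show "\<omega> \<in> ?sup" using k by auto
  qed
  show "?sup \<in> events" unfolding sup using Em by auto
  have "prob ?sup \<le> (\<Sum>k<n. prob (?E k))"
    unfolding sup by (intro finite_measure_subadditive_finite) (use Em in auto)
  also have "\<dots> \<le> (\<Sum>k<n. 2 * p)" using Ep by (intro sum_mono)
  finally show "prob ?sup \<le> 2 * real n * p" by simp
qed

end

section \<open>The exchange dynamics\<close>

text \<open>Holds for every \<open>f\<close>, since the integral of a function that is not integrable is 0 by convention.  For time
  integrals along paths this saves the proof that the integrand is measurable in time.\<close>

lemma set_integral_interval_bound:
  fixes f :: "real \<Rightarrow> real"
  assumes "\<And>s. s \<in> {0..t} \<Longrightarrow> \<bar>f s\<bar> \<le> b" "0 \<le> b" "0 \<le> t"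
  shows "\<bar>LINT s:{0..t}|lborel. f s\<bar> \<le> t * b"
proof (cases "set_integrable lborel {0..t} f")
  case True
  have "norm (LINT s:{0..t}|lborel. f s) \<le> (LINT s|lborel. norm (indicator {0..t} s *\<^sub>R f s))"
    unfolding set_lebesgue_integral_def by (rule integral_norm_bound)
  also have "\<dots> \<le> (LINT s|lborel. b * indicator {0..t} s)"
  proof (rule integral_mono)
    show "integrable lborel (\<lambda>s. norm (indicator {0..t} s *\<^sub>R f s))"
      using True unfolding set_integrable_def by (rule integrable_norm)
    show "integrable lborel (\<lambda>s. b * indicator {0..t} s)"
      using assms(3) by (intro integrable_mult_right integrable_real_indicator) auto
  qed (use assms in \<open>auto simp: indicator_def\<close>)
  also have "\<dots> = t * b" using assms(3) by simp
  finally show ?thesis by simp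
next
  case False
  then have "(LINT s:{0..t}|lborel. f s) = 0"
    unfolding set_integrable_def set_lebesgue_integral_def by (rule not_integrable_integral_eq)
  then show ?thesis using assms by simp
qed

text \<open>The law of the random fraction \<open>r\<close>.  As a measure on the interval, and not on the whole line, it makes the
  map \<open>(r, x) \<mapsto> exchange i j r x\<close> measurable: outside of the interval, wealths would become negative.\<close>

definition unit_interval :: "real measure" where
  "unit_interval = restrict_space lborel {0..1}"

lemma space_unit_interval [simp]: "space unit_interval = {0..1}"
  by (simp add: unit_interval_def space_restrict_space)

lemma sets_unit_interval: "sets unit_interval = sets (restrict_space borel {0..1})"
  unfolding unit_interval_def by (rule sets_restrict_space_cong) simp

lemma prob_space_unit_interval: "prob_space unit_interval"
  by (rule prob_spaceI) (simp add: unit_interval_def space_restrict_space emeasure_restrict_space)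

lemma set_integral_unit_interval:
  "(LINT r:{0..1}|lborel. f r) = (LINT r|unit_interval. f r)" for f :: "real \<Rightarrow> real"
  by (simp add: unit_interval_def set_lebesgue_integral_def integral_restrict_space)

lemma measurable_unit_interval_id: "(\<lambda>r. r) \<in> measurable unit_interval borel"
  unfolding measurable_cong_sets[OF sets_unit_interval refl] by (rule measurable_restrict_space1) simp

lemma measurable_Rplus_id: "(\<lambda>x. x) \<in> measurable Rplus borel"
  unfolding Rplus_def by (rule measurable_restrict_space1) simp

lemma measurable_into_Rplus:
  "f \<in> borel_measurable M \<Longrightarrow> (\<And>x. x \<in> space M \<Longrightarrow> 0 \<le> f x) \<Longrightarrow> f \<in> measurable M Rplus"
  unfolding Rplus_def by (rule measurable_restrict_space2) auto

abbreviation states :: "nat \<Rightarrow> (nat \<Rightarrow> real) measure" where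
  "states N \<equiv> PiM {..<N} (\<lambda>_. Rplus)"

lemma statesD: "x \<in> space (states N) \<Longrightarrow> i < N \<Longrightarrow> 0 \<le> x i"
  by (auto simp: space_PiM)

lemma coordinate_measurable: "i < N \<Longrightarrow> (\<lambda>x. x i) \<in> borel_measurable (states N)"
  using measurable_compose[OF measurable_component_singleton[of i "{..<N}" "\<lambda>_. Rplus"] measurable_Rplus_id]
  by simp

lemma exchange_states:
  assumes "x \<in> space (states N)" "i < N" "j < N" "r \<in> {0..1}"
  shows "exchange i j r x \<in> space (states N)"
  using assms by (auto simp: space_PiM exchange_def PiE_iff extensional_def)

lemma exchange_sum:
  assumes "i < N" "j < N" "i \<noteq> j"
  shows "(\<Sum>k<N. exchange i j r x k) = (\<Sum>k<N. x k)"
proof -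
  have s: "(\<Sum>k<N. y k) = y i + y j + (\<Sum>k\<in>{..<N} - {i, j}. y k)" for y :: "nat \<Rightarrow> real"
  proof -
    have "(\<Sum>k<N. y k) = (\<Sum>k\<in>{i, j}. y k) + (\<Sum>k\<in>{..<N} - {i, j}. y k)"
      using assms by (subst sum.subset_diff[of "{i, j}"]) auto
    then show ?thesis using assms by simp
  qed
  have "(\<Sum>k\<in>{..<N} - {i, j}. exchange i j r x k) = (\<Sum>k\<in>{..<N} - {i, j}. x k)"
    by (rule sum.cong) (auto simp: exchange_def)
  then show ?thesis
    unfolding s[of "exchange i j r x"] s[of x] using assms by (simp add: exchange_def algebra_simps)
qed

lemma exchange_measurable:
  assumes "i < N" "j < N"
  shows "(\<lambda>(r, x). exchange i j r x) \<in> measurable (unit_interval \<Otimes>\<^sub>M states N) (states N)"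
proof -
  let ?P = "unit_interval \<Otimes>\<^sub>M states N"
  have r[measurable]: "fst \<in> borel_measurable ?P"
    by (rule measurable_compose[OF measurable_fst measurable_unit_interval_id])
  have c[measurable]: "(\<lambda>p. snd p k) \<in> borel_measurable ?P" if "k < N" for k
    by (rule measurable_compose[OF measurable_snd coordinate_measurable[OF that]])
  have 1: "(\<lambda>p. fst p * (snd p i + snd p j)) \<in> measurable ?P Rplus"
    "(\<lambda>p. (1 - fst p) * (snd p i + snd p j)) \<in> measurable ?P Rplus"
    using assms c[OF assms(1)] c[OF assms(2)]
    by (auto intro!: measurable_into_Rplus mult_nonneg_nonneg add_nonneg_nonneg
        simp: space_pair_measure statesD)
  have "(\<lambda>p. (snd p)(i := fst p * (snd p i + snd p j), j := (1 - fst p) * (snd p i + snd p j)))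
      \<in> measurable ?P (states N)"
    using assms
    by (intro measurable_fun_upd[where J="{..<N}"] 1 measurable_snd) auto
  then show ?thesis by (simp add: exchange_def case_prod_beta)
qed

lemma integral_unit_interval_measurable:
  fixes f :: "'b \<Rightarrow> real \<Rightarrow> real"
  assumes "(\<lambda>(x, r). f x r) \<in> borel_measurable (L \<Otimes>\<^sub>M unit_interval)"
  shows "(\<lambda>x. LINT r|unit_interval. f x r) \<in> borel_measurable L"
proof -
  interpret prob_space unit_interval by (rule prob_space_unit_interval)
  show ?thesis using assms by (rule borel_measurable_lebesgue_integral)
qed

lemma integral_unit_interval_bound:
  fixes f :: "real \<Rightarrow> real"
  assumes "\<And>r. r \<in> {0..1} \<Longrightarrow> \<bar>f r\<bar> \<le> b"
  shows "\<bar>LINT r|unit_interval. f r\<bar> \<le> b"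
  using set_integral_interval_bound[of 1 f b] assms order_trans[OF abs_ge_zero assms[of 0]]
  by (simp add: set_integral_unit_interval)

lemma exchange_compose_measurable:
  assumes F: "F \<in> borel_measurable (states N)" and ij: "i < N" "j < N"
  shows "(\<lambda>(x, r). F (exchange i j r x)) \<in> borel_measurable (states N \<Otimes>\<^sub>M unit_interval)"
proof -
  have "(\<lambda>(x, r). exchange i j r x) \<in> measurable (states N \<Otimes>\<^sub>M unit_interval) (states N)"
    using measurable_compose[OF measurable_pair_swap' exchange_measurable[OF ij]]
    by (simp add: case_prod_beta)
  from measurable_compose[OF this F] show ?thesis by (simp add: case_prod_beta)
qed

lemma exchange_generator_eq:
  "exchange_generator N F x =
    (\<Sum>(i, j)\<in>off_diagonal N. 1 / N * (LINT r|unit_interval. F (exchange i j r x) - F x))"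
  by (simp add: exchange_generator_def set_integral_unit_interval)

lemma exchange_generator_measurable:
  assumes F[measurable]: "F \<in> borel_measurable (states N)"
  shows "exchange_generator N F \<in> borel_measurable (states N)"
proof -
  have "(\<lambda>x. \<Sum>p\<in>off_diagonal N. 1 / N * (LINT r|unit_interval. F (exchange (fst p) (snd p) r x) - F x))
      \<in> borel_measurable (states N)"
  proof (intro borel_measurable_sum borel_measurable_times borel_measurable_const
      integral_unit_interval_measurable)
    fix p assume "p \<in> off_diagonal N"
    then have [measurable]: "(\<lambda>(x, r). F (exchange (fst p) (snd p) r x))
        \<in> borel_measurable (states N \<Otimes>\<^sub>M unit_interval)"
      by (intro exchange_compose_measurable F) auto
    show "(\<lambda>(x, r). F (exchange (fst p) (snd p) r x) - F x)
        \<in> borel_measurable (states N \<Otimes>\<^sub>M unit_interval)"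
      by (simp add: case_prod_beta) measurable
  qed
  then show ?thesis by (simp add: exchange_generator_eq[abs_def] case_prod_beta)
qed

text \<open>There are at most \<open>N\<^sup>2\<close> pairs, each at rate \<open>1/N\<close>.\<close>

lemma exchange_generator_bound:
  assumes "\<And>i j r. i < N \<Longrightarrow> j < N \<Longrightarrow> i \<noteq> j \<Longrightarrow> r \<in> {0..1} \<Longrightarrow> \<bar>F (exchange i j r x) - F x\<bar> \<le> D"
    and D: "0 \<le> D"
  shows "\<bar>exchange_generator N F x\<bar> \<le> N * D"
proof (cases "N = 0")
  case False
  have "\<bar>exchange_generator N F x\<bar>
      \<le> (\<Sum>p\<in>off_diagonal N. \<bar>case p of (i, j) \<Rightarrow> 1 / N * (LINT r|unit_interval. F (exchange i j r x) - F x)\<bar>)"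
    unfolding exchange_generator_eq by (rule sum_abs)
  also have "\<dots> \<le> (\<Sum>p\<in>off_diagonal N. 1 / N * D)"
  proof (rule sum_mono)
    fix p assume "p \<in> off_diagonal N"
    then obtain i j where p: "p = (i, j)" "i < N" "j < N" "i \<noteq> j" by auto
    have "\<bar>LINT r|unit_interval. F (exchange i j r x) - F x\<bar> \<le> D"
      using assms p by (intro integral_unit_interval_bound) auto
    then show "\<bar>case p of (i, j) \<Rightarrow> 1 / N * (LINT r|unit_interval. F (exchange i j r x) - F x)\<bar> \<le> 1 / N * D"
      unfolding p(1) by (simp add: abs_mult divide_right_mono)
  qed
  also have "\<dots> = real (card (off_diagonal N)) * (1 / N * D)" by simp
  also have "\<dots> \<le> real (N * N) * (1 / N * D)"
    using D by (intro mult_right_mono of_nat_mono card_off_diagonal_le) auto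
  finally show ?thesis using False by simp
qed (simp add: exchange_generator_eq)

lemma wealth_exchange_bounded_jump:
  assumes M: "prob_space M" and Y: "wealth_exchange_process M N Y"
  shows "bounded_jump_process M (states N) (exchange_generator N) Y (2 * real N)"
proof -
  interpret prob_space M by fact
  show ?thesis
  proof
    show "markov_jump_process M (states N) (exchange_generator N) Y"
      using Y unfolding wealth_exchange_process_def .
  next
    fix F :: "(nat \<Rightarrow> real) \<Rightarrow> real" and B x assume F: "F \<in> borel_measurable (states N)" and B: "\<And>x. x \<in> space (states N) \<Longrightarrow> \<bar>F x\<bar> \<le> B"
      and x: "x \<in> space (states N)"
    have "\<bar>exchange_generator N F x\<bar> \<le> N * (2 * B)"
    proof (rule exchange_generator_bound)
      show "0 \<le> 2 * B" using order_trans[OF abs_ge_zero B[OF x]] by simp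
      show "\<bar>F (exchange i j r x) - F x\<bar> \<le> 2 * B" if "i < N" "j < N" "r \<in> {0..1}" for i j r
        using B[OF x] B[OF exchange_states[OF x that]] by linarith
    qed
    then show "\<bar>exchange_generator N F x\<bar> \<le> 2 * real N * B" by simp
  qed (simp_all add: exchange_generator_measurable)
qed

text \<open>The generator annihilates every function of the total wealth, so the squared increment of such a
  function has mean 0.  The arctangent is a bounded one that is injective.  This gives conservation at rational
  times, and at all times by right-continuity.\<close>

lemma wealth_conserved:
  assumes M: "prob_space M" and Y: "wealth_exchange_process M N Y"
  shows "AE \<omega> in M. \<forall>t\<ge>0. (\<Sum>i<N. Y t \<omega> i) = (\<Sum>i<N. Y 0 \<omega> i)"
proof -
  interpret bounded_jump_process M "states N" "exchange_generator N" Y "2 * real N"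
    by (rule wealth_exchange_bounded_jump[OF M Y])
  let ?f = "\<lambda>x. arctan (\<Sum>i<N. x i)"
  have f[measurable]: "?f \<in> borel_measurable (states N)"
    by (intro measurable_compose[OF _ borel_measurable_arctan] borel_measurable_sum coordinate_measurable) simp
  have bd: "\<bar>?f x\<bar> \<le> 2" for x
    using arctan_bounded[of "\<Sum>i<N. x i"] pi_half_less_two by (auto simp: abs_le_iff)
  have K: "\<bar>exchange_generator N ?f x\<bar> \<le> 0" "\<bar>exchange_generator N (\<lambda>x. (?f x)\<^sup>2) x\<bar> \<le> 0" for x
    using exchange_generator_bound[of N ?f x 0] exchange_generator_bound[of N "\<lambda>x. (?f x)\<^sup>2" x 0]
    by (simp_all add: exchange_sum)
  have fixed_time: "AE \<omega> in M. (\<Sum>i<N. Y t \<omega> i) = (\<Sum>i<N. Y 0 \<omega> i)" if t: "0 \<le> t" for t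
  proof -
    have [measurable]: "Y 0 \<in> measurable M (states N)" "Y t \<in> measurable M (states N)"
      using t by (auto intro: Y_measurable)
    let ?g = "\<lambda>\<omega>. (?f (Y t \<omega>) - ?f (Y 0 \<omega>))\<^sup>2"
    have int: "integrable M ?g"
    proof (rule integrable_bdd[where b="4\<^sup>2"])
      show "\<bar>?g \<omega>\<bar> \<le> 4\<^sup>2" for \<omega>
        unfolding abs_power2 using bd[of "Y t \<omega>"] bd[of "Y 0 \<omega>"]
        by (intro power2_le_iff_abs_le[THEN iffD2]) (simp, linarith)
    qed measurable
    have top: "space M \<in> sets (\<F> 0)" using sets.top[of "\<F> 0"] unfolding space_\<F> .
    have "(LINT \<omega>|M. ?g \<omega>) = (LINT \<omega>|M. indicator (space M) \<omega> * (?f (Y (0 + t) \<omega>) - ?f (Y 0 \<omega>))\<^sup>2)"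
      by (rule Bochner_Integration.integral_cong) auto
    also have "\<dots> \<le> t * (0 + 2 * 2 * 0) * prob (space M)"
      by (rule weighted_square_increment[OF f bd K top _ t]) simp
    finally have "(LINT \<omega>|M. ?g \<omega>) \<le> 0" by simp
    then have "(LINT \<omega>|M. ?g \<omega>) = 0" by (intro antisym integral_nonneg_AE) auto
    then have "AE \<omega> in M. ?g \<omega> = 0"
      using integral_nonneg_eq_0_iff_AE[OF int] by simp
    then show ?thesis by eventually_elim (simp add: arctan_eq_iff)
  qed
  have "AE \<omega> in M. \<forall>q\<in>\<rat> \<inter> {0..}. (\<Sum>i<N. Y q \<omega> i) = (\<Sum>i<N. Y 0 \<omega> i)"
    unfolding AE_ball_countable[OF countable_Int1[OF countable_rat]]
    using fixed_time by simp
  then show ?thesis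
  proof (rule AE_mp, intro AE_I2 impI allI)
    fix \<omega> and t :: real assume \<omega>: "\<omega> \<in> space M" and t: "0 \<le> t"
      and rat: "\<forall>q\<in>\<rat> \<inter> {0..}. (\<Sum>i<N. Y q \<omega> i) = (\<Sum>i<N. Y 0 \<omega> i)"
    obtain q where "q \<in> \<rat>" "t < q" "Y q \<omega> = Y t \<omega>"
      using right_constant[OF \<omega> t, of "t + 1"] by auto
    then show "(\<Sum>i<N. Y t \<omega> i) = (\<Sum>i<N. Y 0 \<omega> i)" using rat[rule_format, of q] t by simp
  qed
qed

context bounded_jump_process
begin

text \<open>All terms of the exponential series but the first have mean 0 under the initial law.\<close>

lemma stationary_expectation:
  assumes inv: "\<And>G B. G \<in> borel_measurable S \<Longrightarrow> (\<And>x. x \<in> space S \<Longrightarrow> \<bar>G x\<bar> \<le> B) \<Longrightarrow>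
      (LINT \<omega>|M. A G (Y 0 \<omega>)) = 0"
    and F: "F \<in> borel_measurable S" "\<And>x. x \<in> space S \<Longrightarrow> \<bar>F x :: real\<bar> \<le> B" and t: "0 \<le> t"
  shows "(LINT \<omega>|M. F (Y t \<omega>)) = (LINT \<omega>|M. F (Y 0 \<omega>))"
proof -
  note Y_measurable[OF order_refl, measurable]
  have m[measurable]: "(A ^^ n) F \<in> borel_measurable S" for n
    using generator_power[OF F] by blast
  have bd: "\<bar>(A ^^ n) F x\<bar> \<le> c ^ n * B" if "x \<in> space S" for n x
    using generator_power[OF F] that by blast
  let ?s = "\<lambda>n \<omega>. t ^ n / fact n * (A ^^ n) F (Y 0 \<omega>)"
  have s_bd: "norm (?s n \<omega>) \<le> B * ((t * c) ^ n /\<^sub>R fact n)" if "\<omega> \<in> space M" for n \<omega>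
    using mult_left_mono[OF bd[OF Y_space[OF order_refl that], of n], of "t ^ n / fact n"] t
    by (simp add: abs_mult power_mult_distrib divide_simps mult_ac)
  have exps: "summable (\<lambda>n. B * ((t * c) ^ n /\<^sub>R fact n))"
    by (intro summable_mult summable_exp_generic)
  have int: "integrable M (?s n)" for n
    by (rule integrable_bdd[of _ "B * ((t * c) ^ n /\<^sub>R fact n)"]) (use s_bd in auto)
  have "(LINT \<omega>|M. F (Y t \<omega>)) = (LINT \<omega>|M. (\<Sum>n. ?s n \<omega>))"
    using weighted_transition[OF F, of "\<lambda>_. 1" 0 1 t] t by (simp add: generated_semigroup_def)
  also have "\<dots> = (\<Sum>n. LINT \<omega>|M. ?s n \<omega>)"
  proof (rule integral_suminf[OF int])
    show "AE \<omega> in M. summable (\<lambda>n. norm (?s n \<omega>))"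
      by (rule AE_I2, rule summable_comparison_test'[OF exps]) (use s_bd in simp)
    show "summable (\<lambda>n. LINT \<omega>|M. norm (?s n \<omega>))"
    proof (rule summable_comparison_test'[OF exps])
      fix n
      have "(LINT \<omega>|M. norm (?s n \<omega>)) \<le> (LINT \<omega>|M. B * ((t * c) ^ n /\<^sub>R fact n))"
        by (rule integral_mono[OF integrable_norm[OF int]]) (use s_bd in auto)
      then show "norm (LINT \<omega>|M. norm (?s n \<omega>)) \<le> B * ((t * c) ^ n /\<^sub>R fact n)"
        by (simp add: prob_space)
    qed
  qed
  also have "\<dots> = (\<Sum>n. if n = 0 then LINT \<omega>|M. F (Y 0 \<omega>) else 0)"
  proof (rule arg_cong[where f=suminf], rule ext)
    fix n show "(LINT \<omega>|M. ?s n \<omega>) = (if n = 0 then LINT \<omega>|M. F (Y 0 \<omega>) else 0)"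
    proof (cases n)
      case (Suc k)
      have "(LINT \<omega>|M. A ((A ^^ k) F) (Y 0 \<omega>)) = 0" by (rule inv[OF m bd])
      then show ?thesis using Suc by simp
    qed simp
  qed
  also have "\<dots> = (LINT \<omega>|M. F (Y 0 \<omega>))"
    by (subst suminf_finite[of "{0}"]) auto
  finally show ?thesis .
qed

end

text \<open>Invariance of \<open>\<mu> \<otimes> \<mu>\<close> under one collision, in terms of nonnegative functions, for which Fubini's theorem holds
  without integrability conditions.\<close>

definition exchange_invariant :: "real measure \<Rightarrow> bool" where
  "exchange_invariant \<mu> \<longleftrightarrow> \<mu> \<in> prob_measures \<and>
    (\<forall>H\<in>borel_measurable (Rplus \<Otimes>\<^sub>M Rplus).
      (\<integral>\<^sup>+x. \<integral>\<^sup>+y. \<integral>\<^sup>+r. H (r * (x + y), (1 - r) * (x + y)) \<partial>unit_interval \<partial>\<mu> \<partial>\<mu>)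
        = (\<integral>\<^sup>+x. \<integral>\<^sup>+y. H (x, y) \<partial>\<mu> \<partial>\<mu>))"

text \<open>By Fubini's theorem, integrate first over the coordinates \<open>i\<close> and \<open>j\<close>, the others being fixed.\<close>

lemma product_exchange_invariant:
  assumes inv: "exchange_invariant \<mu>" and ij: "i < N" "j < N" "i \<noteq> j"
    and G: "G \<in> borel_measurable (states N)"
  shows "(\<integral>\<^sup>+x. \<integral>\<^sup>+r. G (exchange i j r x) \<partial>unit_interval \<partial>PiM {..<N} (\<lambda>_. \<mu>))
    = (\<integral>\<^sup>+x. G x \<partial>PiM {..<N} (\<lambda>_. \<mu>))"
proof -
  have \<mu>: "\<mu> \<in> prob_measures" using inv by (simp add: exchange_invariant_def)
  interpret \<mu>: prob_space \<mu> by (rule prob_measures_D[OF \<mu>])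
  interpret U: prob_space unit_interval by (rule prob_space_unit_interval)
  interpret P: product_sigma_finite "\<lambda>_ :: nat. \<mu>" ..
  have [measurable_cong]: "sets \<mu> = sets Rplus" by (rule prob_measures_D[OF \<mu>])
  have sP: "sets (PiM I (\<lambda>_. \<mu>)) = sets (PiM I (\<lambda>_. Rplus))" for I :: "nat set"
    by (intro sets_PiM_cong refl prob_measures_D[OF \<mu>])
  define J where "J = {..<N} - {i, j}"
  have I: "{..<N} = insert j (insert i J)" using ij by (auto simp: J_def)
  have J: "finite J" "i \<notin> J" "j \<notin> insert i J" "finite (insert i J)" using ij by (auto simp: J_def)
  have split: "(\<integral>\<^sup>+x. F x \<partial>PiM {..<N} (\<lambda>_. \<mu>)) = (\<integral>\<^sup>+z. \<integral>\<^sup>+u. \<integral>\<^sup>+v. F (z(i := u, j := v)) \<partial>\<mu> \<partial>\<mu> \<partial>PiM J (\<lambda>_. \<mu>))"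
    if F[measurable]: "F \<in> borel_measurable (states N)" for F :: "(nat \<Rightarrow> real) \<Rightarrow> ennreal"
  proof -
    have F': "F \<in> borel_measurable (PiM (insert j (insert i J)) (\<lambda>_. \<mu>))"
      using F measurable_cong_sets[OF sP refl] unfolding I by blast
    have m2: "(\<lambda>y. \<integral>\<^sup>+v. F (y(j := v)) \<partial>\<mu>) \<in> borel_measurable (PiM (insert i J) (\<lambda>_. \<mu>))"
    proof (rule \<mu>.borel_measurable_nn_integral)
      have "(\<lambda>p. (fst p)(j := snd p)) \<in> measurable (PiM (insert i J) (\<lambda>_. \<mu>) \<Otimes>\<^sub>M \<mu>) (PiM (insert j (insert i J)) (\<lambda>_. \<mu>))"
        by (rule measurable_fun_upd[where J="insert i J"]) auto
      from measurable_compose[OF this F']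
      show "(\<lambda>(y, v). F (y(j := v))) \<in> borel_measurable (PiM (insert i J) (\<lambda>_. \<mu>) \<Otimes>\<^sub>M \<mu>)"
        by (simp add: case_prod_beta)
    qed
    show ?thesis
      unfolding I P.product_nn_integral_insert[OF J(4,3) F'] P.product_nn_integral_insert[OF J(1,2) m2] ..
  qed
  have mE: "(\<lambda>x. \<integral>\<^sup>+r. G (exchange i j r x) \<partial>unit_interval) \<in> borel_measurable (states N)"
  proof (rule U.borel_measurable_nn_integral)
    have "(\<lambda>(x, r). exchange i j r x) \<in> measurable (states N \<Otimes>\<^sub>M unit_interval) (states N)"
      using measurable_compose[OF measurable_pair_swap' exchange_measurable[OF ij(1,2)]]
      by (simp add: case_prod_beta)
    from measurable_compose[OF this G]
    show "(\<lambda>(x, r). G (exchange i j r x)) \<in> borel_measurable (states N \<Otimes>\<^sub>M unit_interval)"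
      by (simp add: case_prod_beta)
  qed
  show ?thesis unfolding split[OF mE] split[OF G]
  proof (rule nn_integral_cong)
    fix z assume z: "z \<in> space (PiM J (\<lambda>_. \<mu>))"
    let ?H = "\<lambda>p. G (z(i := fst p, j := snd p))"
    have z': "z \<in> space (PiM J (\<lambda>_. Rplus))" using z sets_eq_imp_space_eq[OF sP] by blast
    have H: "?H \<in> borel_measurable (Rplus \<Otimes>\<^sub>M Rplus)"
    proof -
      have 1: "(\<lambda>p. z(i := fst p)) \<in> measurable (Rplus \<Otimes>\<^sub>M Rplus) (PiM (insert i J) (\<lambda>_. Rplus))"
        using z' by (intro measurable_fun_upd[where J=J]) auto
      have 2: "(\<lambda>p. z(i := fst p, j := snd p)) \<in> measurable (Rplus \<Otimes>\<^sub>M Rplus) (states N)"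
        unfolding I by (rule measurable_fun_upd[OF _ 1]) auto
      show ?thesis using measurable_compose[OF 2 G] .
    qed
    have "exchange i j r (z(i := u, j := v)) = z(i := r * (u + v), j := (1 - r) * (u + v))" for r u v
      using ij by (auto simp: exchange_def fun_eq_iff)
    then show "(\<integral>\<^sup>+u. \<integral>\<^sup>+v. \<integral>\<^sup>+r. G (exchange i j r (z(i := u, j := v))) \<partial>unit_interval \<partial>\<mu> \<partial>\<mu>)
        = (\<integral>\<^sup>+u. \<integral>\<^sup>+v. G (z(i := u, j := v)) \<partial>\<mu> \<partial>\<mu>)"
      using inv[unfolded exchange_invariant_def, THEN conjunct2, rule_format, OF H] by simp
  qed
qed

section \<open>Invariance of the exponential law\<close>

text \<open>The hypothesis \<open>inv\<close> says that \<open>T\<close> maps \<open>L \<Otimes>\<^sub>M U\<close> to \<open>L\<close>, as \<open>fst\<close> does.  So \<open>F \<circ> T\<close> and \<open>F \<circ> fst\<close> have the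
  same mean, and the two iterated integrals of their difference agree by Fubini's theorem.\<close>

lemma invariant_increment:
  fixes F :: "'s \<Rightarrow> real"
  assumes L: "prob_space L" and U: "prob_space U" and T: "T \<in> measurable (L \<Otimes>\<^sub>M U) L"
    and inv: "\<And>G. G \<in> borel_measurable L \<Longrightarrow> (\<integral>\<^sup>+x. \<integral>\<^sup>+r. G (T (x, r)) \<partial>U \<partial>L) = (\<integral>\<^sup>+x. G x \<partial>L)"
    and F: "F \<in> borel_measurable L" and B: "\<And>x. x \<in> space L \<Longrightarrow> \<bar>F x\<bar> \<le> B"
  shows "integrable L (\<lambda>x. LINT r|U. F (T (x, r)) - F x)"
    and "(LINT x|L. LINT r|U. F (T (x, r)) - F x) = 0"
    and "(LINT r|U. LINT x|L. F (T (x, r)) - F x) = 0"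
proof -
  interpret L: prob_space L by fact
  interpret U: prob_space U by fact
  interpret LU: pair_prob_space L U ..
  have image: "distr (L \<Otimes>\<^sub>M U) L T = L"
  proof (rule measure_eqI)
    fix A assume "A \<in> sets (distr (L \<Otimes>\<^sub>M U) L T)"
    then have A: "A \<in> sets L" by simp
    then have A': "(\<lambda>x. indicator A x :: ennreal) \<in> borel_measurable L" by simp
    have "emeasure (distr (L \<Otimes>\<^sub>M U) L T) A = (\<integral>\<^sup>+x. indicator A x \<partial>distr (L \<Otimes>\<^sub>M U) L T)"
      using A by simp
    also have "\<dots> = (\<integral>\<^sup>+p. indicator A (T p) \<partial>(L \<Otimes>\<^sub>M U))"
      by (rule nn_integral_distr[OF T]) (use A in simp)
    also have "\<dots> = (\<integral>\<^sup>+x. \<integral>\<^sup>+r. indicator A (T (x, r)) \<partial>U \<partial>L)"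
      by (rule U.nn_integral_fst[symmetric, OF measurable_compose[OF T A']])
    also have "\<dots> = emeasure L A" using inv[OF A'] A by simp
    finally show "emeasure (distr (L \<Otimes>\<^sub>M U) L T) A = emeasure L A" .
  qed simp
  have bounded: "integrable (L \<Otimes>\<^sub>M U) (\<lambda>p. F (S p))" if S: "S \<in> measurable (L \<Otimes>\<^sub>M U) L" for S
  proof (rule LU.integrable_const_bound[of _ B])
    show "AE p in L \<Otimes>\<^sub>M U. norm (F (S p)) \<le> B"
      using B[OF measurable_space[OF S]] by (intro AE_I2) simp
  qed (rule measurable_compose[OF S F])
  have mean_T: "(LINT p|(L \<Otimes>\<^sub>M U). F (T p)) = (LINT x|L. F x)"
    using integral_distr[OF T F] unfolding image by simp
  have mean_fst: "(LINT p|(L \<Otimes>\<^sub>M U). F (fst p)) = (LINT x|L. F x)"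
    using integral_distr[OF measurable_fst[of L U] F] unfolding U.distr_pair_fst by simp
  have int: "integrable (L \<Otimes>\<^sub>M U) (\<lambda>(x, r). F (T (x, r)) - F x)"
    using Bochner_Integration.integrable_diff[OF bounded[OF T] bounded[OF measurable_fst]]
    by (simp add: case_prod_beta')
  have "(LINT p|(L \<Otimes>\<^sub>M U). F (T p) - F (fst p)) = 0"
    using Bochner_Integration.integral_diff[OF bounded[OF T] bounded[OF measurable_fst]] mean_T mean_fst by simp
  then have zero: "(LINT p|(L \<Otimes>\<^sub>M U). (\<lambda>(x, r). F (T (x, r)) - F x) p) = 0"
    by (simp add: case_prod_beta)
  show "integrable L (\<lambda>x. LINT r|U. F (T (x, r)) - F x)" using LU.integrable_fst'[OF int] by simp
  show "(LINT x|L. LINT r|U. F (T (x, r)) - F x) = 0" using LU.integral_fst[OF int] zero by simp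
  show "(LINT r|U. LINT x|L. F (T (x, r)) - F x) = 0" using LU.integral_snd[OF int] zero by simp
qed

definition exponential_law :: "real \<Rightarrow> real measure" where
  "exponential_law m = density (restrict_space lborel {0..}) (\<lambda>x. ennreal (1 / m * exp (- x / m)))"

lemma sets_exponential_law: "sets (exponential_law m) = sets Rplus"
  unfolding exponential_law_def Rplus_def sets_density by (rule sets_restrict_space_cong) simp

lemma clamp_measurable: "(\<lambda>x :: real. max 0 x) \<in> measurable borel Rplus"
  by (rule measurable_into_Rplus) auto

lemma exponential_nn_integral:
  assumes m: "0 < m" and f: "f \<in> borel_measurable Rplus"
  shows "(\<integral>\<^sup>+x. f x \<partial>exponential_law m)
    = (\<integral>\<^sup>+x. ennreal (exponential_density (1 / m) x) * f (max 0 x) \<partial>lborel)"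
proof -
  have f': "f \<in> borel_measurable (restrict_space lborel {0..})"
    using f measurable_cong_sets[OF sets_restrict_space_cong[of lborel borel "{0..}"] refl]
    by (auto simp: Rplus_def)
  have "(\<integral>\<^sup>+x. f x \<partial>exponential_law m)
      = (\<integral>\<^sup>+x. ennreal (1 / m * exp (- x / m)) * f x \<partial>restrict_space lborel {0..})"
    unfolding exponential_law_def
    by (rule nn_integral_density[OF _ f']) (auto intro!: measurable_restrict_space1)
  also have "\<dots> = (\<integral>\<^sup>+x. ennreal (1 / m * exp (- x / m)) * f x * indicator {0..} x \<partial>lborel)"
    by (rule nn_integral_restrict_space) simp
  also have "\<dots> = (\<integral>\<^sup>+x. ennreal (exponential_density (1 / m) x) * f (max 0 x) \<partial>lborel)"
    by (rule nn_integral_cong) (auto simp: exponential_density_def indicator_def max_def)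
  finally show ?thesis .
qed

lemma exponential_law_prob: "0 < m \<Longrightarrow> exponential_law m \<in> prob_measures"
proof -
  assume m: "0 < m"
  interpret E: prob_space "density lborel (exponential_density (1 / m))"
    using m by (intro prob_space_exponential_density) simp
  have "emeasure (exponential_law m) (space (exponential_law m)) = (\<integral>\<^sup>+x. 1 \<partial>exponential_law m)" by simp
  also have "\<dots> = (\<integral>\<^sup>+x. ennreal (exponential_density (1 / m) x) * 1 \<partial>lborel)"
    by (rule exponential_nn_integral[OF m]) simp
  also have "\<dots> = 1" using E.emeasure_space_1 by (simp add: emeasure_density)
  finally show ?thesis
    unfolding prob_measures_def using sets_exponential_law by (auto intro: prob_spaceI)
qed

lemma nn_integral_shear:
  fixes f :: "real \<Rightarrow> real \<Rightarrow> ennreal"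
  assumes [measurable]: "(\<lambda>(x, s). f x s) \<in> borel_measurable (borel \<Otimes>\<^sub>M borel)"
  shows "(\<integral>\<^sup>+x. \<integral>\<^sup>+y. f x (x + y) \<partial>lborel \<partial>lborel) = (\<integral>\<^sup>+s. \<integral>\<^sup>+x. f x s \<partial>lborel \<partial>lborel)"
proof -
  have "(\<integral>\<^sup>+y. f x (x + y) \<partial>lborel) = (\<integral>\<^sup>+s. f x s \<partial>lborel)" for x
    using nn_integral_real_affine[of "f x" 1 x] by simp
  then have "(\<integral>\<^sup>+x. \<integral>\<^sup>+y. f x (x + y) \<partial>lborel \<partial>lborel) = (\<integral>\<^sup>+x. \<integral>\<^sup>+s. f x s \<partial>lborel \<partial>lborel)" by simp
  also have "\<dots> = (\<integral>\<^sup>+s. \<integral>\<^sup>+x. f x s \<partial>lborel \<partial>lborel)"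
    by (rule lborel_pair.Fubini'[symmetric]) simp
  finally show ?thesis .
qed

text \<open>The joint density of \<open>x\<close> and \<open>y\<close> is \<open>exp (- s / m) / m\<^sup>2\<close>, a function of \<open>s = x + y\<close>.  In the coordinates
  \<open>(x, s)\<close> the variable \<open>x\<close> is uniform on \<open>[0, s]\<close>, and so is \<open>r s\<close> for uniform \<open>r\<close>.\<close>

lemma exponential_exchange_invariant:
  assumes m: "0 < m"
  shows "exchange_invariant (exponential_law m)"
  unfolding exchange_invariant_def
proof (intro conjI ballI)
  fix H :: "real \<times> real \<Rightarrow> ennreal" assume H: "H \<in> borel_measurable (Rplus \<Otimes>\<^sub>M Rplus)"
  let ?\<mu> = "exponential_law m"
  interpret \<mu>: prob_space ?\<mu> by (rule prob_measures_D[OF exponential_law_prob[OF m]])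
  interpret U: prob_space unit_interval by (rule prob_space_unit_interval)
  note [measurable_cong] = sets_exponential_law
  \<comment> \<open>extend \<open>H\<close> to the plane, where Lebesgue measure can be transformed\<close>
  define K where "K p = H (max 0 (fst p), max 0 (snd p))" for p
  have K[measurable]: "K \<in> borel_measurable (borel \<Otimes>\<^sub>M borel)"
  proof -
    have "(\<lambda>p. (max 0 (fst p), max 0 (snd p))) \<in> measurable (borel \<Otimes>\<^sub>M borel) (Rplus \<Otimes>\<^sub>M Rplus)"
      by (intro measurable_Pair measurable_compose[OF _ clamp_measurable]) auto
    from measurable_compose[OF this H] show ?thesis by (simp add: K_def[abs_def])
  qed
  have KH: "K (x, y) = H (x, y)" if "0 \<le> x" "0 \<le> y" for x y using that by (simp add: K_def max_def)
  let ?e = "\<lambda>x. ennreal (exponential_density (1 / m) x)"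
  define k where "k s = ennreal (1 / m * (1 / m) * exp (- s / m))" for s
  have [measurable]: "k \<in> borel_measurable borel" unfolding k_def[abs_def] by measurable
  define \<Phi> where "\<Phi> s = (\<integral>\<^sup>+r. K (r * s, (1 - r) * s) \<partial>unit_interval)" for s
  have \<Phi>': "\<Phi> s = (\<integral>\<^sup>+r. K (r * s, (1 - r) * s) * indicator {0..1} r \<partial>lborel)" for s
    unfolding \<Phi>_def unit_interval_def by (rule nn_integral_restrict_space) simp
  have \<Phi>_measurable[measurable]: "\<Phi> \<in> borel_measurable borel" unfolding \<Phi>'[abs_def] by measurable
  have triangle: "(\<lambda>p. k (snd p) * indicator {0..snd p} (fst p)) \<in> borel_measurable (borel \<Otimes>\<^sub>M borel)"
    unfolding indicator_def atLeastAtMost_iff by measurable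
  have ee: "?e x * ?e y = k (x + y) * indicator {0..x + y} x" for x y
  proof (cases "0 \<le> x \<and> 0 \<le> y")
    case True
    have "exp (- x / m) * exp (- y / m) = exp (- (x + y) / m)"
      by (simp add: mult_exp_exp add_divide_distrib diff_divide_distrib)
    then show ?thesis using True m
      by (auto simp: exponential_density_def k_def ennreal_mult[symmetric] field_simps)
  qed (auto simp: exponential_density_def indicator_def)
  \<comment> \<open>both sides equal the integral of \<open>k s\<close> times the integral of \<open>K\<close> over the segment \<open>u + v = s\<close>\<close>
  let ?seg = "\<lambda>s. \<integral>\<^sup>+u. K (u, s - u) * indicator {0..s} u \<partial>lborel"
  have seg: "ennreal s * \<Phi> s = ?seg s" if s: "0 < s" for s
  proof -
    have "?seg s = ennreal \<bar>s\<bar> * (\<integral>\<^sup>+r. K (0 + s * r, s - (0 + s * r)) * indicator {0..s} (0 + s * r) \<partial>lborel)"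
      using s by (intro nn_integral_real_affine) auto
    also have "(\<integral>\<^sup>+r. K (0 + s * r, s - (0 + s * r)) * indicator {0..s} (0 + s * r) \<partial>lborel) = \<Phi> s"
      unfolding \<Phi>' using s
      by (intro nn_integral_cong) (auto simp: indicator_def algebra_simps zero_le_mult_iff mult_le_cancel_left1)
    finally show ?thesis using s by simp
  qed
  have "(\<integral>\<^sup>+x. \<integral>\<^sup>+y. \<integral>\<^sup>+r. H (r * (x + y), (1 - r) * (x + y)) \<partial>unit_interval \<partial>?\<mu> \<partial>?\<mu>)
      = (\<integral>\<^sup>+x. \<integral>\<^sup>+y. \<Phi> (x + y) \<partial>?\<mu> \<partial>?\<mu>)"
  proof (intro nn_integral_cong)
    fix x y assume "x \<in> space ?\<mu>" "y \<in> space ?\<mu>"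
    then have "0 \<le> x + y" using sets_eq_imp_space_eq[OF sets_exponential_law, of m] by simp
    then show "(\<integral>\<^sup>+r. H (r * (x + y), (1 - r) * (x + y)) \<partial>unit_interval) = \<Phi> (x + y)"
      unfolding \<Phi>_def by (intro nn_integral_cong KH[symmetric] mult_nonneg_nonneg) auto
  qed
  also have "\<dots> = (\<integral>\<^sup>+x. \<integral>\<^sup>+y. ?e y * \<Phi> (x + max 0 y) \<partial>lborel \<partial>?\<mu>)"
  proof (intro nn_integral_cong exponential_nn_integral[OF m])
    show "(\<lambda>y. \<Phi> (x + y)) \<in> borel_measurable Rplus" for x
      by (rule measurable_compose[OF measurable_Rplus_id]) simp
  qed
  also have "\<dots> = (\<integral>\<^sup>+x. ?e x * (\<integral>\<^sup>+y. ?e y * \<Phi> (max 0 x + max 0 y) \<partial>lborel) \<partial>lborel)"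
    by (intro exponential_nn_integral[OF m] measurable_compose[OF measurable_Rplus_id]) measurable
  also have "\<dots> = (\<integral>\<^sup>+x. \<integral>\<^sup>+y. k (x + y) * indicator {0..x + y} x * \<Phi> (x + y) \<partial>lborel \<partial>lborel)"
  proof (intro nn_integral_cong)
    fix x :: real
    have "?e x * (\<integral>\<^sup>+y. ?e y * \<Phi> (max 0 x + max 0 y) \<partial>lborel)
        = (\<integral>\<^sup>+y. ?e x * (?e y * \<Phi> (max 0 x + max 0 y)) \<partial>lborel)"
      by (rule nn_integral_cmult[symmetric])
        (auto intro!: borel_measurable_times_ennreal measurable_compose[OF _ \<Phi>_measurable])
    also have "\<dots> = (\<integral>\<^sup>+y. k (x + y) * indicator {0..x + y} x * \<Phi> (x + y) \<partial>lborel)"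
      by (intro nn_integral_cong)
        (auto simp: ee[symmetric] mult.assoc exponential_density_def max_def)
    finally show "?e x * (\<integral>\<^sup>+y. ?e y * \<Phi> (max 0 x + max 0 y) \<partial>lborel) = \<dots>" .
  qed
  also have "\<dots> = (\<integral>\<^sup>+s. \<integral>\<^sup>+x. k s * indicator {0..s} x * \<Phi> s \<partial>lborel \<partial>lborel)"
    using borel_measurable_times_ennreal[OF triangle measurable_compose[OF measurable_snd \<Phi>_measurable]]
    by (intro nn_integral_shear) (simp add: case_prod_beta)
  also have "\<dots> = (\<integral>\<^sup>+s. \<integral>\<^sup>+u. k s * indicator {0..s} u * K (u, s - u) \<partial>lborel \<partial>lborel)"
  proof (intro nn_integral_cong_AE)
    have "AE s in lborel. (s::real) \<noteq> 0" by (rule AE_lborel_singleton)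
    then show "AE s in lborel. (\<integral>\<^sup>+x. k s * indicator {0..s} x * \<Phi> s \<partial>lborel)
        = (\<integral>\<^sup>+u. k s * indicator {0..s} u * K (u, s - u) \<partial>lborel)"
    proof eventually_elim
      fix s :: real assume "s \<noteq> 0"
      show "(\<integral>\<^sup>+x. k s * indicator {0..s} x * \<Phi> s \<partial>lborel)
        = (\<integral>\<^sup>+u. k s * indicator {0..s} u * K (u, s - u) \<partial>lborel)"
      proof (cases "0 < s")
        case True
        have "(\<integral>\<^sup>+x. k s * indicator {0..s} x * \<Phi> s \<partial>lborel) = (\<integral>\<^sup>+x. (k s * \<Phi> s) * indicator {0..s} x \<partial>lborel)"
          by (simp add: mult_ac)
        also have "\<dots> = k s * (ennreal s * \<Phi> s)"
          using True by (subst nn_integral_cmult_indicator) (auto simp: mult_ac)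
        also have "\<dots> = (\<integral>\<^sup>+u. k s * (K (u, s - u) * indicator {0..s} u) \<partial>lborel)"
          unfolding seg[OF True] by (rule nn_integral_cmult[symmetric]) measurable
        finally show ?thesis by (simp add: mult_ac)
      qed (use \<open>s \<noteq> 0\<close> in simp)
    qed
  qed
  also have "\<dots> = (\<integral>\<^sup>+u. \<integral>\<^sup>+v. k (u + v) * indicator {0..u + v} u * K (u, u + v - u) \<partial>lborel \<partial>lborel)"
  proof (rule nn_integral_shear[symmetric])
    have "(\<lambda>p. K (fst p, snd p - fst p)) \<in> borel_measurable (borel \<Otimes>\<^sub>M borel)" by measurable
    from borel_measurable_times_ennreal[OF triangle this]
    show "(\<lambda>(u, s). k s * indicator {0..s} u * K (u, s - u)) \<in> borel_measurable (borel \<Otimes>\<^sub>M borel)"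
      by (simp add: case_prod_beta)
  qed
  also have "\<dots> = (\<integral>\<^sup>+u. ?e u * (\<integral>\<^sup>+v. ?e v * K (max 0 u, max 0 v) \<partial>lborel) \<partial>lborel)"
  proof (intro nn_integral_cong)
    fix u :: real
    have "?e u * (\<integral>\<^sup>+v. ?e v * K (max 0 u, max 0 v) \<partial>lborel)
        = (\<integral>\<^sup>+v. ?e u * (?e v * K (max 0 u, max 0 v)) \<partial>lborel)"
      by (rule nn_integral_cmult[symmetric]) measurable
    also have "\<dots> = (\<integral>\<^sup>+v. k (u + v) * indicator {0..u + v} u * K (u, u + v - u) \<partial>lborel)"
      by (intro nn_integral_cong)
        (auto simp: ee[symmetric] mult.assoc exponential_density_def max_def)
    finally show "(\<integral>\<^sup>+v. k (u + v) * indicator {0..u + v} u * K (u, u + v - u) \<partial>lborel)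
      = ?e u * (\<integral>\<^sup>+v. ?e v * K (max 0 u, max 0 v) \<partial>lborel)" by simp
  qed
  also have "\<dots> = (\<integral>\<^sup>+u. \<integral>\<^sup>+v. ?e v * K (u, max 0 v) \<partial>lborel \<partial>?\<mu>)"
    by (intro exponential_nn_integral[OF m, symmetric] measurable_compose[OF measurable_Rplus_id]) measurable
  also have "\<dots> = (\<integral>\<^sup>+u. \<integral>\<^sup>+v. K (u, v) \<partial>?\<mu> \<partial>?\<mu>)"
  proof (intro nn_integral_cong exponential_nn_integral[OF m, symmetric])
    show "(\<lambda>v. K (u, v)) \<in> borel_measurable Rplus" for u
      by (rule measurable_compose[OF measurable_Rplus_id]) measurable
  qed
  also have "\<dots> = (\<integral>\<^sup>+x. \<integral>\<^sup>+y. H (x, y) \<partial>?\<mu> \<partial>?\<mu>)"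
    by (intro nn_integral_cong) (auto simp: KH sets_eq_imp_space_eq[OF sets_exponential_law])
  finally show "(\<integral>\<^sup>+x. \<integral>\<^sup>+y. \<integral>\<^sup>+r. H (r * (x + y), (1 - r) * (x + y)) \<partial>unit_interval \<partial>?\<mu> \<partial>?\<mu>)
      = (\<integral>\<^sup>+x. \<integral>\<^sup>+y. H (x, y) \<partial>?\<mu> \<partial>?\<mu>)" .
qed (rule exponential_law_prob[OF m])


text \<open>Integrating the random fraction out first turns the collision operator into a double integral of
  a fixed kernel.\<close>

definition collision_kernel :: "(real \<Rightarrow> real) \<Rightarrow> real \<times> real \<Rightarrow> real" where
  "collision_kernel g p = (LINT r|unit_interval. collision_gain g r p)"

lemma collision_gain_bound:
  assumes B: "\<And>x. 0 \<le> x \<Longrightarrow> \<bar>g x\<bar> \<le> B" and "r \<in> {0..1}" "p \<in> {0..} \<times> {0..}"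
  shows "\<bar>collision_gain g r p\<bar> \<le> 4 * B"
proof -
  obtain x y where p: "p = (x, y)" "0 \<le> x" "0 \<le> y" using assms(3) by auto
  show ?thesis
    using B[of x] B[of y] B[of "r * (x + y)"] B[of "(1 - r) * (x + y)"] p assms(2)
    by (simp add: collision_gain_def)
qed

lemma collision_map_measurable:
  "(\<lambda>(p, r). (r * (fst p + snd p), (1 - r) * (fst p + snd p)))
    \<in> measurable ((Rplus \<Otimes>\<^sub>M Rplus) \<Otimes>\<^sub>M unit_interval) (Rplus \<Otimes>\<^sub>M Rplus)"
proof -
  let ?P = "(Rplus \<Otimes>\<^sub>M Rplus) \<Otimes>\<^sub>M unit_interval"
  have [measurable]: "snd \<in> borel_measurable ?P"
    by (rule measurable_compose[OF measurable_snd measurable_unit_interval_id])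
  have "(\<lambda>p. fst (fst p)) \<in> measurable ?P Rplus" "(\<lambda>p. snd (fst p)) \<in> measurable ?P Rplus" by auto
  from this[THEN measurable_compose, OF measurable_Rplus_id]
  have [measurable]: "(\<lambda>p. fst (fst p)) \<in> borel_measurable ?P" "(\<lambda>p. snd (fst p)) \<in> borel_measurable ?P" .
  have "(\<lambda>p. snd p * (fst (fst p) + snd (fst p))) \<in> measurable ?P Rplus"
    "(\<lambda>p. (1 - snd p) * (fst (fst p) + snd (fst p))) \<in> measurable ?P Rplus"
    by (rule measurable_into_Rplus; auto simp: space_pair_measure)+
  then show ?thesis unfolding case_prod_beta by (rule measurable_Pair)
qed

lemma collision_gain_measurable:
  assumes g: "g \<in> borel_measurable Rplus"
  shows "(\<lambda>(p, r). collision_gain g r p) \<in> borel_measurable ((Rplus \<Otimes>\<^sub>M Rplus) \<Otimes>\<^sub>M unit_interval)"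
proof -
  let ?P = "(Rplus \<Otimes>\<^sub>M Rplus) \<Otimes>\<^sub>M unit_interval"
  have "(\<lambda>p. fst (fst p)) \<in> measurable ?P Rplus" "(\<lambda>p. snd (fst p)) \<in> measurable ?P Rplus" by auto
  from this[THEN measurable_compose, OF g]
  have [measurable]: "(\<lambda>p. g (fst (fst p))) \<in> borel_measurable ?P" "(\<lambda>p. g (snd (fst p))) \<in> borel_measurable ?P" .
  have "(\<lambda>p. fst p) \<in> measurable (Rplus \<Otimes>\<^sub>M Rplus) Rplus" "(\<lambda>p. snd p) \<in> measurable (Rplus \<Otimes>\<^sub>M Rplus) Rplus"
    by auto
  from this[THEN measurable_compose[OF collision_map_measurable], THEN measurable_compose, OF g]
  have [measurable]: "(\<lambda>p. g (snd p * (fst (fst p) + snd (fst p)))) \<in> borel_measurable ?P"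
    "(\<lambda>p. g ((1 - snd p) * (fst (fst p) + snd (fst p)))) \<in> borel_measurable ?P"
    by (simp_all add: case_prod_beta)
  show ?thesis by (simp add: collision_gain_def case_prod_beta)
qed

lemma collision_kernel_measurable:
  "g \<in> borel_measurable Rplus \<Longrightarrow> collision_kernel g \<in> borel_measurable (Rplus \<Otimes>\<^sub>M Rplus)"
  unfolding collision_kernel_def[abs_def]
  by (intro integral_unit_interval_measurable collision_gain_measurable)

lemma collision_kernel_bound:
  "(\<And>x. 0 \<le> x \<Longrightarrow> \<bar>g x\<bar> \<le> B) \<Longrightarrow> p \<in> {0..} \<times> {0..} \<Longrightarrow> \<bar>collision_kernel g p\<bar> \<le> 4 * B"
  unfolding collision_kernel_def by (intro integral_unit_interval_bound collision_gain_bound) auto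

lemma
  assumes inv: "exchange_invariant \<mu>"
    and g: "g \<in> borel_measurable Rplus" and B: "\<And>x. 0 \<le> x \<Longrightarrow> \<bar>g x\<bar> \<le> B"
  shows collision_kernel_mean_0: "(LINT p|(\<mu> \<Otimes>\<^sub>M \<mu>). collision_kernel g p) = 0"
    and collision_invariant: "collision \<infinity> g \<mu> = 0"
proof -
  have \<mu>: "\<mu> \<in> prob_measures" using inv by (simp add: exchange_invariant_def)
  interpret \<mu>: prob_space \<mu> by (rule prob_measures_D[OF \<mu>])
  interpret U: prob_space unit_interval by (rule prob_space_unit_interval)
  interpret \<mu>\<mu>: pair_prob_space \<mu> \<mu> ..
  let ?\<mu>2 = "\<mu> \<Otimes>\<^sub>M \<mu>" and ?R2 = "Rplus \<Otimes>\<^sub>M Rplus"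
  have s2: "sets ?\<mu>2 = sets ?R2" by (intro sets_pair_measure_cong prob_measures_D[OF \<mu>])
  note R2 = measurable_cong_sets[OF s2 refl]
  let ?T = "\<lambda>(p, r). (r * (fst p + snd p), (1 - r) * (fst p + snd p) :: real)"
  have T: "?T \<in> measurable (?\<mu>2 \<Otimes>\<^sub>M unit_interval) ?\<mu>2"
    using collision_map_measurable measurable_cong_sets[OF sets_pair_measure_cong[OF s2 refl] s2] by blast
  have avg: "(\<integral>\<^sup>+p. \<integral>\<^sup>+r. G (?T (p, r)) \<partial>unit_interval \<partial>?\<mu>2) = (\<integral>\<^sup>+p. G p \<partial>?\<mu>2)"
    if G: "G \<in> borel_measurable ?\<mu>2" for G
  proof -
    have m: "(\<lambda>p. \<integral>\<^sup>+r. G (?T (p, r)) \<partial>unit_interval) \<in> borel_measurable ?\<mu>2"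
      by (rule U.borel_measurable_nn_integral) (use measurable_compose[OF T G] in \<open>simp add: case_prod_beta\<close>)
    have "(\<integral>\<^sup>+p. \<integral>\<^sup>+r. G (?T (p, r)) \<partial>unit_interval \<partial>?\<mu>2)
        = (\<integral>\<^sup>+x. \<integral>\<^sup>+y. \<integral>\<^sup>+r. G (r * (x + y), (1 - r) * (x + y)) \<partial>unit_interval \<partial>\<mu> \<partial>\<mu>)"
      using \<mu>.nn_integral_fst[OF m] by simp
    also have "\<dots> = (\<integral>\<^sup>+x. \<integral>\<^sup>+y. G (x, y) \<partial>\<mu> \<partial>\<mu>)"
      using inv G[unfolded R2] unfolding exchange_invariant_def by blast
    also have "\<dots> = (\<integral>\<^sup>+p. G p \<partial>?\<mu>2)" by (rule \<mu>.nn_integral_fst[OF G])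
    finally show ?thesis .
  qed
  define G where "G p = g (fst p) + g (snd p)" for p
  have "G \<in> borel_measurable ?R2"
    using measurable_compose[OF measurable_fst g] measurable_compose[OF measurable_snd g]
    unfolding G_def[abs_def] by measurable
  then have G: "G \<in> borel_measurable ?\<mu>2" unfolding R2 .
  have GB: "\<bar>G p\<bar> \<le> 2 * B" if "p \<in> space ?\<mu>2" for p
  proof -
    have "p \<in> {0..} \<times> {0..}" using that by (simp add: space_pair_measure prob_measures_D[OF \<mu>])
    then show ?thesis using B[of "fst p"] B[of "snd p"] by (auto simp: G_def)
  qed
  have gain: "collision_gain g r p = G (?T (p, r)) - G p" for r p
    by (simp add: collision_gain_def G_def case_prod_beta)
  note increment = invariant_increment[OF \<mu>\<mu>.prob_space_axioms prob_space_unit_interval T avg G GB]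
  show "(LINT p|?\<mu>2. collision_kernel g p) = 0"
    unfolding collision_kernel_def gain using increment(2) by simp
  show "collision \<infinity> g \<mu> = 0"
    unfolding collision_def set_integral_unit_interval gain using increment(3) by simp
qed

section \<open>Pair statistics of a stationary exchange system\<close>

text \<open>A U-statistic of order two, normalized by \<open>N\<^sup>2\<close> as the collision operator is.\<close>

definition pair_statistic :: "nat \<Rightarrow> (real \<times> real \<Rightarrow> real) \<Rightarrow> (nat \<Rightarrow> real) \<Rightarrow> real" where
  "pair_statistic N h x = 1 / N * (1 / N) * (\<Sum>(i, j)\<in>off_diagonal N. h (x i, x j))"

lemma pair_coordinates_measurable:
  assumes h: "h \<in> borel_measurable (Rplus \<Otimes>\<^sub>M Rplus)" and ij: "i \<in> I" "j \<in> I"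
  shows "(\<lambda>x. h (x i, x j)) \<in> borel_measurable (PiM I (\<lambda>_. Rplus))"
proof -
  have "(\<lambda>x. (x i, x j)) \<in> measurable (PiM I (\<lambda>_. Rplus)) (Rplus \<Otimes>\<^sub>M Rplus)"
    using ij by (intro measurable_Pair measurable_component_singleton)
  from measurable_compose[OF this h] show ?thesis .
qed

lemma pair_statistic_measurable:
  "h \<in> borel_measurable (Rplus \<Otimes>\<^sub>M Rplus) \<Longrightarrow> pair_statistic N h \<in> borel_measurable (states N)"
  unfolding pair_statistic_def[abs_def] case_prod_beta
  by (intro borel_measurable_times borel_measurable_const borel_measurable_sum pair_coordinates_measurable)
    auto

lemma sum_off_diagonal_le:
  fixes F :: "nat \<times> nat \<Rightarrow> real"
  assumes "\<And>p. p \<in> off_diagonal N \<Longrightarrow> \<bar>F p\<bar> \<le> b" "0 \<le> b"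
  shows "\<bar>\<Sum>p\<in>off_diagonal N. F p\<bar> \<le> real N * real N * b"
proof -
  have "\<bar>\<Sum>p\<in>off_diagonal N. F p\<bar> \<le> (\<Sum>p\<in>off_diagonal N. \<bar>F p\<bar>)" by (rule sum_abs)
  also have "\<dots> \<le> real (card (off_diagonal N)) * b" using assms(1) by (intro sum_bounded_above) auto
  also have "\<dots> \<le> real (N * N) * b"
    using assms(2) by (intro mult_right_mono of_nat_mono card_off_diagonal_le)
  finally show ?thesis by simp
qed

text \<open>At most \<open>4 N\<close> pairs share an index with \<open>{i, j}\<close>.  This count gives both the size \<open>O(1/N)\<close> of a jump of a pair
  statistic and the order \<open>1/N\<close> of its second moment.\<close>

lemma sum_meeting_le:
  fixes F :: "nat \<times> nat \<Rightarrow> real"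
  assumes bd: "\<And>p. p \<in> off_diagonal N \<Longrightarrow> \<bar>F p\<bar> \<le> b" and b: "0 \<le> b"
    and zero: "\<And>p. p \<in> off_diagonal N \<Longrightarrow> fst p \<notin> {i, j} \<Longrightarrow> snd p \<notin> {i, j} \<Longrightarrow> F p = 0"
  shows "\<bar>\<Sum>p\<in>off_diagonal N. F p\<bar> \<le> 4 * real N * b"
proof -
  let ?meet = "{p \<in> off_diagonal N. fst p \<in> {i, j} \<or> snd p \<in> {i, j}}"
  have "?meet \<subseteq> {i, j} \<times> {..<N} \<union> {..<N} \<times> {i, j}" by auto
  then have "card ?meet \<le> card ({i, j} \<times> {..<N} \<union> {..<N} \<times> {i, j})" by (intro card_mono) auto
  also have "\<dots> \<le> card ({i, j} \<times> {..<N}) + card ({..<N} \<times> {i, j})" by (rule card_Un_le)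
  also have "\<dots> \<le> 2 * N + 2 * N"
    unfolding card_cartesian_product by (intro add_mono) (auto simp: card_insert_if)
  finally have card: "card ?meet \<le> 4 * N" by simp
  have "(\<Sum>p\<in>off_diagonal N. F p) = (\<Sum>p\<in>?meet. F p)"
    by (rule sum.mono_neutral_right) (use zero finite_off_diagonal in auto)
  then have "\<bar>\<Sum>p\<in>off_diagonal N. F p\<bar> \<le> (\<Sum>p\<in>?meet. \<bar>F p\<bar>)" by simp
  also have "\<dots> \<le> real (card ?meet) * b" using bd by (intro sum_bounded_above) auto
  also have "\<dots> \<le> real (4 * N) * b" using card b by (intro mult_right_mono of_nat_mono)
  finally show ?thesis by simp
qed

context
  fixes h :: "real \<times> real \<Rightarrow> real" and B :: real
  assumes h_bound: "\<And>p. p \<in> {0..} \<times> {0..} \<Longrightarrow> \<bar>h p\<bar> \<le> B"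
begin

lemma h_bound_nonneg: "0 \<le> B"
  using h_bound[of "(0, 0)"] by simp

lemma pair_statistic_bound:
  assumes "x \<in> space (states N)"
  shows "\<bar>pair_statistic N h x\<bar> \<le> B"
proof (cases "N = 0")
  case False
  have "\<bar>\<Sum>p\<in>off_diagonal N. h (x (fst p), x (snd p))\<bar> \<le> real N * real N * B"
    by (rule sum_off_diagonal_le[OF _ h_bound_nonneg]) (use statesD[OF assms] in \<open>auto intro!: h_bound\<close>)
  then have "1 / N * (1 / N) * \<bar>\<Sum>p\<in>off_diagonal N. h (x (fst p), x (snd p))\<bar>
      \<le> 1 / N * (1 / N) * (real N * real N * B)"
    by (intro mult_left_mono) auto
  then show ?thesis using False by (simp add: pair_statistic_def abs_mult case_prod_beta)
qed (use h_bound_nonneg in \<open>simp add: pair_statistic_def\<close>)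

lemma pair_statistic_exchange:
  assumes x: "x \<in> space (states N)" and ij: "i < N" "j < N" "r \<in> {0..1}"
  shows "\<bar>pair_statistic N h (exchange i j r x) - pair_statistic N h x\<bar> \<le> 8 * B / N"
proof -
  let ?y = "exchange i j r x"
  let ?F = "\<lambda>p. h (?y (fst p), ?y (snd p)) - h (x (fst p), x (snd p))"
  have "\<bar>\<Sum>p\<in>off_diagonal N. ?F p\<bar> \<le> 4 * real N * (2 * B)"
  proof (rule sum_meeting_le)
    fix p assume p: "p \<in> off_diagonal N"
    then have "\<bar>h (?y (fst p), ?y (snd p))\<bar> \<le> B" "\<bar>h (x (fst p), x (snd p))\<bar> \<le> B"
      using statesD[OF x] statesD[OF exchange_states[OF x ij]] by (auto intro!: h_bound)
    then show "\<bar>?F p\<bar> \<le> 2 * B" by linarith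
    show "?F p = 0" if "fst p \<notin> {i, j}" "snd p \<notin> {i, j}" using that by (simp add: exchange_def)
  qed (use h_bound_nonneg in simp)
  then have "1 / N * (1 / N) * \<bar>\<Sum>p\<in>off_diagonal N. ?F p\<bar> \<le> 1 / N * (1 / N) * (4 * real N * (2 * B))"
    by (intro mult_left_mono) auto
  moreover have "pair_statistic N h ?y - pair_statistic N h x = 1 / N * (1 / N) * (\<Sum>p\<in>off_diagonal N. ?F p)"
    by (simp add: pair_statistic_def case_prod_beta sum_subtractf diff_divide_distrib)
  ultimately show ?thesis using ij(1) by (simp add: abs_mult)
qed

text \<open>Jumps of size \<open>O(1/N)\<close> at total rate at most \<open>N\<close>: the bounds do not depend on \<open>N\<close>.\<close>

lemma pair_statistic_generator_bound:
  assumes x: "x \<in> space (states N)"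
  shows "\<bar>exchange_generator N (pair_statistic N h) x\<bar> \<le> 8 * B"
    and "\<bar>exchange_generator N (\<lambda>x. (pair_statistic N h x)\<^sup>2) x\<bar> \<le> 16 * B\<^sup>2"
proof -
  note B = h_bound_nonneg
  have "\<bar>exchange_generator N (pair_statistic N h) x\<bar> \<le> N * (8 * B / N)"
    by (intro exchange_generator_bound pair_statistic_exchange x) (use B in auto)
  then show "\<bar>exchange_generator N (pair_statistic N h) x\<bar> \<le> 8 * B" using B by (cases "N = 0") auto
  have "\<bar>exchange_generator N (\<lambda>x. (pair_statistic N h x)\<^sup>2) x\<bar> \<le> N * (8 * B / N * (2 * B))"
  proof (intro exchange_generator_bound)
    fix i j r assume ij: "i < N" "j < N" "r \<in> {0..1::real}"
    let ?q = "pair_statistic N h"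
    have "\<bar>?q (exchange i j r x) + ?q x\<bar> \<le> 2 * B"
      using pair_statistic_bound[OF x] pair_statistic_bound[OF exchange_states[OF x ij]] by linarith
    then have "\<bar>?q (exchange i j r x) - ?q x\<bar> * \<bar>?q (exchange i j r x) + ?q x\<bar> \<le> 8 * B / N * (2 * B)"
      using B by (intro mult_mono pair_statistic_exchange x ij) auto
    then show "\<bar>(?q (exchange i j r x))\<^sup>2 - (?q x)\<^sup>2\<bar> \<le> 8 * B / N * (2 * B)"
      by (simp add: power2_eq_square square_diff_square_factored abs_mult mult.commute)
  qed (use B in auto)
  then show "\<bar>exchange_generator N (\<lambda>x. (pair_statistic N h x)\<^sup>2) x\<bar> \<le> 16 * B\<^sup>2"
    by (cases "N = 0") (auto simp: power2_eq_square)
qed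

text \<open>Expand the square into a sum over two pairs of indices.  If the pairs are disjoint, their
  contributions are independent and centred; only \<open>O(N\<^sup>3)\<close> of the \<open>N\<^sup>4\<close> terms are left.\<close>

lemma pair_statistic_second_moment:
  assumes M: "prob_space M" and h: "h \<in> borel_measurable (Rplus \<Otimes>\<^sub>M Rplus)"
    and mean: "(LINT p|(\<mu> \<Otimes>\<^sub>M \<mu>). h p) = 0" and N: "0 < N"
    and indep: "prob_space.indep_vars M (\<lambda>_. Rplus) X {..<N}"
    and law: "\<And>i. i < N \<Longrightarrow> distr M Rplus (X i) = \<mu>"
  shows "(LINT \<omega>|M. (pair_statistic N h (\<lambda>i. X i \<omega>))\<^sup>2) \<le> 4 * B\<^sup>2 / N"
proof -
  interpret prob_space M by fact
  note B = h_bound_nonneg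
  have X: "X i \<in> measurable M Rplus" if "i < N" for i
    using indep that by (auto simp: indep_vars_def)
  have X0: "0 \<le> X i \<omega>" if "i < N" "\<omega> \<in> space M" for i \<omega>
    using measurable_space[OF X[OF that(1)] that(2)] by simp
  let ?h = "\<lambda>p \<omega>. h (X (fst p) \<omega>, X (snd p) \<omega>)"
  have hm: "?h p \<in> borel_measurable M" if "p \<in> off_diagonal N" for p
    using that X by (intro measurable_compose[OF measurable_Pair h]) auto
  have hb: "\<bar>?h p \<omega>\<bar> \<le> B" if "p \<in> off_diagonal N" "\<omega> \<in> space M" for p \<omega>
    using that X0 by (intro h_bound) auto
  have hi: "integrable M (?h p)" if "p \<in> off_diagonal N" for p
    using hm[OF that] hb[OF that] by (intro integrable_const_bound[of _ B]) auto
  have hhi: "integrable M (\<lambda>\<omega>. ?h p \<omega> * ?h q \<omega>)" and hhb: "\<bar>LINT \<omega>|M. ?h p \<omega> * ?h q \<omega>\<bar> \<le> B\<^sup>2"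
    if p: "p \<in> off_diagonal N" and q: "q \<in> off_diagonal N" for p q
  proof -
    have b: "\<bar>?h p \<omega> * ?h q \<omega>\<bar> \<le> B\<^sup>2" if "\<omega> \<in> space M" for \<omega>
      unfolding abs_mult power2_eq_square using hb that p q B by (intro mult_mono) auto
    show i: "integrable M (\<lambda>\<omega>. ?h p \<omega> * ?h q \<omega>)"
      using hm[OF p] hm[OF q] b by (intro integrable_const_bound[of _ "B\<^sup>2"]) auto
    have "\<bar>LINT \<omega>|M. ?h p \<omega> * ?h q \<omega>\<bar> \<le> (LINT \<omega>|M. \<bar>?h p \<omega> * ?h q \<omega>\<bar>)"
      using integral_norm_bound[of M "\<lambda>\<omega>. ?h p \<omega> * ?h q \<omega>"] unfolding real_norm_def .
    also have "\<dots> \<le> B\<^sup>2" using b i by (intro integral_le_const AE_I2 integrable_abs)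
    finally show "\<bar>LINT \<omega>|M. ?h p \<omega> * ?h q \<omega>\<bar> \<le> B\<^sup>2" .
  qed
  have mean0: "(LINT \<omega>|M. ?h p \<omega>) = 0" if p: "p \<in> off_diagonal N" for p
  proof -
    obtain i j where ij: "p = (i, j)" "i < N" "j < N" "i \<noteq> j" using p by auto
    have "indep_var (PiM {i} (\<lambda>_. Rplus)) (\<lambda>\<omega>. restrict (\<lambda>i. X i \<omega>) {i})
        (PiM {j} (\<lambda>_. Rplus)) (\<lambda>\<omega>. restrict (\<lambda>i. X i \<omega>) {j})"
      by (rule indep_var_restrict[OF indep]) (use ij in auto)
    from indep_var_compose[OF this measurable_component_singleton[of i] measurable_component_singleton[of j]]
    have "indep_var Rplus (X i) Rplus (X j)" by (simp add: comp_def)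
    then have d: "distr M (Rplus \<Otimes>\<^sub>M Rplus) (\<lambda>\<omega>. (X i \<omega>, X j \<omega>)) = \<mu> \<Otimes>\<^sub>M \<mu>"
      using ij law by (simp add: indep_var_distribution_eq)
    have "(LINT p|(\<mu> \<Otimes>\<^sub>M \<mu>). h p) = (LINT \<omega>|M. h (X i \<omega>, X j \<omega>))"
      unfolding d[symmetric] by (rule integral_distr[OF _ h]) (use X ij in auto)
    then show ?thesis using mean ij by simp
  qed
  have uncorrelated: "(LINT \<omega>|M. ?h p \<omega> * ?h q \<omega>) = 0"
    if p: "p \<in> off_diagonal N" and q: "q \<in> off_diagonal N"
      and disj: "fst q \<notin> {fst p, snd p}" "snd q \<notin> {fst p, snd p}" for p q
  proof -
    let ?I = "{fst p, snd p}" and ?J = "{fst q, snd q}"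
    have "indep_var (PiM ?I (\<lambda>_. Rplus)) (\<lambda>\<omega>. restrict (\<lambda>i. X i \<omega>) ?I)
        (PiM ?J (\<lambda>_. Rplus)) (\<lambda>\<omega>. restrict (\<lambda>i. X i \<omega>) ?J)"
      by (rule indep_var_restrict[OF indep]) (use p q disj in auto)
    from indep_var_compose[OF this pair_coordinates_measurable[OF h, of "fst p" _ "snd p"]
        pair_coordinates_measurable[OF h, of "fst q" _ "snd q"]]
    have "indep_var borel (?h p) borel (?h q)" by (simp add: comp_def)
    from indep_var_lebesgue_integral[OF this hi[OF p] hi[OF q]] show ?thesis
      using mean0[OF p] by simp
  qed
  have "(LINT \<omega>|M. (pair_statistic N h (\<lambda>i. X i \<omega>))\<^sup>2)
      = (LINT \<omega>|M. (1 / N * (1 / N))\<^sup>2 * (\<Sum>p\<in>off_diagonal N. \<Sum>q\<in>off_diagonal N. ?h p \<omega> * ?h q \<omega>))"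
    by (rule Bochner_Integration.integral_cong)
      (simp_all add: pair_statistic_def case_prod_beta power2_eq_square sum_product)
  also have "\<dots> = (1 / N * (1 / N))\<^sup>2 * (\<Sum>p\<in>off_diagonal N. \<Sum>q\<in>off_diagonal N. LINT \<omega>|M. ?h p \<omega> * ?h q \<omega>)"
  proof -
    have "(LINT \<omega>|M. (\<Sum>p\<in>off_diagonal N. \<Sum>q\<in>off_diagonal N. ?h p \<omega> * ?h q \<omega>))
        = (\<Sum>p\<in>off_diagonal N. LINT \<omega>|M. (\<Sum>q\<in>off_diagonal N. ?h p \<omega> * ?h q \<omega>))"
      by (intro Bochner_Integration.integral_sum Bochner_Integration.integrable_sum hhi)
    also have "\<dots> = (\<Sum>p\<in>off_diagonal N. \<Sum>q\<in>off_diagonal N. LINT \<omega>|M. ?h p \<omega> * ?h q \<omega>)"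
      by (intro sum.cong refl Bochner_Integration.integral_sum hhi)
    finally show ?thesis by simp
  qed
  also have "\<dots> \<le> (1 / N * (1 / N))\<^sup>2 * (real N * real N * (4 * real N * B\<^sup>2))"
  proof (rule mult_left_mono)
    have "\<bar>\<Sum>p\<in>off_diagonal N. \<Sum>q\<in>off_diagonal N. LINT \<omega>|M. ?h p \<omega> * ?h q \<omega>\<bar>
        \<le> real N * real N * (4 * real N * B\<^sup>2)"
    proof (rule sum_off_diagonal_le)
      fix p assume p: "p \<in> off_diagonal N"
      show "\<bar>\<Sum>q\<in>off_diagonal N. LINT \<omega>|M. ?h p \<omega> * ?h q \<omega>\<bar> \<le> 4 * real N * B\<^sup>2"
        by (rule sum_meeting_le[of N _ _ "fst p" "snd p"]) (use hhb[OF p] uncorrelated[OF p] in auto)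
    qed simp
    then show "(\<Sum>p\<in>off_diagonal N. \<Sum>q\<in>off_diagonal N. LINT \<omega>|M. ?h p \<omega> * ?h q \<omega>)
        \<le> real N * real N * (4 * real N * B\<^sup>2)" by linarith
  qed simp
  also have "\<dots> = 4 * B\<^sup>2 / N" using N by (simp add: power2_eq_square)
  finally show ?thesis .
qed

end

text \<open>Independent initial wealths with an exchange-invariant law put the system into a stationary state.\<close>

locale iid_exchange_process = prob_space M for M :: "'w measure" +
  fixes N :: nat and Y :: "real \<Rightarrow> 'w \<Rightarrow> nat \<Rightarrow> real" and \<mu> :: "real measure"
  assumes N_pos: "0 < N"
    and process: "wealth_exchange_process M N Y"
    and invariant: "exchange_invariant \<mu>"
    and initial_indep: "indep_vars (\<lambda>_. Rplus) (\<lambda>i \<omega>. Y 0 \<omega> i) {..<N}"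
    and initial_law: "\<And>i. i < N \<Longrightarrow> distr M Rplus (\<lambda>\<omega>. Y 0 \<omega> i) = \<mu>"
begin

sublocale bounded_jump_process M "states N" "exchange_generator N" Y "2 * real N"
  by (rule wealth_exchange_bounded_jump[OF prob_space_axioms process])

text \<open>The initial configuration is extensional, hence equal to the tuple of its coordinates below \<open>N\<close>.\<close>

lemma initial_distr: "distr M (states N) (Y 0) = PiM {..<N} (\<lambda>_. \<mu>)"
proof -
  have rv: "random_variable Rplus (\<lambda>\<omega>. Y 0 \<omega> i)" if "i \<in> {..<N}" for i
    using initial_indep that by (auto simp: indep_vars_def)
  have "distr M (states N) (\<lambda>\<omega>. \<lambda>i\<in>{..<N}. Y 0 \<omega> i) = (\<Pi>\<^sub>M i\<in>{..<N}. distr M Rplus (\<lambda>\<omega>. Y 0 \<omega> i))"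
    using indep_vars_iff_distr_eq_PiM'[where I="{..<N}" and M'="\<lambda>_. Rplus" and X="\<lambda>i \<omega>. Y 0 \<omega> i", OF _ rv]
      initial_indep N_pos by (auto simp: lessThan_empty_iff)
  also have "\<dots> = PiM {..<N} (\<lambda>_. \<mu>)" by (intro PiM_cong) (auto simp: initial_law)
  also have "distr M (states N) (\<lambda>\<omega>. \<lambda>i\<in>{..<N}. Y 0 \<omega> i) = distr M (states N) (Y 0)"
  proof (rule distr_cong)
    fix \<omega> assume "\<omega> \<in> space M"
    then have "Y 0 \<omega> \<in> space (states N)" by (intro Y_space) auto
    then show "(\<lambda>i\<in>{..<N}. Y 0 \<omega> i) = Y 0 \<omega>" by (auto simp: space_PiM PiE_def extensional_restrict)
  qed auto
  finally show ?thesis .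
qed

lemma stationary:
  fixes F :: "(nat \<Rightarrow> real) \<Rightarrow> real"
  assumes F: "F \<in> borel_measurable (states N)" and B: "\<And>x. x \<in> space (states N) \<Longrightarrow> \<bar>F x\<bar> \<le> B" and t: "0 \<le> t"
  shows "(LINT \<omega>|M. F (Y t \<omega>)) = (LINT \<omega>|M. F (Y 0 \<omega>))"
proof (rule stationary_expectation[OF _ F B t])
  fix G :: "(nat \<Rightarrow> real) \<Rightarrow> real" and C assume G: "G \<in> borel_measurable (states N)" and C: "\<And>x. x \<in> space (states N) \<Longrightarrow> \<bar>G x\<bar> \<le> C"
  let ?\<pi> = "PiM {..<N} (\<lambda>_. \<mu>)"
  have s: "sets ?\<pi> = sets (states N)"
    using invariant by (intro sets_PiM_cong refl prob_measures_D) (simp add: exchange_invariant_def)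
  note Y0 = Y_measurable[OF order_refl]
  interpret \<pi>: prob_space ?\<pi>
    unfolding initial_distr[symmetric] by (rule prob_space_distr[OF Y0])
  have G': "G \<in> borel_measurable ?\<pi>" using G measurable_cong_sets[OF s refl] by blast
  have pair: "integrable ?\<pi> (\<lambda>x. LINT r|unit_interval. G (exchange i j r x) - G x)"
    "(LINT x|?\<pi>. LINT r|unit_interval. G (exchange i j r x) - G x) = 0"
    if ij: "i < N" "j < N" "i \<noteq> j" for i j
  proof -
    let ?T = "\<lambda>(x, r). exchange i j r x"
    have "?T \<in> measurable (states N \<Otimes>\<^sub>M unit_interval) (states N)"
      using measurable_compose[OF measurable_pair_swap' exchange_measurable[OF ij(1,2)]]
      by (simp add: case_prod_beta)
    then have T: "?T \<in> measurable (?\<pi> \<Otimes>\<^sub>M unit_interval) ?\<pi>"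
      using measurable_cong_sets[OF sets_pair_measure_cong[OF s refl] s] by blast
    have inv: "(\<integral>\<^sup>+x. \<integral>\<^sup>+r. H (?T (x, r)) \<partial>unit_interval \<partial>?\<pi>) = (\<integral>\<^sup>+x. H x \<partial>?\<pi>)"
      if "H \<in> borel_measurable ?\<pi>" for H
    proof -
      have "H \<in> borel_measurable (states N)" using that measurable_cong_sets[OF s refl] by blast
      then show ?thesis using product_exchange_invariant[OF invariant ij] by simp
    qed
    have C': "\<bar>G x\<bar> \<le> C" if "x \<in> space ?\<pi>" for x using C that sets_eq_imp_space_eq[OF s] by blast
    note increment = invariant_increment[OF \<pi>.prob_space_axioms prob_space_unit_interval T inv G' C']
    show "integrable ?\<pi> (\<lambda>x. LINT r|unit_interval. G (exchange i j r x) - G x)"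
      "(LINT x|?\<pi>. LINT r|unit_interval. G (exchange i j r x) - G x) = 0"
      using increment(1,2) by simp_all
  qed
  have "(LINT \<omega>|M. exchange_generator N G (Y 0 \<omega>)) = (LINT x|distr M (states N) (Y 0). exchange_generator N G x)"
    by (rule integral_distr[symmetric, OF Y0 exchange_generator_measurable[OF G]])
  also have "\<dots> = (\<Sum>p\<in>off_diagonal N. LINT x|?\<pi>. 1 / N * (LINT r|unit_interval. G (exchange (fst p) (snd p) r x) - G x))"
    unfolding initial_distr exchange_generator_eq case_prod_beta
    by (rule Bochner_Integration.integral_sum) (auto intro: pair(1))
  also have "\<dots> = 0" by (rule sum.neutral) (auto simp: pair(2))
  finally show "(LINT \<omega>|M. exchange_generator N G (Y 0 \<omega>)) = 0" .
qed

text \<open>By stationarity, Chebyshev's inequality with the initial second moment serves at all times.  The constant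
  \<open>32 B\<^sup>2\<close> is \<open>K2 + 2 B K1\<close> for the bounds \<open>K1 = 8 B\<close> and \<open>K2 = 16 B\<^sup>2\<close> of the generator.\<close>

lemma pair_statistic_maximal:
  assumes h: "h \<in> borel_measurable (Rplus \<Otimes>\<^sub>M Rplus)" and hB: "\<And>p. p \<in> {0..} \<times> {0..} \<Longrightarrow> \<bar>h p\<bar> \<le> B"
    and mean: "(LINT p|(\<mu> \<Otimes>\<^sub>M \<mu>). h p) = 0" and l: "0 < l" and t: "0 \<le> t"
    and n: "0 < n" "t / real n * (32 * B\<^sup>2) \<le> l\<^sup>2 / 2"
  shows "{\<omega> \<in> space M. \<exists>u\<in>{0..t}. 2 * l < \<bar>pair_statistic N h (Y u \<omega>)\<bar>} \<in> events"
    and "prob {\<omega> \<in> space M. \<exists>u\<in>{0..t}. 2 * l < \<bar>pair_statistic N h (Y u \<omega>)\<bar>} \<le> 8 * real n * B\<^sup>2 / (l\<^sup>2 * N)"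
proof -
  let ?q = "pair_statistic N h"
  have q[measurable]: "?q \<in> borel_measurable (states N)" by (rule pair_statistic_measurable[OF h])
  have qB: "\<bar>?q x\<bar> \<le> B" if "x \<in> space (states N)" for x by (rule pair_statistic_bound[OF hB that])
  have K: "t / real n * (16 * B\<^sup>2 + 2 * B * (8 * B)) \<le> l\<^sup>2 / 2"
    using n(2) by (simp add: power2_eq_square)
  have p: "prob {\<omega> \<in> space M. l < \<bar>?q (Y u \<omega>)\<bar>} \<le> 4 * B\<^sup>2 / (l\<^sup>2 * N)" if u: "0 \<le> u" for u
  proof -
    note Y_measurable[OF u, measurable]
    let ?E = "{\<omega> \<in> space M. l < \<bar>?q (Y u \<omega>)\<bar>}"
    have q2: "\<bar>(?q x)\<^sup>2\<bar> \<le> B\<^sup>2" if "x \<in> space (states N)" for x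
      using power_mono[OF qB[OF that], of 2] by simp
    have "l\<^sup>2 * prob ?E = (LINT \<omega>|M. l\<^sup>2 * indicator ?E \<omega>)" by simp
    also have "\<dots> \<le> (LINT \<omega>|M. (?q (Y u \<omega>))\<^sup>2)"
    proof (rule integral_mono)
      show "integrable M (\<lambda>\<omega>. l\<^sup>2 * indicator ?E \<omega>)"
        by (rule integrable_bdd[where b="l\<^sup>2"]) (auto simp: indicator_def)
      show "integrable M (\<lambda>\<omega>. (?q (Y u \<omega>))\<^sup>2)"
        by (rule integrable_bdd[where b="B\<^sup>2"]) (use q2 Y_space[OF u] in auto)
      show "l\<^sup>2 * indicator ?E \<omega> \<le> (?q (Y u \<omega>))\<^sup>2" for \<omega>
        using l power_mono[of l "\<bar>?q (Y u \<omega>)\<bar>" 2] by (auto simp: indicator_def)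
    qed
    also have "\<dots> = (LINT \<omega>|M. (?q (Y 0 \<omega>))\<^sup>2)"
      using stationary[of "\<lambda>x. (?q x)\<^sup>2", OF _ q2 u] by simp
    also have "\<dots> \<le> 4 * B\<^sup>2 / N"
      using pair_statistic_second_moment[OF hB prob_space_axioms h mean N_pos initial_indep initial_law] by simp
    finally show ?thesis using l N_pos by (simp add: field_simps)
  qed
  note mx = maximal_inequality[OF q qB pair_statistic_generator_bound[OF hB] l t n(1) K p]
  show "{\<omega> \<in> space M. \<exists>u\<in>{0..t}. 2 * l < \<bar>?q (Y u \<omega>)\<bar>} \<in> events" using mx(1) by simp
  show "prob {\<omega> \<in> space M. \<exists>u\<in>{0..t}. 2 * l < \<bar>?q (Y u \<omega>)\<bar>} \<le> 8 * real n * B\<^sup>2 / (l\<^sup>2 * N)"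
    using mx(2) by simp
qed

end

section \<open>Events of vanishing probability and the Skorokhod distance\<close>

text \<open>The events of interest, such as those about the Skorokhod distance, need not be measurable.  This
  predicate keeps measurable supersets, so that unions can be bounded by additivity.\<close>

definition asymptotically_null :: "'w measure \<Rightarrow> (nat \<Rightarrow> 'w set) \<Rightarrow> bool" where
  "asymptotically_null M A \<longleftrightarrow> (\<exists>E. (\<forall>N. E N \<in> sets M) \<and> (\<forall>\<^sub>F N in sequentially. A N \<subseteq> E N) \<and>
     (\<lambda>N. emeasure M (E N)) \<longlonglongrightarrow> 0)"

lemma asymptotically_null_except:
  assumes null: "asymptotically_null M A"
    and good: "\<And>N \<omega>. 2 \<le> N \<Longrightarrow> \<omega> \<in> space M \<Longrightarrow> \<omega> \<notin> A N \<Longrightarrow> \<not> P N \<omega>"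
  shows "asymptotically_null M (\<lambda>N. {\<omega> \<in> space M. P N \<omega>})"
proof -
  from null obtain E where E: "\<forall>N. E N \<in> sets M" "\<forall>\<^sub>F N in sequentially. A N \<subseteq> E N"
    "(\<lambda>N. emeasure M (E N)) \<longlonglongrightarrow> 0"
    by (auto simp: asymptotically_null_def)
  have "\<forall>\<^sub>F N in sequentially. {\<omega> \<in> space M. P N \<omega>} \<subseteq> E N"
    using E(2) eventually_ge_at_top[of 2] by eventually_elim (use good in blast)
  then show ?thesis using E unfolding asymptotically_null_def by blast
qed

lemma asymptotically_null_Un:
  assumes "asymptotically_null M A" "asymptotically_null M B"
  shows "asymptotically_null M (\<lambda>N. A N \<union> B N)"
proof -
  from assms obtain E E' where E: "\<forall>N. E N \<in> sets M" "\<forall>\<^sub>F N in sequentially. A N \<subseteq> E N"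
    "(\<lambda>N. emeasure M (E N)) \<longlonglongrightarrow> 0" "\<forall>N. E' N \<in> sets M" "\<forall>\<^sub>F N in sequentially. B N \<subseteq> E' N"
    "(\<lambda>N. emeasure M (E' N)) \<longlonglongrightarrow> 0"
    by (auto simp: asymptotically_null_def)
  show ?thesis unfolding asymptotically_null_def
  proof (intro exI[of _ "\<lambda>N. E N \<union> E' N"] conjI)
    show "\<forall>\<^sub>F N in sequentially. A N \<union> B N \<subseteq> E N \<union> E' N"
      using E(2,5) by eventually_elim blast
    show "(\<lambda>N. emeasure M (E N \<union> E' N)) \<longlonglongrightarrow> 0"
    proof (rule tendsto_sandwich[OF _ _ tendsto_const])
      show "\<forall>\<^sub>F N in sequentially. emeasure M (E N \<union> E' N) \<le> emeasure M (E N) + emeasure M (E' N)"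
        using E(1,4) by (intro always_eventually allI emeasure_subadditive) auto
      show "(\<lambda>N. emeasure M (E N) + emeasure M (E' N)) \<longlonglongrightarrow> 0"
        using tendsto_add[OF E(3,6)] by simp
    qed simp
  qed (use E in auto)
qed

lemma asymptotically_null_null:
  assumes "AE \<omega> in M. \<forall>N\<ge>2. \<omega> \<notin> A N" "\<And>N. A N \<subseteq> space M"
  shows "asymptotically_null M A"
proof -
  obtain Z where Z: "{\<omega> \<in> space M. \<not> (\<forall>N\<ge>2. \<omega> \<notin> A N)} \<subseteq> Z" "emeasure M Z = 0" "Z \<in> sets M"
    using assms(1) by (rule AE_E)
  have "\<forall>\<^sub>F N in sequentially. A N \<subseteq> Z"
    using eventually_ge_at_top[of 2] by eventually_elim (use Z(1) assms(2) in blast)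
  then show ?thesis using Z unfolding asymptotically_null_def by (intro exI[of _ "\<lambda>_. Z"]) auto
qed

lemma asymptotically_null_finite_UN:
  assumes "finite I" "\<And>i. i \<in> I \<Longrightarrow> asymptotically_null M (A i)"
  shows "asymptotically_null M (\<lambda>N. \<Union>i\<in>I. A i N)"
  using assms
proof (induction I)
  case empty
  then show ?case by (auto simp: asymptotically_null_def intro!: exI[of _ "\<lambda>_. {}"])
qed (simp add: asymptotically_null_Un)

lemma asymptotically_null_outer_measure:
  assumes "asymptotically_null M A"
  shows "(\<lambda>N. outer_measure_of M (A N)) \<longlonglongrightarrow> 0"
proof -
  from assms obtain E where E: "\<forall>N. E N \<in> sets M" "\<forall>\<^sub>F N in sequentially. A N \<subseteq> E N"
    "(\<lambda>N. emeasure M (E N)) \<longlonglongrightarrow> 0"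
    by (auto simp: asymptotically_null_def)
  show ?thesis
  proof (rule tendsto_sandwich[OF _ _ tendsto_const E(3)])
    show "\<forall>\<^sub>F N in sequentially. outer_measure_of M (A N) \<le> emeasure M (E N)"
      using E(2) by eventually_elim (metis E(1) outer_measure_of_eq outer_measure_of_mono)
  qed simp
qed

lemma prokhorov_dist_le:
  assumes "0 < e" "\<And>F. closed F \<Longrightarrow> F \<subseteq> {0..} \<Longrightarrow>
      measure \<mu> F \<le> measure \<nu> {x. 0 \<le> x \<and> (\<exists>y\<in>F. \<bar>x - y\<bar> < e)} + e"
  shows "prokhorov_dist \<mu> \<nu> \<le> e"
  unfolding prokhorov_dist_def
proof (rule cInf_lower)
  show "bdd_below {e. 0 < e \<and> (\<forall>F. closed F \<and> F \<subseteq> {0..} \<longrightarrow>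
      measure \<mu> F \<le> measure \<nu> {x. 0 \<le> x \<and> (\<exists>y\<in>F. \<bar>x - y\<bar> < e)} + e)}"
    by (rule bdd_belowI[of _ 0]) (simp only: mem_Collect_eq less_imp_le)
qed (use assms in blast)

text \<open>Cut the half-line into bins of length \<open>d\<close> and a tail of small mass.  The bins that meet a closed set lie in its
  \<open>d\<close>-neighbourhood, so the Prokhorov distance is controlled by the masses of finitely many sets.\<close>

lemma prokhorov_dist_bins:
  assumes \<mu>: "\<mu> \<in> prob_measures" and d: "0 < d"
  obtains \<A> \<eta> where "finite \<A>" "\<A> \<subseteq> sets Rplus" "0 < \<eta>"
    "\<And>\<nu>. \<nu> \<in> prob_measures \<Longrightarrow> (\<And>A. A \<in> \<A> \<Longrightarrow> \<bar>measure \<nu> A - measure \<mu> A\<bar> \<le> \<eta>) \<Longrightarrow> prokhorov_dist \<nu> \<mu> \<le> d"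
proof -
  interpret \<mu>: prob_space \<mu> by (rule prob_measures_D[OF \<mu>])
  let ?tail = "\<lambda>m. {real m * d..}"
  let ?bin = "\<lambda>k. {real k * d..<real (Suc k) * d}"
  have restr: "A \<in> sets Rplus" if "A \<in> sets borel" "A \<subseteq> {0..}" for A
    using that unfolding Rplus_def by (subst sets_restrict_space_iff) auto
  have nonneg: "{real k * d..} \<subseteq> {0..}" "{real k * d..<real (Suc k) * d} \<subseteq> {0..}" for k
    using d by (auto intro: order_trans[of 0 "real k * d"])
  have pos: "0 \<le> real k * d" for k using d by simp
  have tail_sets: "?tail m \<in> sets Rplus" for m by (intro restr nonneg) simp
  have bin_sets: "?bin k \<in> sets Rplus" for k by (intro restr nonneg) simp
  have "(\<lambda>m. measure \<mu> (?tail m)) \<longlonglongrightarrow> measure \<mu> (\<Inter>m. ?tail m)"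
  proof (rule \<mu>.finite_Lim_measure_decseq)
    show "range ?tail \<subseteq> \<mu>.events" using tail_sets prob_measures_D(2)[OF \<mu>] by auto
    show "decseq ?tail"
      unfolding decseq_def using d by (simp add: mult_right_mono)
  qed
  also have "(\<Inter>m. ?tail m) = {}"
  proof -
    have "x \<notin> (\<Inter>m. ?tail m)" for x
    proof -
      obtain m where "x < real m * d" using reals_Archimedean3[OF d] by blast
      then have "x \<notin> ?tail m" by simp
      then show ?thesis by (intro notI) (drule INT_D[of _ _ _ m], simp_all)
    qed
    then show ?thesis by blast
  qed
  finally have "(\<lambda>m. measure \<mu> (?tail m)) \<longlonglongrightarrow> 0" by simp
  then have "\<forall>\<^sub>F m in sequentially. measure \<mu> (?tail m) < d / 2"
    using d by (intro order_tendstoD(2)[where y=0]) auto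
  then obtain m where m: "measure \<mu> (?tail m) < d / 2" by (auto simp: eventually_sequentially)
  \<comment> \<open>half of \<open>d\<close> for the deviations on \<open>m\<close> bins and the tail, half for the mass of the tail\<close>
  define \<eta> where "\<eta> = d / (2 * (real m + 1))"
  have \<eta>: "0 < \<eta>" "(real m + 1) * \<eta> = d / 2" using d by (auto simp: \<eta>_def field_simps)
  show ?thesis
  proof (rule that[of "insert (?tail m) (?bin ` {..<m})" \<eta>])
    fix \<nu> assume \<nu>: "\<nu> \<in> prob_measures"
      and close: "\<And>A. A \<in> insert (?tail m) (?bin ` {..<m}) \<Longrightarrow> \<bar>measure \<nu> A - measure \<mu> A\<bar> \<le> \<eta>"
    interpret \<nu>: prob_space \<nu> by (rule prob_measures_D[OF \<nu>])
    show "prokhorov_dist \<nu> \<mu> \<le> d"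
    proof (rule prokhorov_dist_le[OF d])
      fix F :: "real set" assume F: "closed F" "F \<subseteq> {0..}"
      let ?near = "{x. 0 \<le> x \<and> (\<exists>y\<in>F. \<bar>x - y\<bar> < d)}"
      define I where "I = {k. k < m \<and> ?bin k \<inter> F \<noteq> {}}"
      have I: "finite I" "I \<subseteq> {..<m}" by (auto simp: I_def)
      have near: "?near \<in> sets Rplus"
      proof (rule restr)
        have "?near = {0..} \<inter> (\<Union>y\<in>F. ball y d)" by (auto simp: ball_def dist_real_def abs_minus_commute)
        moreover have "open (\<Union>y\<in>F. ball y d)" by blast
        ultimately show "?near \<in> sets borel" by (simp only: sets.Int borel_open borel_closed closed_atLeast)
      qed auto
      have cover: "F \<subseteq> (\<Union>k\<in>I. ?bin k) \<union> ?tail m"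
      proof
        fix x assume x: "x \<in> F"
        define k where "k = nat \<lfloor>x / d\<rfloor>"
        have "0 \<le> x / d" using x F d by auto
        then have "real k \<le> x / d" "x / d < real (Suc k)" by (auto simp: k_def) linarith
        then have k: "x \<in> ?bin k" using d by (auto simp: field_simps)
        show "x \<in> (\<Union>k\<in>I. ?bin k) \<union> ?tail m"
        proof (cases "k < m")
          case True
          then have "k \<in> I" using k x by (auto simp: I_def)
          then show ?thesis using k by blast
        next
          case False
          then have "real m * d \<le> real k * d" using d by (intro mult_right_mono) auto
          then show ?thesis using k by auto
        qed
      qed
      have "measure \<nu> F \<le> measure \<nu> ((\<Union>k\<in>I. ?bin k) \<union> ?tail m)"
        using cover bin_sets tail_sets I prob_measures_D(2)[OF \<nu>] by (intro \<nu>.finite_measure_mono) auto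
      also have "\<dots> \<le> measure \<nu> (\<Union>k\<in>I. ?bin k) + measure \<nu> (?tail m)"
        using bin_sets tail_sets I prob_measures_D(2)[OF \<nu>] by (intro measure_Un_le) auto
      also have "\<dots> \<le> (\<Sum>k\<in>I. measure \<nu> (?bin k)) + measure \<nu> (?tail m)"
        using bin_sets I prob_measures_D(2)[OF \<nu>]
        by (intro add_right_mono \<nu>.finite_measure_subadditive_finite) auto
      also have "\<dots> \<le> (\<Sum>k\<in>I. measure \<mu> (?bin k) + \<eta>) + (measure \<mu> (?tail m) + \<eta>)"
      proof (intro add_mono sum_mono)
        show "measure \<nu> (?bin k) \<le> measure \<mu> (?bin k) + \<eta>" if "k \<in> I" for k
          using close[of "?bin k"] that I by auto
        show "measure \<nu> (?tail m) \<le> measure \<mu> (?tail m) + \<eta>" using close[of "?tail m"] by auto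
      qed
      also have "\<dots> = (\<Sum>k\<in>I. measure \<mu> (?bin k)) + measure \<mu> (?tail m) + (real (card I) + 1) * \<eta>"
        by (simp add: sum.distrib algebra_simps)
      also have "(\<Sum>k\<in>I. measure \<mu> (?bin k)) = measure \<mu> (\<Union>k\<in>I. ?bin k)"
      proof (rule \<mu>.finite_measure_finite_Union[symmetric, OF I(1)])
        show "disjoint_family_on ?bin I"
        proof -
          have "?bin j \<inter> ?bin k = {}" if "j < k" for j k
          proof -
            have "real (Suc j) * d \<le> real k * d" using that d by (intro mult_right_mono) auto
            then show ?thesis by auto
          qed
          note less = this
          have "?bin j \<inter> ?bin k = {}" if "j \<noteq> k" for j k
          proof (cases "j < k")
            case False
            then have "?bin k \<inter> ?bin j = {}" using that by (intro less) simp
            then show ?thesis by (subst Int_commute)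
          qed (rule less)
          then show ?thesis unfolding disjoint_family_on_def by (intro ballI impI)
        qed
      qed (use bin_sets prob_measures_D(2)[OF \<mu>] in auto)
      also have "measure \<mu> (\<Union>k\<in>I. ?bin k) \<le> measure \<mu> ?near"
      proof (rule \<mu>.finite_measure_mono)
        show "(\<Union>k\<in>I. ?bin k) \<subseteq> ?near"
        proof
          fix x assume "x \<in> (\<Union>k\<in>I. ?bin k)"
          then obtain k where "k \<in> I" "x \<in> ?bin k" by blast
          moreover then obtain y where "y \<in> ?bin k" "y \<in> F" unfolding I_def by blast
          ultimately have k: "x \<in> ?bin k" "y \<in> ?bin k" "y \<in> F" by blast+
          then have "\<bar>x - y\<bar> < d" by (auto simp: algebra_simps)
          moreover have "0 \<le> x" using k(1) pos[of k] by auto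
          ultimately show "x \<in> ?near" using k(3) by blast
        qed
      qed (use near prob_measures_D(2)[OF \<mu>] in auto)
      also have "(real (card I) + 1) * \<eta> \<le> (real m + 1) * \<eta>"
        using card_mono[OF _ I(2)] \<eta> by (intro mult_right_mono) auto
      finally show "measure \<nu> F \<le> measure \<mu> ?near + d" using m \<eta> by linarith
    qed
  next
    show "insert (?tail m) (?bin ` {..<m}) \<subseteq> sets Rplus" using bin_sets tail_sets by blast
  qed (simp_all add: \<eta>)
qed

lemma exp_tail_integral:
  "has_bochner_integral lborel (\<lambda>u. exp (- u) * indicator {a..} u :: real) (exp (- a))"
proof (rule has_bochner_integral_nn_integral)
  have "(\<integral>\<^sup>+u. ennreal (exp (- u)) * indicator {a..} u \<partial>lborel) = ennreal (0 - (- exp (- a)))"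
  proof (rule nn_integral_FTC_atLeast)
    show "((\<lambda>u::real. - exp (- u)) has_real_derivative exp (- x)) (at x)" for x
      by (auto intro!: derivative_eq_intros)
    show "((\<lambda>u::real. - exp (- u)) \<longlongrightarrow> 0) at_top"
      using tendsto_minus[OF filterlim_compose[OF exp_at_bot filterlim_uminus_at_bot_at_top]] by simp
  qed auto
  moreover have "(\<integral>\<^sup>+u. ennreal (exp (- u) * indicator {a..} u) \<partial>lborel)
      = (\<integral>\<^sup>+u. ennreal (exp (- u)) * indicator {a..} u \<partial>lborel)"
    by (rule nn_integral_cong) (auto simp: indicator_def)
  ultimately show "(\<integral>\<^sup>+u. ennreal (exp (- u) * indicator {a..} u) \<partial>lborel) = ennreal (exp (- a))" by simp
qed auto

text \<open>Take the identity as time change.  Up to time \<open>T\<close> the stopped paths are within \<open>d\<close>; after \<open>T\<close> their distance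
  is at most 1, and the weight \<open>exp (- u)\<close> contributes \<open>exp (- T)\<close>.\<close>

lemma skorokhod_dist_const_le:
  assumes close: "\<And>s. s \<in> {0..T} \<Longrightarrow> prokhorov_dist (x s) \<mu> \<le> d" and d: "0 \<le> d" and T: "0 \<le> T"
  shows "skorokhod_dist x (\<lambda>_. \<mu>) \<le> d + exp (- T)"
proof -
  let ?P = "{(s :: real, t). 0 \<le> s \<and> s < t}"
  let ?D = "\<lambda>l. LINT u:{0..}|lborel. exp (- u) * stopped_dist x (\<lambda>_. \<mu>) l u"
  have P: "(0, 1) \<in> ?P" by simp
  \<comment> \<open>all slopes of the identity are 1\<close>
  have id_logs: "(\<lambda>(s :: real, t). \<bar>ln ((id t - id s) / (t - s))\<bar>) ` ?P = {0}"
  proof (rule equalityI)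
    show "{0} \<subseteq> (\<lambda>(s :: real, t). \<bar>ln ((id t - id s) / (t - s))\<bar>) ` ?P"
      using imageI[OF P, of "\<lambda>(s :: real, t). \<bar>ln ((id t - id s) / (t - s))\<bar>"] by simp
  qed auto
  have id: "id \<in> time_changes"
    unfolding time_changes_def using id_logs by (auto simp: strict_mono_on_def)
  have size: "time_change_size id = 0" unfolding time_change_size_def id_logs by simp
  have "skorokhod_dist x (\<lambda>_. \<mu>) \<le> max (time_change_size id) (?D id)"
    unfolding skorokhod_dist_def
  proof (rule cINF_lower[OF bdd_belowI2[of _ 0] id])
    fix l assume "l \<in> time_changes"
    then have bdd: "bdd_above ((\<lambda>(s, t). \<bar>ln ((l t - l s) / (t - s))\<bar>) ` ?P)"
      by (simp add: time_changes_def)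
    have "0 \<le> (\<lambda>(s, t). \<bar>ln ((l t - l s) / (t - s))\<bar>) (0 :: real, 1 :: real)" by simp
    also have "\<dots> \<le> time_change_size l"
      unfolding time_change_size_def by (rule cSUP_upper[OF P bdd])
    finally show "0 \<le> max (time_change_size l) (?D l)" by simp
  qed
  moreover have "?D id \<le> d + exp (- T)"
  proof -
    let ?g = "\<lambda>u. d * (exp (- u) * indicator {0..} u) + exp (- u) * indicator {T..} u"
    have stopped: "stopped_dist x (\<lambda>_. \<mu>) id u \<le> (if u \<le> T then d else 1)" if u: "0 \<le> u" for u
      unfolding stopped_dist_def
    proof (rule cSUP_least)
      fix t :: real assume "t \<in> {0..}"
      then show "min 1 (prokhorov_dist (x (min t u)) \<mu>) \<le> (if u \<le> T then d else 1)"
        using close[of "min t u"] u by (auto simp: min_le_iff_disj)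
    qed simp
    have g: "has_bochner_integral lborel ?g (d * exp (- 0) + exp (- T))"
      by (intro has_bochner_integral_add has_bochner_integral_mult_right exp_tail_integral)
    have "?D id \<le> (LINT u|lborel. ?g u)"
      unfolding set_lebesgue_integral_def
    proof (rule integral_mono')
      show "integrable lborel ?g" using g by (simp add: has_bochner_integral_iff)
      fix u :: real
      show "indicator {0..} u *\<^sub>R (exp (- u) * stopped_dist x (\<lambda>_. \<mu>) id u) \<le> ?g u"
      proof (cases "0 \<le> u")
        case True
        have "exp (- u) * stopped_dist x (\<lambda>_. \<mu>) id u \<le> exp (- u) * (if u \<le> T then d else 1)"
          using stopped[OF True] by (intro mult_left_mono) auto
        also have "\<dots> \<le> ?g u" using True d by (auto simp: indicator_def)
        finally show ?thesis using True by simp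
      qed (use T in \<open>simp add: indicator_def\<close>)
      show "0 \<le> ?g u" using d by simp
    qed
    also have "\<dots> = d + exp (- T)" using has_bochner_integral_integral_eq[OF g] by simp
    finally show ?thesis .
  qed
  moreover have "0 \<le> d + exp (- T)" using d by simp
  ultimately show ?thesis unfolding size by linarith
qed

lemma limitin_eventually_const:
  assumes "l \<in> topspace X" "\<forall>\<^sub>F u in F. f u = l"
  shows "limitin X f l F"
  unfolding limitin_def using assms by (auto elim: eventually_mono)

lemma const_in_skorokhod_space: "\<mu> \<in> prob_measures \<Longrightarrow> (\<lambda>_. \<mu>) \<in> skorokhod_space"
  unfolding skorokhod_space_def
  by (auto intro!: limitin_eventually_const exI[of _ \<mu>] simp: topspace_weak_topology)

lemma empirical_path_in_skorokhod_space:
  assumes Y: "wealth_exchange_process M N Y" and N: "0 < N" and \<omega>: "\<omega> \<in> space M"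
  shows "(\<lambda>t. empirical N (Y t \<omega>)) \<in> skorokhod_space"
proof -
  have mj: "markov_jump_process M (states N) (exchange_generator N) Y"
    using Y by (simp add: wealth_exchange_process_def)
  have top: "empirical N (Y t \<omega>) \<in> topspace weak_topology" if "0 \<le> t" for t
  proof -
    have "Y t \<omega> \<in> space (states N)"
      using mj that \<omega> by (auto simp: markov_jump_process_def dest: measurable_space)
    then show ?thesis
      unfolding topspace_weak_topology using N by (intro empirical_prob_measure statesD)
  qed
  have right: "\<forall>\<^sub>F u in at_right t. Y u \<omega> = Y t \<omega>" if "0 \<le> t" for t
    using mj that \<omega> by (auto simp: markov_jump_process_def)
  have left: "\<exists>y. \<forall>\<^sub>F u in at_left t. Y u \<omega> = y" if "0 < t" for t
    using mj that \<omega> by (auto simp: markov_jump_process_def)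
  show ?thesis unfolding skorokhod_space_def
  proof (intro CollectI allI impI conjI)
    fix t :: real assume t: "0 \<le> t"
    show "limitin weak_topology (\<lambda>t. empirical N (Y t \<omega>)) (empirical N (Y t \<omega>)) (at_right t)"
      by (rule limitin_eventually_const[OF top[OF t]]) (use right[OF t] in \<open>auto elim: eventually_mono\<close>)
    assume t: "0 < t"
    then obtain y where y: "\<forall>\<^sub>F u in at_left t. Y u \<omega> = y" using left by blast
    have "\<forall>\<^sub>F u in at_left t. u \<in> {0<..<t}" using eventually_at_left_real[OF t] .
    with y have "\<forall>\<^sub>F u in at_left t. u \<in> {0<..<t} \<and> Y u \<omega> = y" by eventually_elim blast
    then obtain u where u: "u \<in> {0<..<t}" "Y u \<omega> = y"
      using eventually_happens[of _ "at_left t"] trivial_limit_at_left_real by blast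
    then have "empirical N y \<in> topspace weak_topology" using top[of u] by auto
    then have "limitin weak_topology (\<lambda>t. empirical N (Y t \<omega>)) (empirical N y) (at_left t)"
      by (rule limitin_eventually_const) (use y in \<open>auto elim: eventually_mono\<close>)
    then show "\<exists>l. limitin weak_topology (\<lambda>t. empirical N (Y t \<omega>)) l (at_left t)" by blast
  qed
qed

section \<open>Sequences of stationary exchange systems\<close>

lemma tendsto_in_prob_0I:
  assumes "\<And>e. 0 < e \<Longrightarrow> asymptotically_null M (\<lambda>N. {\<omega> \<in> space M. e < \<bar>Z N \<omega>\<bar>})"
  shows "tendsto_in_prob M Z 0"
  unfolding tendsto_in_prob_def using asymptotically_null_outer_measure[OF assms] by simp

lemma cSUP_abs_le:
  fixes f :: "'b \<Rightarrow> real"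
  assumes "I \<noteq> {}" "\<And>i. i \<in> I \<Longrightarrow> \<bar>f i\<bar> \<le> e"
  shows "\<bar>SUP i\<in>I. f i\<bar> \<le> e"
proof -
  obtain i where i: "i \<in> I" using assms(1) by blast
  have "bdd_above (f ` I)" using assms(2) by (intro bdd_aboveI2[of _ _ e]) (simp add: abs_le_iff)
  then have "f i \<le> (SUP i\<in>I. f i)" using i by (rule cSUP_upper[rotated])
  moreover have "(SUP i\<in>I. f i) \<le> e" using assms by (intro cSUP_least) (auto simp: abs_le_iff)
  ultimately show ?thesis using assms(2)[OF i] by linarith
qed

lemma sum_off_diagonal_fst:
  fixes G :: "nat \<Rightarrow> real"
  shows "(\<Sum>(i, j)\<in>off_diagonal N. G i) = (real N - 1) * (\<Sum>i<N. G i)"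
proof -
  have "(\<Sum>i<N. \<Sum>j<N. G i) = real N * (\<Sum>i<N. G i)" by (simp add: sum_distrib_left)
  then show ?thesis using sum_square_split[of "\<lambda>i j. G i" N] by (simp add: left_diff_distrib)
qed

text \<open>For distinct indices, \<open>x i + x j\<close> is at most the total wealth, so the indicator in the collision
  operator has value 1.\<close>

lemma collision_N_empirical:
  assumes x: "x \<in> space (states N)" and N: "0 < N" and W: "W = (\<Sum>i<N. x i)"
    and g: "g \<in> borel_measurable Rplus" and B: "\<And>x. 0 \<le> x \<Longrightarrow> \<bar>g x\<bar> \<le> B"
  shows "collision_N N W g (empirical N x) = pair_statistic N (collision_kernel g) x"
proof -
  interpret U: prob_space unit_interval by (rule prob_space_unit_interval)
  note x0 = statesD[OF x]
  have sum_le: "x i + x j \<le> W" if "(i, j) \<in> off_diagonal N" for i j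
  proof -
    have "x i + x j = (\<Sum>k\<in>{i, j}. x k)" using that by simp
    also have "\<dots> \<le> W" unfolding W using that x0 by (intro sum_mono2) auto
    finally show ?thesis .
  qed
  let ?R2 = "Rplus \<Otimes>\<^sub>M Rplus"
  have gain: "collision_gain g r \<in> borel_measurable ?R2" if "r \<in> space unit_interval" for r
    using measurable_Pair1[OF collision_gain_measurable[OF g] that] by simp
  have inner: "(LINT p|pair_empirical N (empirical N x). collision_gain g r p * indicator {p. fst p + snd p \<le> W} p)
      = 1 / N * (1 / N) * (\<Sum>p\<in>off_diagonal N. collision_gain g r (x (fst p), x (snd p)))"
    if r: "r \<in> space unit_interval" for r
  proof -
    have "(\<lambda>p. fst p) \<in> measurable ?R2 Rplus" "(\<lambda>p. snd p) \<in> measurable ?R2 Rplus" by auto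
    from this[THEN measurable_compose, OF measurable_Rplus_id]
    have "(\<lambda>p. fst p + snd p) \<in> borel_measurable ?R2" by (rule borel_measurable_add)
    then have "(\<lambda>p. indicator {..W} (fst p + snd p) :: real) \<in> borel_measurable ?R2"
      by (rule measurable_compose) simp
    moreover have "(\<lambda>p. indicator {..W} (fst p + snd p) :: real) = indicator {p. fst p + snd p \<le> W}"
      by (auto simp: indicator_def fun_eq_iff)
    ultimately have "(\<lambda>p. collision_gain g r p * indicator {p. fst p + snd p \<le> W} p) \<in> borel_measurable ?R2"
      using gain[OF r] by (intro borel_measurable_times) simp_all
    from pair_empirical_integral[OF x0 N this]
    have "(LINT p|pair_empirical N (empirical N x). collision_gain g r p * indicator {p. fst p + snd p \<le> W} p)
      = 1 / N * (1 / N) * (\<Sum>(i, j)\<in>off_diagonal N. collision_gain g r (x i, x j)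
          * indicator {p. fst p + snd p \<le> W} (x i, x j))" by simp
    also have "(\<Sum>(i, j)\<in>off_diagonal N. collision_gain g r (x i, x j) * indicator {p. fst p + snd p \<le> W} (x i, x j))
        = (\<Sum>p\<in>off_diagonal N. collision_gain g r (x (fst p), x (snd p)))"
      using sum_le by (intro sum.cong) auto
    finally show ?thesis .
  qed
  have int: "integrable unit_interval (\<lambda>r. collision_gain g r (x (fst p), x (snd p)))" if p: "p \<in> off_diagonal N" for p
  proof (rule U.integrable_const_bound[of _ "4 * B"])
    have sp: "(x (fst p), x (snd p)) \<in> space ?R2" using p x0 by (auto simp: space_pair_measure)
    show "(\<lambda>r. collision_gain g r (x (fst p), x (snd p))) \<in> borel_measurable unit_interval"
      using measurable_Pair2[OF collision_gain_measurable[OF g] sp] by simp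
    show "AE r in unit_interval. norm (collision_gain g r (x (fst p), x (snd p))) \<le> 4 * B"
      using sp B by (intro AE_I2) (auto intro!: collision_gain_bound simp: space_pair_measure)
  qed
  have "collision_N N W g (empirical N x)
      = (LINT r|unit_interval. 1 / N * (1 / N) * (\<Sum>p\<in>off_diagonal N. collision_gain g r (x (fst p), x (snd p))))"
    unfolding collision_N_def set_integral_unit_interval
    by (rule Bochner_Integration.integral_cong[OF refl inner])
  also have "\<dots> = 1 / N * (1 / N) * (\<Sum>p\<in>off_diagonal N. LINT r|unit_interval. collision_gain g r (x (fst p), x (snd p)))"
    unfolding Bochner_Integration.integral_mult_right_zero
    by (rule arg_cong[OF Bochner_Integration.integral_sum[OF int]])
  finally show ?thesis by (simp add: pair_statistic_def collision_kernel_def case_prod_beta)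
qed

text \<open>The systems of all sizes live on one probability space, with an arbitrary joint law.\<close>

locale exchange_sequence = prob_space M for M :: "'w measure" +
  fixes Y :: "nat \<Rightarrow> real \<Rightarrow> 'w \<Rightarrow> nat \<Rightarrow> real" and \<mu> :: "real measure"
  assumes systems: "\<And>N. 2 \<le> N \<Longrightarrow> iid_exchange_process M N (Y N) \<mu>"
begin

lemma invariant: "exchange_invariant \<mu>"
  using iid_exchange_process.invariant[OF systems[of 2]] by simp

lemma \<mu>_prob: "\<mu> \<in> prob_measures"
  using invariant by (simp add: exchange_invariant_def)

lemma states_Y: "2 \<le> N \<Longrightarrow> 0 \<le> u \<Longrightarrow> \<omega> \<in> space M \<Longrightarrow> Y N u \<omega> \<in> space (states N)"
proof -
  assume N: "2 \<le> N" and "0 \<le> u" "\<omega> \<in> space M"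
  interpret iid_exchange_process M N "Y N" \<mu> using systems[OF N] .
  show ?thesis by (rule Y_space) fact+
qed

text \<open>Fix the number \<open>n\<close> of time intervals according to \<open>t\<close>, \<open>e\<close> and \<open>B\<close>; then the bound of the maximal
  inequality is of order \<open>1/N\<close>.\<close>

lemma pair_statistic_vanishes:
  assumes h: "h \<in> borel_measurable (Rplus \<Otimes>\<^sub>M Rplus)" "\<And>p. p \<in> {0..} \<times> {0..} \<Longrightarrow> \<bar>h p\<bar> \<le> B"
    and mean: "(LINT p|(\<mu> \<Otimes>\<^sub>M \<mu>). h p) = 0" and t: "0 \<le> t" and e: "0 < e"
  shows "asymptotically_null M (\<lambda>N. {\<omega> \<in> space M. \<exists>u\<in>{0..t}. e < \<bar>pair_statistic N h (Y N u \<omega>)\<bar>})"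
proof -
  let ?A = "\<lambda>N. {\<omega> \<in> space M. \<exists>u\<in>{0..t}. e < \<bar>pair_statistic N h (Y N u \<omega>)\<bar>}"
  define l where "l = e / 2"
  have l: "0 < l" "2 * l = e" using e by (auto simp: l_def)
  \<comment> \<open>this is the condition \<open>t / n * (32 * B\<^sup>2) \<le> l\<^sup>2 / 2\<close> on the length of the pieces\<close>
  obtain n :: nat where n: "t * (64 * B\<^sup>2) / l\<^sup>2 < n" using reals_Archimedean2 by blast
  moreover have "0 \<le> t * (64 * B\<^sup>2) / l\<^sup>2" using t by simp
  ultimately have n0: "0 < n" by (metis of_nat_0_less_iff order_le_less_trans)
  have fine: "t / real n * (32 * B\<^sup>2) \<le> l\<^sup>2 / 2" using n n0 l by (simp add: field_simps)
  have A: "?A N \<in> events" "prob (?A N) \<le> 8 * real n * B\<^sup>2 / (l\<^sup>2 * N)" if N: "2 \<le> N" for N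
  proof -
    interpret iid_exchange_process M N "Y N" \<mu> using systems[OF N] .
    show "?A N \<in> events" "prob (?A N) \<le> 8 * real n * B\<^sup>2 / (l\<^sup>2 * N)"
      using pair_statistic_maximal[OF h mean l(1) t n0 fine] unfolding l(2) by auto
  qed
  show ?thesis unfolding asymptotically_null_def
  proof (intro exI[of _ "\<lambda>N. if 2 \<le> N then ?A N else {}"] conjI allI)
    show "\<forall>\<^sub>F N in sequentially. ?A N \<subseteq> (if 2 \<le> N then ?A N else {})"
      using eventually_ge_at_top[of 2] by eventually_elim auto
    show "(\<lambda>N. emeasure M (if 2 \<le> N then ?A N else {})) \<longlonglongrightarrow> 0"
    proof (rule tendsto_sandwich[OF _ _ tendsto_const])
      show "\<forall>\<^sub>F N in sequentially. emeasure M (if 2 \<le> N then ?A N else {}) \<le> ennreal (8 * real n * B\<^sup>2 / l\<^sup>2 / N)"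
        using eventually_ge_at_top[of 2]
        by eventually_elim (use A in \<open>auto simp: emeasure_eq_measure intro!: ennreal_leI\<close>)
      show "(\<lambda>N. ennreal (8 * real n * B\<^sup>2 / l\<^sup>2 / N)) \<longlonglongrightarrow> 0"
        using tendsto_ennrealI[OF lim_const_over_n[of "8 * real n * B\<^sup>2 / l\<^sup>2"]] unfolding ennreal_0 .
    qed simp
  qed (use A in auto)
qed

text \<open>The kernel \<open>h (x, y) = g x - c\<close>, with \<open>c\<close> the mean of \<open>g\<close>, is centred, and its pair statistic is
  \<open>(N - 1) / N\<close>, hence at least one half, times the deviation of the empirical mean.\<close>

lemma empirical_mean_vanishes:
  fixes g :: "real \<Rightarrow> real"
  assumes g: "g \<in> borel_measurable Rplus" "\<And>x. 0 \<le> x \<Longrightarrow> \<bar>g x\<bar> \<le> B" and t: "0 \<le> t" and e: "0 < e"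
  shows "asymptotically_null M (\<lambda>N. {\<omega> \<in> space M. \<exists>u\<in>{0..t}.
    e < \<bar>(LINT x|empirical N (Y N u \<omega>). g x) - (LINT x|\<mu>. g x)\<bar>})"
proof -
  interpret \<mu>: prob_space \<mu> by (rule prob_measures_D[OF \<mu>_prob])
  interpret \<mu>\<mu>: pair_prob_space \<mu> \<mu> ..
  have s: "sets \<mu> = sets Rplus" and sp: "space \<mu> = {0..}" using prob_measures_D[OF \<mu>_prob] by auto
  define c where "c = (LINT x|\<mu>. g x)"
  define h where "h p = g (fst p) - c" for p :: "real \<times> real"
  have h: "h \<in> borel_measurable (Rplus \<Otimes>\<^sub>M Rplus)"
    unfolding h_def[abs_def] by (intro borel_measurable_diff measurable_compose[OF measurable_fst g(1)]) simp
  have hB: "\<bar>h p\<bar> \<le> B + \<bar>c\<bar>" if "p \<in> {0..} \<times> {0..}" for p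
    using g(2)[of "fst p"] abs_triangle_ineq4[of "g (fst p)" c] that by (auto simp: h_def)
  have gi: "integrable \<mu> (\<lambda>x. g x - c)"
  proof (rule \<mu>.integrable_const_bound[of _ "B + \<bar>c\<bar>"])
    have "g \<in> borel_measurable \<mu>" using g(1) measurable_cong_sets[OF s refl] by blast
    then show "(\<lambda>x. g x - c) \<in> borel_measurable \<mu>" by simp
    show "AE x in \<mu>. norm (g x - c) \<le> B + \<bar>c\<bar>"
      using hB[of "(_, 0)"] sp by (intro AE_I2) (simp add: h_def)
  qed
  have mean: "(LINT p|(\<mu> \<Otimes>\<^sub>M \<mu>). h p) = 0"
  proof -
    have sets2: "sets (\<mu> \<Otimes>\<^sub>M \<mu>) = sets (Rplus \<Otimes>\<^sub>M Rplus)" by (intro sets_pair_measure_cong s)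
    have "integrable (\<mu> \<Otimes>\<^sub>M \<mu>) (\<lambda>(x, y). g x - c)"
    proof (rule \<mu>\<mu>.integrable_const_bound[of _ "B + \<bar>c\<bar>"])
      show "(\<lambda>(x, y). g x - c) \<in> borel_measurable (\<mu> \<Otimes>\<^sub>M \<mu>)"
      proof -
        have "h \<in> borel_measurable (\<mu> \<Otimes>\<^sub>M \<mu>)" using h measurable_cong_sets[OF sets2 refl] by blast
        then show ?thesis by (simp add: h_def[abs_def] case_prod_beta)
      qed
      show "AE p in (\<mu> \<Otimes>\<^sub>M \<mu>). norm (case p of (x, y) \<Rightarrow> g x - c) \<le> B + \<bar>c\<bar>"
        using hB sp by (intro AE_I2) (auto simp: h_def space_pair_measure)
    qed
    from \<mu>\<mu>.integral_fst[OF this]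
    have "(LINT p|(\<mu> \<Otimes>\<^sub>M \<mu>). h p) = (LINT x|\<mu>. LINT y|\<mu>. g x - c)"
      by (simp add: h_def[abs_def] case_prod_beta')
    also have "\<dots> = (LINT x|\<mu>. g x - c)" using \<mu>.prob_space by simp
    also have "\<dots> = 0"
    proof -
      have "integrable \<mu> g" using Bochner_Integration.integrable_add[OF gi, of "\<lambda>_. c"] by simp
      then show ?thesis using \<mu>.prob_space by (simp add: c_def)
    qed
    finally show ?thesis .
  qed
  have half: "\<bar>(LINT x|empirical N y. g x) - c\<bar> \<le> 2 * \<bar>pair_statistic N h y\<bar>"
    if N: "2 \<le> N" and y: "y \<in> space (states N)" for N y
  proof -
    define m where "m = (LINT x|empirical N y. g x) - c"
    have "(LINT x|empirical N y. g x) = 1 / N * (\<Sum>i<N. g (y i))"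
      by (rule empirical_integral[OF statesD[OF y] g(1)])
    then have "(\<Sum>i<N. g (y i) - c) = N * m" using N by (simp add: m_def sum_subtractf field_simps)
    then have "pair_statistic N h y = 1 / N * (1 / N) * ((real N - 1) * (N * m))"
      by (simp add: pair_statistic_def h_def sum_off_diagonal_fst)
    also have "\<dots> = (real N - 1) / N * m" using N by simp
    finally have q: "pair_statistic N h y = (real N - 1) / N * m" .
    have "1 / 2 \<le> (real N - 1) / N" using N by (simp add: field_simps)
    then have "1 / 2 * \<bar>m\<bar> \<le> (real N - 1) / N * \<bar>m\<bar>" by (intro mult_right_mono) auto
    also have "\<dots> = \<bar>pair_statistic N h y\<bar>" unfolding q using N by (simp add: abs_mult)
    finally show ?thesis by (simp add: m_def)
  qed
  have "asymptotically_null M (\<lambda>N. {\<omega> \<in> space M. \<exists>u\<in>{0..t}. e / 2 < \<bar>pair_statistic N h (Y N u \<omega>)\<bar>})"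
    by (rule pair_statistic_vanishes[OF h hB mean t]) (use e in simp_all)
  then show ?thesis
  proof (rule asymptotically_null_except)
    fix N \<omega> assume N: "2 \<le> N" and \<omega>: "\<omega> \<in> space M"
      "\<omega> \<notin> {\<omega> \<in> space M. \<exists>u\<in>{0..t}. e / 2 < \<bar>pair_statistic N h (Y N u \<omega>)\<bar>}"
    have "\<bar>(LINT x|empirical N (Y N u \<omega>). g x) - c\<bar> \<le> e" if "u \<in> {0..t}" for u
    proof -
      have "\<bar>pair_statistic N h (Y N u \<omega>)\<bar> \<le> e / 2" using \<omega> that by (auto simp: not_less)
      moreover have "Y N u \<omega> \<in> space (states N)" using states_Y[OF N] \<omega>(1) that by simp
      ultimately show ?thesis using half[OF N] by fastforce
    qed
    then show "\<not> (\<exists>u\<in>{0..t}. e < \<bar>(LINT x|empirical N (Y N u \<omega>). g x) - (LINT x|\<mu>. g x)\<bar>)"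
      unfolding c_def[symmetric] by (simp add: not_less)
  qed
qed

text \<open>Off a null set on which the total wealth changes, the collision operator is the pair statistic of the
  collision kernel, and this kernel is centred because \<open>\<mu>\<close> is invariant.\<close>

lemma collision_vanishes:
  assumes g: "g \<in> borel_measurable Rplus" "\<And>x. 0 \<le> x \<Longrightarrow> \<bar>g x\<bar> \<le> B" and t: "0 \<le> t" and e: "0 < e"
    and W: "\<And>N. 2 \<le> N \<Longrightarrow> AE \<omega> in M. W N \<omega> = (\<Sum>i<N. Y N 0 \<omega> i)"
  shows "asymptotically_null M (\<lambda>N. {\<omega> \<in> space M. \<exists>u\<in>{0..t}.
    e < \<bar>collision_N N (W N \<omega>) g (empirical N (Y N u \<omega>))\<bar>})"
proof -
  \<comment> \<open>a null set, possibly depending on \<open>N\<close>, where wealth is not conserved\<close>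
  let ?bad = "\<lambda>N. {\<omega> \<in> space M. \<not> (\<forall>u\<ge>0. W N \<omega> = (\<Sum>i<N. Y N u \<omega> i))}"
  have "AE \<omega> in M. 2 \<le> N \<longrightarrow> (\<forall>u\<ge>0. W N \<omega> = (\<Sum>i<N. Y N u \<omega> i))" for N
  proof (cases "2 \<le> N")
    case N: True
    interpret iid_exchange_process M N "Y N" \<mu> using systems[OF N] .
    show ?thesis using W[OF N] wealth_conserved[OF prob_space_axioms process]
    proof eventually_elim
      case (elim \<omega>)
      then show ?case by metis
    qed
  qed simp
  then have "AE \<omega> in M. \<forall>N. 2 \<le> N \<longrightarrow> (\<forall>u\<ge>0. W N \<omega> = (\<Sum>i<N. Y N u \<omega> i))"
    unfolding AE_all_countable by (rule allI)
  then have "AE \<omega> in M. \<forall>N\<ge>2. \<omega> \<notin> ?bad N" by eventually_elim blast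
  then have bad: "asymptotically_null M ?bad" by (rule asymptotically_null_null) blast
  have "asymptotically_null M (\<lambda>N. {\<omega> \<in> space M. \<exists>u\<in>{0..t}. e < \<bar>pair_statistic N (collision_kernel g) (Y N u \<omega>)\<bar>})"
    by (rule pair_statistic_vanishes[OF collision_kernel_measurable[OF g(1)] collision_kernel_bound[OF g(2)]
        collision_kernel_mean_0[OF invariant g] t e])
  from asymptotically_null_Un[OF this bad] show ?thesis
  proof (rule asymptotically_null_except)
    fix N \<omega> assume N: "2 \<le> N" and \<omega>: "\<omega> \<in> space M"
      "\<omega> \<notin> {\<omega> \<in> space M. \<exists>u\<in>{0..t}. e < \<bar>pair_statistic N (collision_kernel g) (Y N u \<omega>)\<bar>} \<union> ?bad N"
    have "\<bar>collision_N N (W N \<omega>) g (empirical N (Y N u \<omega>))\<bar> \<le> e" if u: "u \<in> {0..t}" for u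
    proof -
      have "W N \<omega> = (\<Sum>i<N. Y N u \<omega> i)" using \<omega> u by simp
      then have "collision_N N (W N \<omega>) g (empirical N (Y N u \<omega>)) = pair_statistic N (collision_kernel g) (Y N u \<omega>)"
        using N \<omega>(1) u by (intro collision_N_empirical[OF states_Y[OF N] _ _ g]) simp_all
      then show ?thesis using \<omega> u by (simp add: not_less)
    qed
    then show "\<not> (\<exists>u\<in>{0..t}. e < \<bar>collision_N N (W N \<omega>) g (empirical N (Y N u \<omega>))\<bar>)"
      by (simp add: not_less)
  qed
qed

lemma empirical_mean_tendsto:
  fixes g :: "real \<Rightarrow> real"
  assumes g: "g \<in> borel_measurable Rplus" "\<And>x. 0 \<le> x \<Longrightarrow> \<bar>g x\<bar> \<le> B" and t: "0 \<le> t"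
  shows "tendsto_in_prob M (\<lambda>N \<omega>. SUP s\<in>{0..t}. (LINT x|empirical N (Y N s \<omega>). g x) - (LINT x|\<mu>. g x)) 0"
proof (rule tendsto_in_prob_0I)
  fix e :: real assume "0 < e"
  from empirical_mean_vanishes[OF g t this]
  show "asymptotically_null M (\<lambda>N. {\<omega> \<in> space M.
      e < \<bar>SUP s\<in>{0..t}. (LINT x|empirical N (Y N s \<omega>). g x) - (LINT x|\<mu>. g x)\<bar>})"
    by (rule asymptotically_null_except) (use t in \<open>auto simp: not_less intro!: cSUP_abs_le\<close>)
qed

lemma collision_integral_tendsto:
  assumes g: "g \<in> borel_measurable Rplus" "\<And>x. 0 \<le> x \<Longrightarrow> \<bar>g x\<bar> \<le> B" and t: "0 \<le> t"
    and W: "\<And>N. 2 \<le> N \<Longrightarrow> AE \<omega> in M. W N \<omega> = (\<Sum>i<N. Y N 0 \<omega> i)"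
  shows "tendsto_in_prob M (\<lambda>N \<omega>. LINT s:{0..t}|lborel. collision_N N (W N \<omega>) g (empirical N (Y N s \<omega>))) 0"
proof (rule tendsto_in_prob_0I)
  fix e :: real assume e: "0 < e"
  let ?Q = "\<lambda>N s \<omega>. collision_N N (W N \<omega>) g (empirical N (Y N s \<omega>))"
  \<comment> \<open>\<open>t + 1\<close> instead of \<open>t\<close> to cover \<open>t = 0\<close>\<close>
  define d where "d = e / (t + 1)"
  have d: "0 < d" "t * d \<le> e" using e t by (auto simp: d_def field_simps)
  have "asymptotically_null M (\<lambda>N. {\<omega> \<in> space M. \<exists>u\<in>{0..t}. d < \<bar>?Q N u \<omega>\<bar>})"
    by (rule collision_vanishes[OF g t d(1) W])
  then show "asymptotically_null M (\<lambda>N. {\<omega> \<in> space M. e < \<bar>LINT s:{0..t}|lborel. ?Q N s \<omega>\<bar>})"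
  proof (rule asymptotically_null_except)
    fix N \<omega> assume \<omega>: "\<omega> \<in> space M" "\<omega> \<notin> {\<omega> \<in> space M. \<exists>u\<in>{0..t}. d < \<bar>?Q N u \<omega>\<bar>}"
    then have "\<bar>LINT s:{0..t}|lborel. ?Q N s \<omega>\<bar> \<le> t * d"
      using t d by (intro set_integral_interval_bound) (auto simp: not_less)
    then show "\<not> e < \<bar>LINT s:{0..t}|lborel. ?Q N s \<omega>\<bar>" using d(2) by linarith
  qed
qed

lemma martingale_tendsto:
  assumes g: "g \<in> borel_measurable Rplus" "\<And>x. 0 \<le> x \<Longrightarrow> \<bar>g x\<bar> \<le> B" and t: "0 \<le> t"
    and W: "\<And>N. 2 \<le> N \<Longrightarrow> AE \<omega> in M. W N \<omega> = (\<Sum>i<N. Y N 0 \<omega> i)"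
  shows "tendsto_in_prob M (\<lambda>N \<omega>. SUP s\<in>{0..t}. \<bar>martingale_term N (W N \<omega>) g (\<lambda>t. empirical N (Y N t \<omega>)) s\<bar>) 0"
proof (rule tendsto_in_prob_0I)
  fix e :: real assume e: "0 < e"
  let ?M = "\<lambda>N s \<omega>. martingale_term N (W N \<omega>) g (\<lambda>t. empirical N (Y N t \<omega>)) s"
  let ?mean = "\<lambda>N s \<omega>. LINT x|empirical N (Y N s \<omega>). g x" and ?c = "LINT x|\<mu>. g x"
  let ?Q = "\<lambda>N s \<omega>. collision_N N (W N \<omega>) g (empirical N (Y N s \<omega>))"
  \<comment> \<open>two deviations of the mean and an integral over an interval of length at most \<open>t\<close>\<close>
  define d where "d = e / (t + 2)"
  have "d + d + t * d = (t + 2) * d" by (simp add: algebra_simps)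
  then have d: "0 < d" "d + d + t * d = e" using e t by (simp_all add: d_def)
  let ?bad = "\<lambda>N. {\<omega> \<in> space M. \<exists>u\<in>{0..t}. d < \<bar>?mean N u \<omega> - ?c\<bar>} \<union> {\<omega> \<in> space M. \<exists>u\<in>{0..t}. d < \<bar>?Q N u \<omega>\<bar>}"
  have "asymptotically_null M ?bad"
    by (intro asymptotically_null_Un empirical_mean_vanishes[OF g t d(1)] collision_vanishes[OF g t d(1) W])
  then show "asymptotically_null M (\<lambda>N. {\<omega> \<in> space M. e < \<bar>SUP s\<in>{0..t}. \<bar>?M N s \<omega>\<bar>\<bar>})"
  proof (rule asymptotically_null_except)
    fix N \<omega> assume \<omega>: "\<omega> \<in> space M" "\<omega> \<notin> ?bad N"
    then have mean: "\<bar>?mean N u \<omega> - ?c\<bar> \<le> d" and Q: "\<bar>?Q N u \<omega>\<bar> \<le> d" if "u \<in> {0..t}" for u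
      using that by (auto simp: not_less)
    have "\<bar>SUP s\<in>{0..t}. \<bar>?M N s \<omega>\<bar>\<bar> \<le> e"
    proof (rule cSUP_abs_le)
      fix s assume s: "s \<in> {0..t}"
      have "\<bar>LINT u:{0..s}|lborel. ?Q N u \<omega>\<bar> \<le> s * d"
        using s Q d by (intro set_integral_interval_bound) auto
      also have "\<dots> \<le> t * d" using s d by (intro mult_right_mono) auto
      finally show "\<bar>\<bar>?M N s \<omega>\<bar>\<bar> \<le> e"
        using mean[OF s] mean[of 0] t d(2) unfolding martingale_term_def by auto
    qed (use t in simp)
    then show "\<not> e < \<bar>SUP s\<in>{0..t}. \<bar>?M N s \<omega>\<bar>\<bar>" by linarith
  qed
qed

text \<open>The uniform convergence of empirical means holds for measurable \<open>g\<close>; apply it to the indicators of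
  finitely many bins.\<close>

lemma skorokhod_tendsto:
  "skorokhod_tendsto_in_prob M (\<lambda>N \<omega> t. empirical N (Y N t \<omega>)) (\<lambda>_. \<mu>)"
  unfolding skorokhod_tendsto_in_prob_def
proof (intro conjI allI impI)
  show "(\<lambda>_. \<mu>) \<in> skorokhod_space" by (rule const_in_skorokhod_space[OF \<mu>_prob])
  show "\<forall>\<^sub>F N in sequentially. \<forall>\<omega>\<in>space M. (\<lambda>t. empirical N (Y N t \<omega>)) \<in> skorokhod_space"
    using eventually_ge_at_top[of 2]
    by eventually_elim
      (use iid_exchange_process.process[OF systems] in \<open>auto intro!: empirical_path_in_skorokhod_space\<close>)
  fix e :: real assume e: "0 < e"
  have "((\<lambda>T. exp (- T)) \<longlongrightarrow> (0::real)) at_top"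
    by (rule filterlim_compose[OF exp_at_bot filterlim_uminus_at_bot_at_top])
  then have "\<forall>\<^sub>F T in at_top. exp (- T) < e / 2" using e by (intro order_tendstoD(2)[where y=0]) auto
  then obtain T where T: "0 \<le> T" "exp (- T) < e / 2"
    unfolding eventually_at_top_linorder by (metis linear max.cobounded1 max.cobounded2)
  have e2: "0 < e / 2" using e by simp
  obtain \<A> \<eta> where \<A>: "finite \<A>" "\<A> \<subseteq> sets Rplus" "0 < \<eta>"
    and bins: "\<And>\<nu>. \<nu> \<in> prob_measures \<Longrightarrow> (\<And>A. A \<in> \<A> \<Longrightarrow> \<bar>measure \<nu> A - measure \<mu> A\<bar> \<le> \<eta>)
      \<Longrightarrow> prokhorov_dist \<nu> \<mu> \<le> e / 2"
    by (rule prokhorov_dist_bins[OF \<mu>_prob e2]) blast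
  let ?bad = "\<lambda>A N. {\<omega> \<in> space M. \<exists>u\<in>{0..T}.
    \<eta> < \<bar>(LINT x|empirical N (Y N u \<omega>). indicator A x) - (LINT x|\<mu>. indicator A x)\<bar>}"
  have "asymptotically_null M (\<lambda>N. \<Union>A\<in>\<A>. ?bad A N)"
    using \<A> T by (intro asymptotically_null_finite_UN empirical_mean_vanishes[where B=1])
      (auto simp: indicator_def)
  then have "asymptotically_null M (\<lambda>N. {\<omega> \<in> space M. e < skorokhod_dist (\<lambda>t. empirical N (Y N t \<omega>)) (\<lambda>_. \<mu>)})"
  proof (rule asymptotically_null_except)
    fix N \<omega> assume N: "2 \<le> N" and \<omega>: "\<omega> \<in> space M" "\<omega> \<notin> (\<Union>A\<in>\<A>. ?bad A N)"
    have "prokhorov_dist (empirical N (Y N u \<omega>)) \<mu> \<le> e / 2" if u: "u \<in> {0..T}" for u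
    proof (rule bins)
      have st: "Y N u \<omega> \<in> space (states N)" using states_Y[OF N] u \<omega>(1) by simp
      show "empirical N (Y N u \<omega>) \<in> prob_measures"
        using N by (intro empirical_prob_measure statesD[OF st]) auto
      then have s: "sets (empirical N (Y N u \<omega>)) = sets Rplus" by (rule prob_measures_D)
      fix A assume A: "A \<in> \<A>"
      then have "A \<in> sets Rplus" using \<A>(2) by blast
      then have "A \<inter> space (empirical N (Y N u \<omega>)) = A" "A \<inter> space \<mu> = A"
        using s sets.sets_into_space prob_measures_D(2)[OF \<mu>_prob] by blast+
      moreover have "\<bar>(LINT x|empirical N (Y N u \<omega>). indicator A x) - (LINT x|\<mu>. indicator A x)\<bar> \<le> \<eta>"
        using \<omega> A u by (force simp: not_less)
      ultimately show "\<bar>measure (empirical N (Y N u \<omega>)) A - measure \<mu> A\<bar> \<le> \<eta>" by simp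
    qed
    then have "skorokhod_dist (\<lambda>t. empirical N (Y N t \<omega>)) (\<lambda>_. \<mu>) \<le> e / 2 + exp (- T)"
      using e T by (intro skorokhod_dist_const_le) auto
    then show "\<not> e < skorokhod_dist (\<lambda>t. empirical N (Y N t \<omega>)) (\<lambda>_. \<mu>)" using T(2) by linarith
  qed
  then show "(\<lambda>N. outer_measure_of M {\<omega> \<in> space M. e < skorokhod_dist (\<lambda>t. empirical N (Y N t \<omega>)) (\<lambda>_. \<mu>)}) \<longlonglongrightarrow> 0"
    by (rule asymptotically_null_outer_measure)
qed

end

section \<open>Limits of empirical measures\<close>

text \<open>The strong law of large numbers for indicators: the deviation probabilities of Hoeffding's inequality
  are summable.\<close>

lemma (in prob_space) frequencies_converge:
  fixes X :: "nat \<Rightarrow> 'a \<Rightarrow> real"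
  assumes indep: "indep_vars (\<lambda>_. borel) X UNIV" and law: "\<And>i. distr M borel (X i) = L"
    and A: "A \<in> sets borel"
  shows "AE \<omega> in M. (\<lambda>n. (\<Sum>i<n. indicator A (X i \<omega>)) / n) \<longlonglongrightarrow> measure L A"
proof -
  let ?Z = "\<lambda>i \<omega>. indicator A (X i \<omega>) :: real"
  have X[measurable]: "X i \<in> borel_measurable M" for i using indep by (simp add: indep_vars_def)
  note A[measurable]
  have Z: "?Z i \<in> borel_measurable M" for i by measurable
  have indepZ: "indep_vars (\<lambda>_. borel) ?Z I" for I
    by (rule indep_vars_compose2[OF indep_vars_subset[OF indep]]) auto
  have mean: "expectation (?Z i) = measure L A" for i
  proof -
    have "(LINT x|L. indicator A x) = expectation (?Z i)"
      unfolding law[of i, symmetric] by (rule integral_distr) auto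
    moreover have "A \<inter> space L = A" unfolding law[of 0, symmetric] by simp
    ultimately show ?thesis by simp
  qed
  have lawZ: "distr M borel (?Z i) = distr M borel (?Z 0)" for i
  proof -
    have "distr M borel (?Z i) = distr (distr M borel (X i)) borel (indicator A)" for i
      by (subst distr_distr) (auto simp: comp_def)
    then show ?thesis unfolding law by simp
  qed
  let ?dev = "\<lambda>n \<omega>. (\<Sum>i<n. ?Z i \<omega>) / real n - measure L A"
  have hoeffding: "prob {\<omega> \<in> space M. e \<le> \<bar>?dev n \<omega>\<bar>} \<le> 2 * exp (-2 * e\<^sup>2) ^ n"
    if e: "0 < e" and n: "0 < n" for e n
  proof -
    interpret H: Hoeffding_ineq_iid M "{..<n}" ?Z "?Z 0" 0 1 "expectation (?Z 0)"
      using indepZ lawZ Z by unfold_locales (auto simp: indicator_def)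
    have "prob {\<omega> \<in> space M. e \<le> \<bar>?dev n \<omega>\<bar>} \<le> 2 * exp (-2 * real n * e\<^sup>2)"
      using H.Hoeffding_ineq_abs_ge'[of e] e n unfolding mean by (simp add: lessThan_empty_iff)
    also have "-2 * real n * e\<^sup>2 = real n * (-2 * e\<^sup>2)" by simp
    finally show ?thesis unfolding exp_of_nat_mult .
  qed
  have close: "AE \<omega> in M. \<forall>\<^sub>F n in sequentially. \<omega> \<in> space M - {\<omega> \<in> space M. e \<le> \<bar>?dev n \<omega>\<bar>}"
    if e: "0 < e" for e
  proof (rule borel_cantelli_AE1)
    show "{\<omega> \<in> space M. e \<le> \<bar>?dev n \<omega>\<bar>} \<in> events" for n by measurable
    have "summable (\<lambda>n. 2 * exp (-2 * e\<^sup>2) ^ n)"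
      using e by (intro summable_mult summable_geometric) simp
    then show "summable (\<lambda>n. prob {\<omega> \<in> space M. e \<le> \<bar>?dev n \<omega>\<bar>})"
      by (rule summable_comparison_test'[where N=1]) (use hoeffding[OF e] in simp)
  qed (simp add: emeasure_eq_measure)
  have "AE \<omega> in M. \<forall>k :: nat. \<forall>\<^sub>F n in sequentially. \<omega> \<in> space M - {\<omega> \<in> space M. 1 / Suc k \<le> \<bar>?dev n \<omega>\<bar>}"
    unfolding AE_all_countable by (intro allI close) simp
  then show ?thesis
  proof (rule AE_mp, intro AE_I2 impI)
    fix \<omega> assume \<omega>: "\<omega> \<in> space M"
      and ev: "\<forall>k :: nat. \<forall>\<^sub>F n in sequentially. \<omega> \<in> space M - {\<omega> \<in> space M. 1 / Suc k \<le> \<bar>?dev n \<omega>\<bar>}"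
    show "(\<lambda>n. (\<Sum>i<n. indicator A (X i \<omega>)) / n) \<longlonglongrightarrow> measure L A"
    proof (rule tendstoI)
      fix e :: real assume "0 < e"
      then obtain k where k: "1 / real (Suc k) < e" using nat_approx_posE by blast
      show "\<forall>\<^sub>F n in sequentially. dist ((\<Sum>i<n. indicator A (X i \<omega>)) / real n) (measure L A) < e"
        using ev[rule_format, of k]
        by eventually_elim (use k \<omega> in \<open>auto simp: dist_real_def not_le\<close>)
    qed
  qed
qed

lemma empirical_distr_integral:
  fixes f :: "real \<Rightarrow> real" and N :: nat
  assumes "f \<in> borel_measurable borel"
  shows "(LINT y|distr (uniform_count_measure {..<N}) borel x. f y) = 1 / N * (\<Sum>i<N. f (x i))"
proof -
  have x: "x \<in> measurable (uniform_count_measure {..<N}) borel"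
    by (auto simp: measurable_def space_uniform_count_measure sets_uniform_count_measure)
  have "(LINT y|distr (uniform_count_measure {..<N}) borel x. f y) = (LINT i|uniform_count_measure {..<N}. f (x i))"
    by (rule integral_distr[OF x assms])
  also have "\<dots> = (\<Sum>i<N. 1 / N * f (x i))"
    unfolding uniform_count_measure_def
    by (subst lebesgue_integral_point_measure_finite) (auto simp: sum_divide_distrib)
  finally show ?thesis by (simp add: sum_distrib_left)
qed

lemma empirical_real_distribution:
  "0 < N \<Longrightarrow> real_distribution (distr (uniform_count_measure {..<N}) borel (x :: nat \<Rightarrow> real))"
  unfolding real_distribution_def real_distribution_axioms_def
  by (auto intro!: prob_space.prob_space_distr prob_space_uniform_count_measure
      simp: measurable_def space_uniform_count_measure sets_uniform_count_measure)

text \<open>Squeeze between two rational points near a continuity point.\<close>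

lemma weak_conv_from_rationals:
  assumes mono: "\<And>n. mono (F n :: real \<Rightarrow> real)"
    and rat: "\<And>q. q \<in> \<rat> \<Longrightarrow> (\<lambda>n. F n q) \<longlonglongrightarrow> G q"
  shows "weak_conv F G"
  unfolding weak_conv_def
proof (intro allI impI tendstoI)
  fix x e :: real assume cont: "isCont G x" and e: "0 < e"
  then obtain d where d: "0 < d" "\<And>y. dist y x < d \<Longrightarrow> dist (G y) (G x) < e / 2"
    unfolding continuous_at_eps_delta by (metis half_gt_zero)
  obtain q where q: "q \<in> \<rat>" "x - d < q" "q < x" using Rats_dense_in_real[of "x - d" x] d by auto
  obtain r where r: "r \<in> \<rat>" "x < r" "r < x + d" using Rats_dense_in_real[of x "x + d"] d by auto
  have close: "dist (G q) (G x) < e / 2" "dist (G r) (G x) < e / 2"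
    using q r d(2)[of q] d(2)[of r] by (simp_all add: dist_real_def)
  have e2: "0 < e / 2" using e by simp
  show "\<forall>\<^sub>F n in sequentially. dist (F n x) (G x) < e"
    using tendstoD[OF rat[OF q(1)] e2] tendstoD[OF rat[OF r(1)] e2]
  proof eventually_elim
    case (elim n)
    have "F n q \<le> F n x" "F n x \<le> F n r" using q r by (auto intro!: monoD[OF mono])
    then show ?case using elim close unfolding dist_real_def by linarith
  qed
qed

lemma (in prob_space) empirical_weak_conv:
  fixes X :: "nat \<Rightarrow> 'a \<Rightarrow> real"
  assumes indep: "indep_vars (\<lambda>_. borel) X UNIV" and law: "\<And>i. distr M borel (X i) = L"
  shows "AE \<omega> in M. weak_conv_m (\<lambda>n. distr (uniform_count_measure {..<Suc n}) borel (\<lambda>i. X i \<omega>)) L"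
proof -
  have "AE \<omega> in M. \<forall>q\<in>\<rat>. (\<lambda>n. (\<Sum>i<n. indicator {..q} (X i \<omega>)) / n) \<longlonglongrightarrow> measure L {..q}"
    unfolding AE_ball_countable[OF countable_rat] by (intro ballI frequencies_converge[OF indep law]) auto
  then show ?thesis
  proof (rule AE_mp, intro AE_I2 impI)
    fix \<omega> assume rat: "\<forall>q\<in>\<rat>. (\<lambda>n. (\<Sum>i<n. indicator {..q} (X i \<omega>)) / n) \<longlonglongrightarrow> measure L {..q}"
    let ?E = "\<lambda>n. distr (uniform_count_measure {..<Suc n}) borel (\<lambda>i. X i \<omega>)"
    show "weak_conv_m ?E L" unfolding weak_conv_m_def
    proof (rule weak_conv_from_rationals)
      show "mono (cdf (?E n))" for n
      proof -
        interpret E: real_distribution "?E n" by (rule empirical_real_distribution) simp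
        show ?thesis by (rule monoI) (rule E.cdf_nondecreasing)
      qed
      fix q :: real assume "q \<in> \<rat>"
      then have "(\<lambda>n. (\<Sum>i<Suc n. indicator {..q} (X i \<omega>)) / real (Suc n)) \<longlonglongrightarrow> cdf L q"
        unfolding cdf_def using rat by (intro LIMSEQ_Suc) blast
      moreover have "cdf (?E n) q = (\<Sum>i<Suc n. indicator {..q} (X i \<omega>)) / real (Suc n)" for n
        using empirical_distr_integral[of "indicator {..q}" "Suc n" "\<lambda>i. X i \<omega>"] by (simp add: cdf_def)
      ultimately show "(\<lambda>n. cdf (?E n) q) \<longlonglongrightarrow> cdf L q" by simp
    qed
  qed
qed

text \<open>Distribution functions belong to measures on the real line, so the measures are transported there, and a
  test function \<open>g\<close> on the half-line is extended by \<open>g (max 0 x)\<close>.\<close>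

lemma (in prob_space) empirical_limitin:
  fixes X :: "nat \<Rightarrow> 'a \<Rightarrow> real"
  assumes indep: "indep_vars (\<lambda>_. borel) X UNIV" and law: "\<And>i. distr M Rplus (X i) = \<mu>"
    and pos: "\<And>i \<omega>. 0 \<le> X i \<omega>"
  shows "AE \<omega> in M. limitin weak_topology (\<lambda>N. empirical N (\<lambda>i. X i \<omega>)) \<mu> sequentially"
proof -
  have Xb: "X i \<in> borel_measurable M" for i using indep by (simp add: indep_vars_def)
  have XR: "X i \<in> measurable M Rplus" for i by (rule measurable_into_Rplus[OF Xb pos])
  have \<mu>: "\<mu> \<in> prob_measures"
    unfolding prob_measures_def law[of 0, symmetric] by (simp add: prob_space_distr[OF XR])
  define L where "L = distr \<mu> borel (\<lambda>x. x)"
  have L: "distr M borel (X i) = L" for i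
    unfolding L_def law[of i, symmetric] by (subst distr_distr[OF measurable_Rplus_id XR]) (simp add: comp_def)
  have rdL: "real_distribution L"
    unfolding L[of 0, symmetric] real_distribution_def real_distribution_axioms_def
    by (simp add: prob_space_distr[OF Xb])
  from empirical_weak_conv[OF indep L] show ?thesis
  proof (rule AE_mp, intro AE_I2 impI)
    fix \<omega> assume wc: "weak_conv_m (\<lambda>n. distr (uniform_count_measure {..<Suc n}) borel (\<lambda>i. X i \<omega>)) L"
    show "limitin weak_topology (\<lambda>N. empirical N (\<lambda>i. X i \<omega>)) \<mu> sequentially"
    proof (rule limitin_weak_topologyI[OF \<mu>])
      show "\<forall>\<^sub>F N in sequentially. empirical N (\<lambda>i. X i \<omega>) \<in> prob_measures"
        using eventually_gt_at_top[of 0]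
        by eventually_elim (auto intro!: empirical_prob_measure pos)
      fix g assume g: "g \<in> C_b"
      obtain B where B: "\<And>x. 0 \<le> x \<Longrightarrow> \<bar>g x\<bar> \<le> B" using C_b_bounded[OF g] by blast
      let ?f = "\<lambda>x. g (max 0 x)"
      have cont: "continuous_on UNIV ?f"
      proof (rule continuous_on_compose2[of "{0..}" g])
        show "continuous_on {0..} g" using g by (simp add: C_b_def)
      qed (auto intro!: continuous_intros)
      have f: "?f \<in> borel_measurable borel" using cont by (rule borel_measurable_continuous_onI)
      have "(\<lambda>n. LINT y|distr (uniform_count_measure {..<Suc n}) borel (\<lambda>i. X i \<omega>). ?f y) \<longlonglongrightarrow> (LINT y|L. ?f y)"
      proof (rule weak_conv_imp_integral_bdd_continuous_conv[OF _ rdL wc])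
        show "isCont ?f x" for x using cont by (simp add: continuous_on_eq_continuous_at)
        show "norm (?f x) \<le> B" for x using B by simp
      qed (rule empirical_real_distribution, simp)
      moreover have "(LINT y|distr (uniform_count_measure {..<Suc n}) borel (\<lambda>i. X i \<omega>). ?f y)
          = (LINT y|empirical (Suc n) (\<lambda>i. X i \<omega>). g y)" for n
        unfolding empirical_distr_integral[OF f]
        by (subst empirical_integral) (auto simp: pos C_b_measurable[OF g] max_def)
      moreover have "(LINT y|L. ?f y) = (LINT y|\<mu>. g y)"
      proof -
        have "(LINT y|L. ?f y) = (LINT \<omega>|M. ?f (X 0 \<omega>))"
          unfolding L[of 0, symmetric] by (rule integral_distr[OF Xb f])
        also have "\<dots> = (LINT \<omega>|M. g (X 0 \<omega>))" by (simp add: pos max_def)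
        also have "\<dots> = (LINT y|\<mu>. g y)"
          unfolding law[of 0, symmetric] by (rule integral_distr[OF XR C_b_measurable[OF g], symmetric])
        finally show ?thesis .
      qed
      ultimately have "(\<lambda>n. LINT y|empirical (Suc n) (\<lambda>i. X i \<omega>). g y) \<longlonglongrightarrow> (LINT y|\<mu>. g y)" by simp
      then show "(\<lambda>n. LINT y|empirical n (\<lambda>i. X i \<omega>). g y) \<longlonglongrightarrow> (LINT y|\<mu>. g y)"
        by (rule LIMSEQ_imp_Suc)
    qed
  qed
qed

text \<open>The test function \<open>min x 1\<close> has mean at most \<open>W N / N\<close>, which tends to 0.\<close>

lemma empirical_bounded_wealth_limit:
  assumes W: "W \<longlonglongrightarrow> (w0 :: real)" and \<nu>: "\<And>N. 2 \<le> N \<Longrightarrow> is_empirical_measure N (W N) (\<nu> N)"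
    and lim: "limitin weak_topology \<nu> \<mu> sequentially"
  shows "AE x in \<mu>. x = 0"
proof -
  have \<mu>: "\<mu> \<in> prob_measures" using limitin_topspace[OF lim] by (simp add: topspace_weak_topology)
  interpret \<mu>: prob_space \<mu> by (rule prob_measures_D[OF \<mu>])
  have sp: "space \<mu> = {0..}" by (rule prob_measures_D[OF \<mu>])
  let ?g = "\<lambda>x :: real. min x 1"
  have g: "?g \<in> C_b"
  proof -
    have "continuous_on {0..} ?g" by (intro continuous_intros)
    moreover have "bounded (?g ` {0..})" by (rule boundedI[of _ 1]) auto
    ultimately show ?thesis by (simp add: C_b_def)
  qed
  have up: "(LINT x|\<nu> N. ?g x) \<le> W N / N" if N: "2 \<le> N" for N
  proof -
    obtain x where x: "\<And>i. i < N \<Longrightarrow> 0 \<le> x i" "(\<Sum>i<N. x i) = W N" "\<nu> N = empirical N x"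
      using \<nu>[OF N] by (auto simp: is_empirical_measure_def)
    have "(LINT y|\<nu> N. ?g y) = 1 / N * (\<Sum>i<N. ?g (x i))"
      unfolding x(3) by (rule empirical_integral[OF x(1) C_b_measurable[OF g]])
    also have "\<dots> \<le> 1 / N * (\<Sum>i<N. x i)" by (intro mult_left_mono sum_mono) auto
    finally show ?thesis using x(2) by simp
  qed
  have "(\<lambda>N. W N * (1 / real N)) \<longlonglongrightarrow> w0 * 0" by (intro tendsto_mult W lim_1_over_n)
  then have "(\<lambda>N. W N / N) \<longlonglongrightarrow> 0" by simp
  then have "(LINT x|\<mu>. ?g x) \<le> 0"
  proof (rule LIMSEQ_le[OF limitin_weak_topologyD[OF lim g]])
    show "\<exists>N. \<forall>n\<ge>N. (LINT x|\<nu> n. ?g x) \<le> W n / n" using up by blast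
  qed
  have nonneg: "AE x in \<mu>. 0 \<le> ?g x" using sp by (intro AE_I2) auto
  have int: "integrable \<mu> ?g"
  proof (rule \<mu>.integrable_const_bound[of _ 1])
    show "?g \<in> borel_measurable \<mu>"
      using C_b_measurable[OF g] measurable_cong_sets[OF prob_measures_D(2)[OF \<mu>] refl] by blast
  qed (use sp in \<open>auto intro!: AE_I2\<close>)
  have "(LINT x|\<mu>. ?g x) = 0"
    using \<open>(LINT x|\<mu>. ?g x) \<le> 0\<close> integral_nonneg_AE[OF nonneg] by (rule antisym)
  then have "AE x in \<mu>. ?g x = 0" using integral_nonneg_eq_0_iff_AE[OF int nonneg] by simp
  then show ?thesis by eventually_elim (auto simp: min_def split: if_splits)
qed

lemma no_empirical_limit_with_density:
  assumes W: "W \<longlonglongrightarrow> (w0 :: real)" and \<nu>: "\<And>N. 2 \<le> N \<Longrightarrow> is_empirical_measure N (W N) (\<nu> N)"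
    and f: "f \<in> borel_measurable (restrict_space lborel {0..})"
  shows "\<not> limitin weak_topology \<nu> (density (restrict_space lborel {0..}) f) sequentially"
proof
  let ?\<mu> = "density (restrict_space lborel {0..}) f"
  assume lim: "limitin weak_topology \<nu> ?\<mu> sequentially"
  then have "?\<mu> \<in> prob_measures" using limitin_topspace by (force simp: topspace_weak_topology)
  then interpret \<mu>: prob_space ?\<mu> by (rule prob_measures_D)
  have "AE x in lborel. x \<noteq> (0 :: real)" by (rule AE_lborel_singleton)
  then have "AE x in restrict_space lborel {0..}. x \<noteq> (0 :: real)"
    by (subst AE_restrict_space_iff) (auto elim: eventually_mono)
  then have "AE x in ?\<mu>. x \<noteq> 0" using f by (subst AE_density) (auto elim: eventually_mono)
  moreover have "AE x in ?\<mu>. x = 0" by (rule empirical_bounded_wealth_limit[OF W \<nu> lim])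
  ultimately have "AE x in ?\<mu>. False" by eventually_elim simp
  then show False by simp
qed

section \<open>Exponential initial wealths\<close>

text \<open>Exponential variables are only almost surely nonnegative; their positive parts take values in the half-line
  everywhere and have the same law.\<close>

lemma exponential_clamped_law:
  assumes m: "0 < m" and X: "distributed M lborel X (exponential_density (1 / m))"
  shows "distr M Rplus (\<lambda>\<omega>. max 0 (X \<omega>)) = exponential_law m"
proof (rule measure_eqI)
  fix A assume "A \<in> sets (distr M Rplus (\<lambda>\<omega>. max 0 (X \<omega>)))"
  then have A: "A \<in> sets Rplus" by simp
  have Xm: "X \<in> borel_measurable M" using X by (simp add: distributed_def)
  have cX: "(\<lambda>\<omega>. max 0 (X \<omega>)) \<in> measurable M Rplus" by (rule measurable_compose[OF Xm clamp_measurable])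
  have i: "(\<lambda>x. indicator A (max 0 x) :: ennreal) \<in> borel_measurable lborel"
    using measurable_compose[OF clamp_measurable borel_measurable_indicator[OF A]] by simp
  have "emeasure (distr M Rplus (\<lambda>\<omega>. max 0 (X \<omega>))) A = (\<integral>\<^sup>+x. indicator A x \<partial>distr M Rplus (\<lambda>\<omega>. max 0 (X \<omega>)))"
    using A by simp
  also have "\<dots> = (\<integral>\<^sup>+\<omega>. indicator A (max 0 (X \<omega>)) \<partial>M)" by (rule nn_integral_distr[OF cX]) (use A in simp)
  also have "\<dots> = (\<integral>\<^sup>+x. ennreal (exponential_density (1 / m) x) * indicator A (max 0 x) \<partial>lborel)"
    by (rule distributed_nn_integral[OF X i, symmetric])
  also have "\<dots> = (\<integral>\<^sup>+x. indicator A x \<partial>exponential_law m)"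
    by (rule exponential_nn_integral[OF m, symmetric]) (use A in simp)
  also have "\<dots> = emeasure (exponential_law m) A" using A sets_exponential_law by simp
  finally show "emeasure (distr M Rplus (\<lambda>\<omega>. max 0 (X \<omega>))) A = emeasure (exponential_law m) A" .
qed (simp add: sets_exponential_law)

lemma exponential_AE_nonneg:
  assumes "distributed M lborel X (exponential_density (1 / m))"
  shows "AE \<omega> in M. 0 \<le> X \<omega>"
proof (rule AE_distrD[OF distributed_measurable[OF assms]])
  have "AE x in density lborel (exponential_density (1 / m)). 0 \<le> x"
    by (subst AE_density) (auto simp: exponential_density_def intro!: AE_I2)
  then show "AE x in distr M lborel X. 0 \<le> x"
    unfolding distributed_distr_eq_density[OF assms] .
qed

lemma (in prob_space) indep_vars_cong_AE:
  assumes "indep_vars M' X I" "I \<noteq> {}" "countable I" and Y: "\<And>i. i \<in> I \<Longrightarrow> Y i \<in> measurable M (M' i)"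
    and eq: "AE \<omega> in M. \<forall>i\<in>I. Y i \<omega> = X i \<omega>"
  shows "indep_vars M' Y I"
proof -
  have X: "X i \<in> measurable M (M' i)" if "i \<in> I" for i using assms(1) that by (simp add: indep_vars_def)
  have "distr M (PiM I M') (\<lambda>\<omega>. \<lambda>i\<in>I. Y i \<omega>) = distr M (PiM I M') (\<lambda>\<omega>. \<lambda>i\<in>I. X i \<omega>)"
    by (rule distr_cong_AE) (use eq X Y in \<open>auto intro!: measurable_restrict elim!: eventually_mono\<close>)
  also have "\<dots> = PiM I (\<lambda>i. distr M (M' i) (X i))"
    using indep_vars_iff_distr_eq_PiM'[OF assms(2) X] assms(1) by simp
  also have "\<dots> = PiM I (\<lambda>i. distr M (M' i) (Y i))"
    by (intro PiM_cong refl distr_cong_AE) (use eq X Y in \<open>auto elim!: eventually_mono\<close>)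
  finally show ?thesis using indep_vars_iff_distr_eq_PiM'[OF assms(2) Y] by simp
qed

lemma exponential_exchange_sequence:
  assumes M: "prob_space M" and m: "0 < m" and indep: "prob_space.indep_vars M (\<lambda>_. borel) X UNIV"
    and law: "\<And>i. distributed M lborel (X i) (exponential_density (1 / m))"
    and Y: "\<And>N. 2 \<le> N \<Longrightarrow> wealth_exchange_process M N (Y N)"
    and initial: "\<And>N. 2 \<le> N \<Longrightarrow> AE \<omega> in M. \<forall>i<N. Y N 0 \<omega> i = X i \<omega>"
  shows "exchange_sequence M Y (exponential_law m)"
proof -
  interpret prob_space M by fact
  show ?thesis
  proof (intro exchange_sequence.intro exchange_sequence_axioms.intro M)
    fix N :: nat assume N: "2 \<le> N"
    let ?X = "\<lambda>i \<omega>. max 0 (X i \<omega>)"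
    have Y0: "Y N 0 \<in> measurable M (states N)"
      using Y[OF N] by (simp add: wealth_exchange_process_def markov_jump_process_def)
    have Ym: "(\<lambda>\<omega>. Y N 0 \<omega> i) \<in> measurable M Rplus" if "i \<in> {..<N}" for i
      by (rule measurable_compose[OF Y0 measurable_component_singleton[OF that]])
    have "AE \<omega> in M. \<forall>i. 0 \<le> X i \<omega>"
      unfolding AE_all_countable using exponential_AE_nonneg[OF law] by blast
    with initial[OF N] have eq: "AE \<omega> in M. \<forall>i\<in>{..<N}. Y N 0 \<omega> i = ?X i \<omega>"
      by eventually_elim (auto simp: max_def)
    have indepX: "indep_vars (\<lambda>_. Rplus) ?X UNIV"
      by (rule indep_vars_compose2[OF indep]) (rule clamp_measurable)
    show "iid_exchange_process M N (Y N) (exponential_law m)"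
    proof (unfold_locales)
      show "indep_vars (\<lambda>_. Rplus) (\<lambda>i \<omega>. Y N 0 \<omega> i) {..<N}"
        by (rule indep_vars_cong_AE[OF indep_vars_subset[OF indepX] _ _ Ym eq])
          (use N in \<open>auto simp: lessThan_empty_iff\<close>)
      fix i assume i: "i < N"
      have "distr M Rplus (\<lambda>\<omega>. Y N 0 \<omega> i) = distr M Rplus (?X i)"
      proof (rule distr_cong_AE)
        show "AE \<omega> in M. Y N 0 \<omega> i = ?X i \<omega>" using eq by eventually_elim (use i in auto)
        show "?X i \<in> measurable M Rplus" using indepX by (simp add: indep_vars_def)
      qed (use Ym i in auto)
      then show "distr M Rplus (\<lambda>\<omega>. Y N 0 \<omega> i) = exponential_law m"
        using exponential_clamped_law[OF m law] by simp
    qed (use N Y exponential_exchange_invariant[OF m] in auto)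
  qed
qed

text \<open>The total wealth is at least the number of agents whose wealth exceeds 1, which grows linearly in \<open>N\<close>.\<close>

lemma exponential_total_wealth_at_top:
  assumes M: "prob_space M" and m: "0 < m" and indep: "prob_space.indep_vars M (\<lambda>_. borel) X UNIV"
    and law: "\<And>i. distributed M lborel (X i) (exponential_density (1 / m))"
  shows "AE \<omega> in M. filterlim (\<lambda>N. \<Sum>i<N. X i \<omega>) at_top sequentially"
proof -
  interpret prob_space M by fact
  have Xm: "X i \<in> borel_measurable M" for i using indep by (simp add: indep_vars_def)
  define L where "L = distr M borel (X 0)"
  have L: "distr M borel (X i) = L" for i
  proof -
    have "distr M lborel (X i) = distr M lborel (X 0)" using law[of i] law[of 0] by (simp add: distributed_def)
    moreover have "distr M lborel (X i) = distr M borel (X i)" for i by (rule distr_cong) auto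
    ultimately show ?thesis by (simp add: L_def)
  qed
  have "measure L {1<..} = prob {\<omega> \<in> space M. 1 < X 0 \<omega>}"
    unfolding L_def by (subst measure_distr[OF Xm]) (auto intro!: arg_cong[where f=prob])
  also have "\<dots> = exp (- 1 * (1 / m))" by (rule exponential_distributedD_gt[OF law]) (use m in auto)
  finally have p: "0 < measure L {1<..}" by simp
  have nonneg: "AE \<omega> in M. \<forall>i. 0 \<le> X i \<omega>"
    unfolding AE_all_countable using exponential_AE_nonneg[OF law] by blast
  have freq: "AE \<omega> in M. (\<lambda>n. (\<Sum>i<n. indicator {1<..} (X i \<omega>)) / n) \<longlonglongrightarrow> measure L {1<..}"
    by (rule frequencies_converge[OF indep L]) simp
  from freq nonneg show ?thesis
  proof eventually_elim
    case (elim \<omega>)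
    let ?f = "\<lambda>n. (\<Sum>i<n. indicator {1<..} (X i \<omega>)) / real n"
    have lim: "filterlim (\<lambda>n. ?f n * real n) at_top sequentially"
      by (rule filterlim_tendsto_pos_mult_at_top[OF elim(1) p filterlim_real_sequentially])
    show ?case
    proof (rule filterlim_at_top_mono[OF lim], rule always_eventually, rule allI)
      fix n
      have "?f n * real n = (\<Sum>i<n. indicator {1<..} (X i \<omega>))" by (cases "n = 0") auto
      also have "\<dots> \<le> (\<Sum>i<n. X i \<omega>)"
        using elim(2) by (intro sum_mono) (auto simp: indicator_def)
      finally show "?f n * real n \<le> (\<Sum>i<n. X i \<omega>)" .
    qed
  qed
qed

lemma exponential_empirical_limitin:
  assumes M: "prob_space M" and m: "0 < m" and indep: "prob_space.indep_vars M (\<lambda>_. borel) X UNIV"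
    and law: "\<And>i. distributed M lborel (X i) (exponential_density (1 / m))"
  shows "AE \<omega> in M. limitin weak_topology (\<lambda>N. empirical N (\<lambda>i. X i \<omega>)) (exponential_law m) sequentially"
proof -
  interpret prob_space M by fact
  have indep': "indep_vars (\<lambda>_. borel) (\<lambda>i \<omega>. max 0 (X i \<omega>)) UNIV"
    by (rule indep_vars_compose2[OF indep]) auto
  have "AE \<omega> in M. limitin weak_topology (\<lambda>N. empirical N (\<lambda>i. max 0 (X i \<omega>))) (exponential_law m) sequentially"
    by (rule empirical_limitin[OF indep' exponential_clamped_law[OF m law]]) simp
  moreover have "AE \<omega> in M. \<forall>i. 0 \<le> X i \<omega>"
    unfolding AE_all_countable using exponential_AE_nonneg[OF law] by blast
  ultimately show ?thesis
  proof eventually_elim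
    case (elim \<omega>)
    then have "(\<lambda>i. max 0 (X i \<omega>)) = (\<lambda>i. X i \<omega>)" by (auto simp: max_def)
    then show ?case using elim(1) by simp
  qed
qed

lemma exponential_mean_field_limit:
  fixes M :: "'w measure"
  assumes M: "prob_space M" and m: "0 < m" and indep: "prob_space.indep_vars M (\<lambda>_. borel) X UNIV"
    and law: "\<And>i. distributed M lborel (X i) (exponential_density (1 / m))"
    and Y: "\<And>N. 2 \<le> N \<Longrightarrow> wealth_exchange_process M N (Y N)"
    and initial: "\<And>N. 2 \<le> N \<Longrightarrow> AE \<omega> in M. \<forall>i<N. Y N 0 \<omega> i = X i \<omega>"
  defines "W \<equiv> \<lambda>N \<omega>. \<Sum>i<N. X i \<omega>" and "\<mu>N \<equiv> \<lambda>N \<omega> t. empirical N (Y N t \<omega>)"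
    and "\<mu> \<equiv> \<lambda>_ :: real. exponential_law m"
  shows "continuous_map (top_of_set {0..}) weak_topology \<mu>"
    and "solves_kinetic_equation \<infinity> (exponential_law m) \<mu>"
    and "skorokhod_tendsto_in_prob M \<mu>N \<mu>"
    and "\<And>g t. g \<in> C_b \<Longrightarrow> 0 \<le> t \<Longrightarrow>
      tendsto_in_prob M (\<lambda>N \<omega>. SUP s\<in>{0..t}. (LINT x|\<mu>N N \<omega> s. g x) - (LINT x|\<mu> s. g x)) 0"
    and "\<And>g t. g \<in> C_b \<Longrightarrow> 0 \<le> t \<Longrightarrow>
      tendsto_in_prob M (\<lambda>N \<omega>. SUP s\<in>{0..t}. \<bar>martingale_term N (W N \<omega>) g (\<mu>N N \<omega>) s\<bar>) 0"
    and "\<And>g t. g \<in> C_b \<Longrightarrow> 0 \<le> t \<Longrightarrow>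
      tendsto_in_prob M (\<lambda>N \<omega>. LINT s:{0..t}|lborel. collision_N N (W N \<omega>) g (\<mu>N N \<omega> s))
        (LINT s:{0..t}|lborel. collision \<infinity> g (\<mu> s))"
proof -
  interpret exchange_sequence M Y "exponential_law m"
    by (rule exponential_exchange_sequence[OF M m indep law Y initial])
  have W: "AE \<omega> in M. W N \<omega> = (\<Sum>i<N. Y N 0 \<omega> i)" if "2 \<le> N" for N
    using initial[OF that] by eventually_elim (simp add: W_def)
  have C_b: "\<exists>B. \<forall>x\<ge>0. \<bar>g x\<bar> \<le> B" "g \<in> borel_measurable Rplus" if "g \<in> C_b" for g
    using C_b_D[OF that] by auto
  have collision_0: "collision \<infinity> g (exponential_law m) = 0" if g: "g \<in> C_b" for g
  proof -
    obtain B where "\<forall>x\<ge>0. \<bar>g x\<bar> \<le> B" using C_b(1)[OF g] by blast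
    then show ?thesis by (intro collision_invariant[OF invariant C_b(2)[OF g], of B]) simp
  qed
  show "continuous_map (top_of_set {0..}) weak_topology \<mu>"
    unfolding \<mu>_def using \<mu>_prob by (simp add: topspace_weak_topology)
  show "solves_kinetic_equation \<infinity> (exponential_law m) \<mu>"
    unfolding solves_kinetic_equation_def \<mu>_def using \<mu>_prob
    by (simp add: collision_0 set_integrable_def set_lebesgue_integral_def)
  show "skorokhod_tendsto_in_prob M \<mu>N \<mu>"
    unfolding \<mu>N_def \<mu>_def by (rule skorokhod_tendsto)
  fix g and t :: real assume g: "g \<in> C_b" and t: "0 \<le> t"
  obtain B where B: "\<And>x. 0 \<le> x \<Longrightarrow> \<bar>g x\<bar> \<le> B" using C_b(1)[OF g] by blast
  note gm = C_b(2)[OF g]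
  show "tendsto_in_prob M (\<lambda>N \<omega>. SUP s\<in>{0..t}. (LINT x|\<mu>N N \<omega> s. g x) - (LINT x|\<mu> s. g x)) 0"
    unfolding \<mu>N_def \<mu>_def by (rule empirical_mean_tendsto[OF gm B t])
  show "tendsto_in_prob M (\<lambda>N \<omega>. SUP s\<in>{0..t}. \<bar>martingale_term N (W N \<omega>) g (\<mu>N N \<omega>) s\<bar>) 0"
    unfolding \<mu>N_def by (rule martingale_tendsto[OF gm B t W])
  have "(LINT s:{0..t}|lborel. collision \<infinity> g (\<mu> s)) = 0"
    unfolding \<mu>_def by (simp add: collision_0[OF g] set_lebesgue_integral_def)
  then show "tendsto_in_prob M (\<lambda>N \<omega>. LINT s:{0..t}|lborel. collision_N N (W N \<omega>) g (\<mu>N N \<omega> s))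
      (LINT s:{0..t}|lborel. collision \<infinity> g (\<mu> s))"
    unfolding \<mu>N_def using collision_integral_tendsto[OF gm B t W] by simp
qed

theorem proposition2p8:
  shows
    "(\<forall>(M :: 'w measure) (m0 :: real) (X :: nat \<Rightarrow> 'w \<Rightarrow> real)
        (Y :: nat \<Rightarrow> real \<Rightarrow> 'w \<Rightarrow> nat \<Rightarrow> real)
        (W :: nat \<Rightarrow> 'w \<Rightarrow> real) (\<mu>0 :: real measure)
        (\<mu>N :: nat \<Rightarrow> 'w \<Rightarrow> real \<Rightarrow> real measure).
        prob_space M \<and> 0 < m0 \<and>
        prob_space.indep_vars M (\<lambda>_. borel) X UNIV \<and>
        (\<forall>i. distributed M lborel (X i) (exponential_density (1 / m0))) \<and>
        (\<forall>N\<ge>2. wealth_exchange_process M N (Y N) \<and>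
           (AE \<omega> in M. \<forall>i<N. Y N 0 \<omega> i = X i \<omega>)) \<and>
        W = (\<lambda>N \<omega>. \<Sum>i<N. X i \<omega>) \<and>
        \<mu>0 = density (restrict_space lborel {0..}) (\<lambda>x. ennreal (1 / m0 * exp (- x / m0))) \<and>
        \<mu>N = (\<lambda>N \<omega> t. empirical N (Y N t \<omega>))
      \<longrightarrow>
        (AE \<omega> in M. filterlim (\<lambda>N. W N \<omega>) at_top sequentially) \<and>
        (AE \<omega> in M. limitin weak_topology (\<lambda>N. empirical N (\<lambda>i. X i \<omega>)) \<mu>0 sequentially) \<and>
        (\<exists>\<mu>. continuous_map (top_of_set {0..}) weak_topology \<mu> \<and>
           solves_kinetic_equation \<infinity> \<mu>0 \<mu> \<and>
           skorokhod_tendsto_in_prob M \<mu>N \<mu> \<and>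
           (\<forall>g\<in>C_b. \<forall>t\<ge>0.
              tendsto_in_prob M
                (\<lambda>N \<omega>. SUP s\<in>{0..t}. (LINT x|\<mu>N N \<omega> s. g x) - (LINT x|\<mu> s. g x)) 0 \<and>
              tendsto_in_prob M
                (\<lambda>N \<omega>. SUP s\<in>{0..t}. \<bar>martingale_term N (W N \<omega>) g (\<mu>N N \<omega>) s\<bar>) 0 \<and>
              tendsto_in_prob M
                (\<lambda>N \<omega>. LINT s:{0..t}|lborel. collision_N N (W N \<omega>) g (\<mu>N N \<omega> s))
                (LINT s:{0..t}|lborel. collision \<infinity> g (\<mu> s))) \<and>
           (\<forall>t\<ge>0. \<mu> t = \<mu>0)))
     \<and>
     (\<forall>(W :: nat \<Rightarrow> real) (w0 :: real). W \<longlonglongrightarrow> w0 \<and> 0 < w0 \<longrightarrow>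
        \<not> (\<exists>(\<nu> :: nat \<Rightarrow> real measure) (m :: real). 0 < m \<and>
             (\<forall>N\<ge>2. is_empirical_measure N (W N) (\<nu> N)) \<and>
             limitin weak_topology \<nu>
               (density (restrict_space lborel {0..})
                  (\<lambda>x. ennreal (exp (- x / m) / (m * (1 - exp (- w0 / m))) * indicator {..w0} x)))
               sequentially))"
proof (intro conjI allI impI, goal_cases)
  case (1 M m0 X Y W \<mu>0 \<mu>N)
  then have hyps: "prob_space M" "0 < m0" "prob_space.indep_vars M (\<lambda>_. borel) X UNIV"
      "distributed M lborel (X i) (exponential_density (1 / m0))"
    and W: "W = (\<lambda>N \<omega>. \<Sum>i<N. X i \<omega>)" for i by (elim conjE, blast)+
  show ?case unfolding W by (rule exponential_total_wealth_at_top[OF hyps])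
next
  case (2 M m0 X Y W \<mu>0 \<mu>N)
  then have hyps: "prob_space M" "0 < m0" "prob_space.indep_vars M (\<lambda>_. borel) X UNIV"
      "distributed M lborel (X i) (exponential_density (1 / m0))"
    and \<mu>0: "\<mu>0 = exponential_law m0" for i unfolding exponential_law_def by (elim conjE, blast)+
  show ?case unfolding \<mu>0 by (rule exponential_empirical_limitin[OF hyps])
next
  case (3 M m0 X Y W \<mu>0 \<mu>N)
  then have hyps: "prob_space M" "0 < m0" "prob_space.indep_vars M (\<lambda>_. borel) X UNIV"
      "distributed M lborel (X i) (exponential_density (1 / m0))"
      "2 \<le> N \<Longrightarrow> wealth_exchange_process M N (Y N)"
      "2 \<le> N \<Longrightarrow> AE \<omega> in M. \<forall>i<N. Y N 0 \<omega> i = X i \<omega>"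
    and W: "W = (\<lambda>N \<omega>. \<Sum>i<N. X i \<omega>)" and \<mu>N: "\<mu>N = (\<lambda>N \<omega> t. empirical N (Y N t \<omega>))"
    and \<mu>0: "\<mu>0 = exponential_law m0" for i N
    unfolding exponential_law_def by (elim conjE, blast)+
  note limit = exponential_mean_field_limit[OF hyps]
  show ?case unfolding W \<mu>N \<mu>0
    by (intro exI[of _ "\<lambda>_. exponential_law m0"] conjI ballI allI impI limit refl) simp_all
next
  case (4 W w0)
  show ?case
  proof (safe)
    fix \<nu> :: "nat \<Rightarrow> real measure" and m :: real
    assume "\<forall>N\<ge>2. is_empirical_measure N (W N) (\<nu> N)"
      and lim: "limitin weak_topology \<nu> (density (restrict_space lborel {0..})
        (\<lambda>x. ennreal (exp (- x / m) / (m * (1 - exp (- w0 / m))) * indicator {..w0} x))) sequentially"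
    then have emp: "is_empirical_measure N (W N) (\<nu> N)" if "2 \<le> N" for N using that by blast
    have "(\<lambda>x. ennreal (exp (- x / m) / (m * (1 - exp (- w0 / m))) * indicator {..w0} x))
        \<in> borel_measurable (restrict_space lborel {0..})"
      by (intro measurable_restrict_space1) measurable
    from no_empirical_limit_with_density[OF _ emp this, of w0] show False
      using 4 lim by blast
  qed
qed

end
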